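(* Let $\Omega\subset\mathbb{R}^3$ and consider the BDDC algorithm with a change of basis formulation for the set of primal constraints chosen adaptively on all faces and edges with a given tolerance $\lambda_{TOL}$, as described in the context. Then $$\kappa\big(M_{BDDC,a}^{-1}\,\widetilde R^T\widetilde S_a\widetilde R\big)\le C\,\lambda_{TOL},$$ where $M_{BDDC,a}^{-1}=\widetilde R^T\widetilde D\,\widetilde S_a^{-1}\widetilde D^T\widetilde R$ and $C$ is a constant depending only on the numbers $N_{F(i)}$ of faces per subdomain, $N_{E(i)}$ of edges per subdomain, and $N_{I(E)}$ of subdomains sharing an edge $E$; explicitly $$C=8\max\Big\{\max_i N_{F(i)}^2,\ \max_i\Big(N_{E(i)}^2\max_{E\in E(i)}N_{I(E)}\Big)\Big\}.$$
   Context: **Discretization.** $\Omega\subset\mathbb{R}^3$ is a bounded domain, $\rho$ is a uniformly positive coefficient (otherwise arbitrary, possibly highly varying), and $V_h$ is the space of conforming piecewise linear finite element functions on a given mesh of $\Omega$ vanishing on $\partial\Omega$. $\Omega$ is partitioned into non-overlapping subdomains $\Omega_1,\dots,\Omega_N$ that are unions of mesh elements. $X_i$ is the restriction of $V_h$ to $\Omega_i$ and $A^{(i)}$ is the matrix of $a_i(u,v)=\int_{\Omega_i}\rho\nabla u\cdot\nabla v\,dx$ on $X_i$. $W_i$ is the restriction of $X_i$ to $\partial\Omega_i$ (functions are identified with coefficient vectors), and $S^{(i)}$ is the Schur complement of $A^{(i)}$ obtained by eliminating the unknowns interior to $\Omega_i$. **Interface classes.** Interface nodes (not on $\partial\Omega$)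 are grouped into faces $F$ (equivalence classes shared by exactly two subdomains), edges $E$ (shared by more than two subdomains) and vertices (end points of edges). $F(i)$, $E(i)$ are the sets of faces and edges of $\partial\Omega_i$, with $N_{F(i)}=|F(i)|$, $N_{E(i)}=|E(i)|$. $I(E)$ is the set of indices of the subdomains sharing $E$, and $N_{I(E)}=|I(E)|$. For $w^{(i)}\in W_i$, $w_F^{(i)}$ and $w_E^{(i)}$ are its unknowns interior to $F$ and $E$. **Local matrices and scalings.** $S_F^{(i)}$, $S_E^{(i)}$ are the diagonal blocks of $S^{(i)}$ for the unknowns interior to $F$, $E$; $\widetilde S_F^{(i)}$, $\widetilde S_E^{(i)}$ are the Schur complements of $S^{(i)}$ after eliminating all unknowns except those interior to $F$, $E$. Scaling matrices $D_F^{(l)}$, $D_E^{(l)}$ and scalars $D_V^{(l)}$ at vertices $V$ satisfy the partition of unity: $D_F^{(i)}+D_F^{(j)}=I$ for $F$ shared by $\Omega_i,\Omega_j$; $\sum_{l\in I(E)}D_E^{(l)}=I$; $\sum_l D_V^{(l)}=1$ over the subdomains sharing $V$. For symmetric positive semidefinite $A,B$, the parallel sum is $A:B=B(A+B)^+A$, with $^+$ a pseudo-inverse. **Generalized eigenvalue problems.** For a face $F$ shared by $\Omega_i,\Omega_j$: $A_Fv=\lambda(\widetilde S_F^{(i)}:\widetilde S_F^{(j)})v$ with $A_F=(D_F^{(j)})^TS_F^{(i)}D_F^{(j)}+(D_F^{(i)})^TS_F^{(j)}D_F^{(i)}$. For an edge $E$: $A_Ev=\lambda\widetilde S_Ev$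 with $A_E=\sum_{m\in I(E)}\sum_{l\in I(E)\setminus\{m\}}(D_E^{(l)})^TS_E^{(m)}D_E^{(l)}$ and $\widetilde S_E$ the parallel sum of all $\widetilde S_E^{(m)}$, $m\in I(E)$. $A_F$, $A_E$ are symmetric positive definite; eigenvalues lie in $(0,\infty]$, with $\lambda=\infty$ for vectors in the kernel of the right-hand matrix. On each $F$ (resp. $E$) a full basis of eigenvectors, orthonormal for $\langle A_F\cdot,\cdot\rangle$ (resp. $\langle A_E\cdot,\cdot\rangle$), is fixed. Selected eigenvectors: those with eigenvalue $\ge\lambda_{TOL}$ on faces and $>\lambda_{TOL}$ on edges. $P_F$ (resp. $P_E$) is the matrix whose columns are all eigenvectors, selected ones first. **Change of basis.** In every $W_i$ the nodal coordinates on each $F$ and $E$ are replaced by coordinates in the bases given by the columns of $P_F$, $P_E$; the matrices $S^{(i)}$ are transformed accordingly, and the scalings become $P_F^{-1}D_F^{(i)}P_F$, $P_E^{-1}D_E^{(i)}P_E$. $D_i$ is the block diagonal matrix on $W_i$ formed by these blocks and the $D_V^{(i)}$. Primal unknowns: the vertex values and the coordinates of the selected eigenvectors; all other interface coordinates are dual. $\widehat W$ is the fully coupled space (one copy of every interface coordinate). $\widetilde W_a=W_\Delta\times\widehat W_\Pi$ is the partially coupled space: one common copy of each primal unknown and a separate copy of each dual unknown for every subdomain containing it. $\widetilde R_i:\widetilde W_a\to W_i$ is coordinate restriction; $\widetilde R:\widehat W\to\widetilde W_a$ copies each dual coordinate to all subdomains sharing it and is the identity on primal ones. Then $\widetilde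 S_a=\sum_{i=1}^N\widetilde R_i^TS^{(i)}\widetilde R_i$, which is invertible, and $\widetilde D=\sum_{i=1}^N\widetilde R_i^TD_i\widetilde R_i$. $\kappa$ denotes the ratio of the largest to the smallest eigenvalue.
   Formalization: The formal theorem additionally assumes 1 ≤ C·λ_TOL; for λ_TOL < 1 every eigenvector is selected and κ = 1, so the stated bound fails when C·λ_TOL < 1. This also excludes an empty interface, where κ is undefined. *)

theory Defs
  imports "HOL-Analysis.Analysis"
begin

text \<open>The sizes of the matrices depend on the mesh, so a matrix is a function of a row index and a
  column index, and every operation names the finite set it sums over. Entries outside the index
  sets are irrelevant.\<close>

type_synonym ('a, 'b) matx = "'a \<Rightarrow> 'b \<Rightarrow> real"

definition mvec :: "'b set \<Rightarrow> ('a, 'b) matx \<Rightarrow> ('b \<Rightarrow> real) \<Rightarrow> 'a \<Rightarrow> real" where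
  "mvec J A v = (\<lambda>i. \<Sum>j\<in>J. A i j * v j)"

definition mmult :: "'b set \<Rightarrow> ('a, 'b) matx \<Rightarrow> ('b, 'c) matx \<Rightarrow> ('a, 'c) matx" where
  "mmult J A B = (\<lambda>i k. \<Sum>j\<in>J. A i j * B j k)"

definition madd :: "('a, 'b) matx \<Rightarrow> ('a, 'b) matx \<Rightarrow> ('a, 'b) matx" where
  "madd A B = (\<lambda>i j. A i j + B i j)"

definition mtrans :: "('a, 'b) matx \<Rightarrow> ('b, 'a) matx" where
  "mtrans A = (\<lambda>i j. A j i)"

definition mone :: "('a, 'a) matx" where
  "mone = (\<lambda>i j. if i = j then 1 else 0)"

definition meq :: "'a set \<Rightarrow> 'b set \<Rightarrow> ('a, 'b) matx \<Rightarrow> ('a, 'b) matx \<Rightarrow> bool" where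
  "meq I J A B \<longleftrightarrow> (\<forall>i\<in>I. \<forall>j\<in>J. A i j = B i j)"

text \<open>Inverse of a matrix with row set \<open>I\<close> and column set \<open>J\<close>; its entries on \<open>J \<times> I\<close> are
  determined whenever an inverse exists.\<close>

definition minverse :: "'a set \<Rightarrow> 'b set \<Rightarrow> ('a, 'b) matx \<Rightarrow> ('b, 'a) matx" where
  "minverse I J A =
     (SOME X. meq J J (mmult I X A) mone \<and> meq I I (mmult J A X) mone)"

text \<open>Moore--Penrose pseudo-inverse of a square matrix.\<close>

definition pinverse :: "'a set \<Rightarrow> ('a, 'a) matx \<Rightarrow> ('a, 'a) matx" where
  "pinverse I A =
     (SOME X. meq I I (mmult I A (mmult I X A)) A
            \<and> meq I I (mmult I X (mmult I A X)) X
            \<and> meq I I (mtrans (mmult I A X)) (mmult I A X)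
            \<and> meq I I (mtrans (mmult I X A)) (mmult I X A))"

definition parallel_sum :: "'a set \<Rightarrow> ('a, 'a) matx \<Rightarrow> ('a, 'a) matx \<Rightarrow> ('a, 'a) matx" where
  "parallel_sum I A B = mmult I B (mmult I (pinverse I (madd A B)) A)"

text \<open>On positive semidefinite matrices the parallel sum is commutative and associative, so the
  order of the list does not matter.\<close>

fun parallel_sums :: "'a set \<Rightarrow> ('a, 'a) matx list \<Rightarrow> ('a, 'a) matx" where
  "parallel_sums I [] = (\<lambda>i j. 0)"
| "parallel_sums I [A] = A"
| "parallel_sums I (A # B # As) = parallel_sum I A (parallel_sums I (B # As))"

text \<open>Schur complement after elimination of the unknowns in \<open>L\<close>, to be read on the remaining
  indices. The pseudo-inverse is the inverse if the eliminated block is nonsingular; for positive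
  semidefinite matrices it is the usual extension to a singular eliminated block.\<close>

definition schur_complement :: "'a set \<Rightarrow> ('a, 'a) matx \<Rightarrow> ('a, 'a) matx" where
  "schur_complement L A = (\<lambda>i j. A i j - mmult L A (mmult L (pinverse L A) A) i j)"

definition eigenvalues_on :: "'a set \<Rightarrow> ('a, 'a) matx \<Rightarrow> real set" where
  "eigenvalues_on I A =
     {\<mu>. \<exists>v. (\<exists>i\<in>I. v i \<noteq> 0) \<and> (\<forall>i\<in>I. mvec I A v i = \<mu> * v i)}"

text \<open>Meant for matrices with positive real spectrum, such as a product of two symmetric positive
  definite matrices.\<close>

definition cond_number :: "'a set \<Rightarrow> ('a, 'a) matx \<Rightarrow> real" where
  "cond_number I A = Max (eigenvalues_on I A) / Min (eigenvalues_on I A)"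

text \<open>\<open>A v = \<mu> B v\<close>, where \<open>\<mu> = \<infinity>\<close> stands for \<open>B v = 0\<close>.\<close>

definition gen_eigenpair ::
  "'a set \<Rightarrow> ('a, 'a) matx \<Rightarrow> ('a, 'a) matx \<Rightarrow> ereal \<Rightarrow> ('a \<Rightarrow> real) \<Rightarrow> bool" where
  "gen_eigenpair I A B \<mu> v \<longleftrightarrow>
     (\<exists>i\<in>I. v i \<noteq> 0) \<and>
     ((\<mu> = \<infinity> \<and> (\<forall>i\<in>I. mvec I B v i = 0)) \<or>
      (\<exists>r. \<mu> = ereal r \<and> (\<forall>i\<in>I. mvec I A v i = r * mvec I B v i)))"

type_synonym point = "real ^ 3"

text \<open>Subdomains are numbered \<open>1, \<dots>, nsub\<close>, and \<open>submesh i\<close> is the set of mesh elements of the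
  \<open>i\<close>-th one. \<open>class_rel\<close> is the equivalence relation on the interface nodes other than the
  vertices \<open>verts\<close> whose classes are the faces and edges. \<open>scal i C\<close> and \<open>scal_vert i v\<close> are the
  scalings of subdomain \<open>i\<close> on the class \<open>C\<close> and at the vertex \<open>v\<close>. The \<open>k\<close>-th column of
  \<open>eigbasis C\<close>, for \<open>k < card C\<close>, is an eigenvector for the eigenvalue \<open>eigval C k\<close>.\<close>

record bddc =
  dom :: "point set"
  coeff :: "point \<Rightarrow> real"
  mesh :: "point set set"
  nsub :: nat
  submesh :: "nat \<Rightarrow> point set set"
  verts :: "point set"
  class_rel :: "(point \<times> point) set"
  scal :: "nat \<Rightarrow> point set \<Rightarrow> (point, point) matx"
  scal_vert :: "nat \<Rightarrow> point \<Rightarrow> real"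
  eigval :: "point set \<Rightarrow> nat \<Rightarrow> ereal"
  eigbasis :: "point set \<Rightarrow> (point, nat) matx"
  tol :: real

text \<open>The last condition says that the mesh resolves the boundary.\<close>

definition mesh_of :: "point set \<Rightarrow> point set set \<Rightarrow> bool" where
  "mesh_of \<Omega> \<T> \<longleftrightarrow>
     triangulation \<T> \<and> (\<forall>T\<in>\<T>. 3 simplex T) \<and> \<Union>\<T> = closure \<Omega> \<and>
     frontier \<Omega> = \<Union>{S. S \<subseteq> frontier \<Omega> \<and> (\<exists>T\<in>\<T>. S face_of T)}"

definition nodes :: "point set set \<Rightarrow> point set" where
  "nodes \<T> = {x. \<exists>T\<in>\<T>. x extreme_point_of T}"

definition fe_space :: "point set \<Rightarrow> point set set \<Rightarrow> (point \<Rightarrow> real) set" where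
  "fe_space \<Omega> \<T> =
     {u. continuous_on (closure \<Omega>) u \<and>
         (\<forall>T\<in>\<T>. \<exists>g c. \<forall>x\<in>T. u x = g \<bullet> x + c) \<and>
         (\<forall>x\<in>frontier \<Omega>. u x = 0)}"

text \<open>The nodal basis function at a node off the boundary; it is unique on the closure of
  the domain.\<close>

definition nodal_basis :: "point set \<Rightarrow> point set set \<Rightarrow> point \<Rightarrow> point \<Rightarrow> real" where
  "nodal_basis \<Omega> \<T> x =
     (SOME u. u \<in> fe_space \<Omega> \<T> \<and> (\<forall>y\<in>nodes \<T>. u y = (if y = x then 1 else 0)))"

text \<open>Piecewise linear functions have a gradient off the null set of element boundaries.\<close>

definition grad :: "(point \<Rightarrow> real) \<Rightarrow> point \<Rightarrow> point" where
  "grad u x = (THE g. GDERIV u x :> g)"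

definition energy_form ::
  "(point \<Rightarrow> real) \<Rightarrow> point set \<Rightarrow> (point \<Rightarrow> real) \<Rightarrow> (point \<Rightarrow> real) \<Rightarrow> real" where
  "energy_form \<rho> G u v = (LINT x:G|lebesgue. \<rho> x * (grad u x \<bullet> grad v x))"

definition fe_discretization :: "bddc \<Rightarrow> bool" where
  "fe_discretization X \<longleftrightarrow>
     open (dom X) \<and> connected (dom X) \<and> bounded (dom X) \<and> dom X \<noteq> {} \<and>
     coeff X absolutely_integrable_on dom X \<and>
     (\<exists>\<rho>0>0. \<forall>x\<in>dom X. \<rho>0 \<le> coeff X x) \<and>
     mesh_of (dom X) (mesh X) \<and>
     mesh X = (\<Union>i\<in>{1..nsub X}. submesh X i) \<and>
     (\<forall>i\<in>{1..nsub X}. submesh X i \<noteq> {}) \<and>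
     disjoint_family_on (submesh X) {1..nsub X}"

text \<open>The closed subdomain.\<close>

definition subdomain :: "bddc \<Rightarrow> nat \<Rightarrow> point set" where
  "subdomain X i = \<Union>(submesh X i)"

definition local_nodes :: "bddc \<Rightarrow> nat \<Rightarrow> point set" where
  "local_nodes X i = (nodes (mesh X) \<inter> subdomain X i) - frontier (dom X)"

definition boundary_nodes :: "bddc \<Rightarrow> nat \<Rightarrow> point set" where
  "boundary_nodes X i = local_nodes X i \<inter> frontier (subdomain X i)"

definition interior_nodes :: "bddc \<Rightarrow> nat \<Rightarrow> point set" where
  "interior_nodes X i = local_nodes X i - frontier (subdomain X i)"

definition stiffness :: "bddc \<Rightarrow> nat \<Rightarrow> (point, point) matx" where
  "stiffness X i = (\<lambda>x y. energy_form (coeff X) (subdomain X i)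
     (nodal_basis (dom X) (mesh X) x) (nodal_basis (dom X) (mesh X) y))"

definition local_schur :: "bddc \<Rightarrow> nat \<Rightarrow> (point, point) matx" where
  "local_schur X i = schur_complement (interior_nodes X i) (stiffness X i)"

definition interface_nodes :: "bddc \<Rightarrow> point set" where
  "interface_nodes X = (\<Union>i\<in>{1..nsub X}. boundary_nodes X i)"

definition sharing :: "bddc \<Rightarrow> point \<Rightarrow> nat set" where
  "sharing X x = {i \<in> {1..nsub X}. x \<in> frontier (subdomain X i)}"

text \<open>The relation may, but need not, be ``shared by the same subdomains'': it may also separate
  the connected components of such a set of nodes. As an end point of an edge, a vertex is shared
  by more than two subdomains; no other restriction is put on the choice of the vertices.\<close>

definition interface_partition :: "bddc \<Rightarrow> bool" where
  "interface_partition X \<longleftrightarrow>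
     verts X \<subseteq> {x \<in> interface_nodes X. 2 < card (sharing X x)} \<and>
     equiv (interface_nodes X - verts X) (class_rel X) \<and>
     (\<forall>(x, y)\<in>class_rel X. sharing X x = sharing X y)"

definition subdoms :: "bddc \<Rightarrow> point set \<Rightarrow> nat set" where
  "subdoms X C = {i \<in> {1..nsub X}. C \<subseteq> frontier (subdomain X i)}"

definition faces :: "bddc \<Rightarrow> point set set" where
  "faces X = {C \<in> (interface_nodes X - verts X) // class_rel X. card (subdoms X C) = 2}"

definition edges :: "bddc \<Rightarrow> point set set" where
  "edges X = {C \<in> (interface_nodes X - verts X) // class_rel X. 2 < card (subdoms X C)}"

definition faces_of :: "bddc \<Rightarrow> nat \<Rightarrow> point set set" where
  "faces_of X i = {F \<in> faces X. i \<in> subdoms X F}"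

definition edges_of :: "bddc \<Rightarrow> nat \<Rightarrow> point set set" where
  "edges_of X i = {E \<in> edges X. i \<in> subdoms X E}"

definition partition_of_unity :: "bddc \<Rightarrow> bool" where
  "partition_of_unity X \<longleftrightarrow>
     (\<forall>C\<in>faces X \<union> edges X. meq C C (\<lambda>x y. \<Sum>l\<in>subdoms X C. scal X l C x y) mone) \<and>
     (\<forall>v\<in>verts X. (\<Sum>l\<in>sharing X v. scal_vert X l v) = 1)"

text \<open>The edge formula, used for faces as well: for a class shared by exactly two subdomains it is
  the face formula, see the two lemmas below.\<close>

definition eig_lhs :: "bddc \<Rightarrow> point set \<Rightarrow> (point, point) matx" where
  "eig_lhs X C = (\<lambda>x y. \<Sum>m\<in>subdoms X C. \<Sum>l\<in>subdoms X C - {m}.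
     mmult C (mtrans (scal X l C)) (mmult C (local_schur X m) (scal X l C)) x y)"

definition class_schur :: "bddc \<Rightarrow> nat \<Rightarrow> point set \<Rightarrow> (point, point) matx" where
  "class_schur X m C = schur_complement (boundary_nodes X m - C) (local_schur X m)"

definition eig_rhs :: "bddc \<Rightarrow> point set \<Rightarrow> (point, point) matx" where
  "eig_rhs X C = parallel_sums C (map (\<lambda>m. class_schur X m C) (sorted_list_of_set (subdoms X C)))"

lemma eig_lhs_face:
  assumes "subdoms X F = {i, j}" and "i \<noteq> j"
  shows "eig_lhs X F =
    madd (mmult F (mtrans (scal X j F)) (mmult F (local_schur X i) (scal X j F)))
         (mmult F (mtrans (scal X i F)) (mmult F (local_schur X j) (scal X i F)))"
proof -
  have "{i, j} - {i} = {j}" "{i, j} - {j} = {i}"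
    using assms(2) by auto
  then show ?thesis
    using assms by (simp add: eig_lhs_def madd_def fun_eq_iff)
qed

lemma eig_rhs_face:
  assumes "subdoms X F = {i, j}" and "i < j"
  shows "eig_rhs X F = parallel_sum F (class_schur X i F) (class_schur X j F)"
proof -
  have "sorted_list_of_set {i, j} = [i, j]"
    using assms(2) by (auto simp: sorted_list_of_set_insert_remove)
  then show ?thesis
    using assms(1) by (simp add: eig_rhs_def)
qed

definition selected :: "bddc \<Rightarrow> point set \<Rightarrow> nat \<Rightarrow> bool" where
  "selected X C k \<longleftrightarrow>
     (C \<in> faces X \<and> ereal (tol X) \<le> eigval X C k) \<or>
     (C \<in> edges X \<and> ereal (tol X) < eigval X C k)"

definition adaptive_eigenbases :: "bddc \<Rightarrow> bool" where
  "adaptive_eigenbases X \<longleftrightarrow> (\<forall>C\<in>faces X \<union> edges X.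
     (\<forall>k<card C. gen_eigenpair C (eig_lhs X C) (eig_rhs X C)
        (eigval X C k) (\<lambda>x. eigbasis X C x k)) \<and>
     meq {..<card C} {..<card C}
       (mmult C (mtrans (eigbasis X C)) (mmult C (eig_lhs X C) (eigbasis X C))) mone \<and>
     (\<forall>k<card C. \<forall>l<card C. selected X C k \<and> \<not> selected X C l \<longrightarrow> k < l))"

text \<open>Interface coordinates: the value at a vertex, or the coefficient of the \<open>k\<close>-th eigenvector of
  a face or edge.\<close>

datatype coord = Vertex point | Mode "point set" nat

definition local_coords :: "bddc \<Rightarrow> nat \<Rightarrow> coord set" where
  "local_coords X i =
     {Vertex v | v. v \<in> verts X \<and> i \<in> sharing X v} \<union>
     {Mode C k | C k. C \<in> faces X \<union> edges X \<and> i \<in> subdoms X C \<and> k < card C}"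

definition coords :: "bddc \<Rightarrow> coord set" where
  "coords X =
     {Vertex v | v. v \<in> verts X} \<union>
     {Mode C k | C k. C \<in> faces X \<union> edges X \<and> k < card C}"

definition primal_coords :: "bddc \<Rightarrow> coord set" where
  "primal_coords X =
     {Vertex v | v. v \<in> verts X} \<union>
     {Mode C k | C k. C \<in> faces X \<union> edges X \<and> k < card C \<and> selected X C k}"

text \<open>Coordinates of the partially coupled space: \<open>Dual i c\<close> is the copy of \<open>c\<close> that belongs to
  subdomain \<open>i\<close>.\<close>

datatype pcoord = Primal coord | Dual nat coord

definition pcoords :: "bddc \<Rightarrow> pcoord set" where
  "pcoords X =
     {Primal c | c. c \<in> primal_coords X} \<union>
     {Dual i c | i c. i \<in> {1..nsub X} \<and> c \<in> local_coords X i - primal_coords X}"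

fun basis_change :: "bddc \<Rightarrow> (point, coord) matx" where
  "basis_change X x (Vertex v) = (if x = v then 1 else 0)"
| "basis_change X x (Mode C k) = (if x \<in> C then eigbasis X C x k else 0)"

definition transformed_schur :: "bddc \<Rightarrow> nat \<Rightarrow> (coord, coord) matx" where
  "transformed_schur X i = mmult (boundary_nodes X i) (mtrans (basis_change X))
     (mmult (boundary_nodes X i) (local_schur X i) (basis_change X))"

fun transformed_scal :: "bddc \<Rightarrow> nat \<Rightarrow> (coord, coord) matx" where
  "transformed_scal X i (Vertex v) (Vertex w) = (if v = w then scal_vert X i v else 0)"
| "transformed_scal X i (Mode C k) (Mode C' l) =
     (if C = C' then mmult C (minverse C {..<card C} (eigbasis X C))
        (mmult C (scal X i C) (eigbasis X C)) k l else 0)"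
| "transformed_scal X i (Vertex v) (Mode C l) = 0"
| "transformed_scal X i (Mode C k) (Vertex w) = 0"

text \<open>Row set \<open>local_coords X i\<close>, column set \<open>pcoords X\<close>.\<close>

fun R_local :: "nat \<Rightarrow> (coord, pcoord) matx" where
  "R_local i c (Primal c') = (if c = c' then 1 else 0)"
| "R_local i c (Dual j c') = (if i = j \<and> c = c' then 1 else 0)"

text \<open>Row set \<open>pcoords X\<close>, column set \<open>coords X\<close>.\<close>

fun R_tilde :: "(pcoord, coord) matx" where
  "R_tilde (Primal c') c = (if c = c' then 1 else 0)"
| "R_tilde (Dual j c') c = (if c = c' then 1 else 0)"

definition S_tilde :: "bddc \<Rightarrow> (pcoord, pcoord) matx" where
  "S_tilde X = (\<lambda>p q. \<Sum>i\<in>{1..nsub X}.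
     mmult (local_coords X i) (mtrans (R_local i))
       (mmult (local_coords X i) (transformed_schur X i) (R_local i)) p q)"

definition D_tilde :: "bddc \<Rightarrow> (pcoord, pcoord) matx" where
  "D_tilde X = (\<lambda>p q. \<Sum>i\<in>{1..nsub X}.
     mmult (local_coords X i) (mtrans (R_local i))
       (mmult (local_coords X i) (transformed_scal X i) (R_local i)) p q)"

definition S_hat :: "bddc \<Rightarrow> (coord, coord) matx" where
  "S_hat X = mmult (pcoords X) (mtrans R_tilde) (mmult (pcoords X) (S_tilde X) R_tilde)"

definition M_inv :: "bddc \<Rightarrow> (coord, coord) matx" where
  "M_inv X = mmult (pcoords X) (mtrans R_tilde) (mmult (pcoords X) (D_tilde X)
     (mmult (pcoords X) (minverse (pcoords X) (pcoords X) (S_tilde X))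
       (mmult (pcoords X) (mtrans (D_tilde X)) R_tilde)))"

text \<open>If a subdomain has no edges, the inner maximum ranges over the empty set, but its factor
  is \<open>0\<close>.\<close>

definition bddc_const :: "bddc \<Rightarrow> real" where
  "bddc_const X = 8 * real (max
     (Max ((\<lambda>i. (card (faces_of X i))\<^sup>2) ` {1..nsub X}))
     (Max ((\<lambda>i. (card (edges_of X i))\<^sup>2 * Max ((\<lambda>E. card (subdoms X E)) ` edges_of X i))
        ` {1..nsub X})))"

text \<open>A bound \<open>bddc_const X * tol X\<close> on the condition number can only hold if
  \<open>1 \<le> bddc_const X * tol X\<close>, because a condition number is at least \<open>1\<close>. This excludes very small
  tolerances: all eigenvalues are at least \<open>1\<close>, so for \<open>tol X < 1\<close> everything is primal and the
  condition number is \<open>1\<close>, however small \<open>tol X\<close> is. It also excludes an empty interface.\<close>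

end

theory Submission
  imports Defs
begin

text \<open>Write S for the partially coupled matrix \<open>S_tilde\<close>, R for \<open>R_tilde\<close>, D for \<open>D_tilde\<close> and
\<open>|w|\<close> for the S-norm. The averaging operator \<open>E = R R\<^sup>T D\<close> is a projection, because the scalings form a
partition of unity, \<open>R\<^sup>T D R = I\<close>. Let \<lambda> be an eigenvalue of the preconditioned operator with
eigenvector v, and put \<open>z = R v\<close> and \<open>w = S\<^sup>-\<^sup>1 D\<^sup>T R (R\<^sup>T S R) v\<close>. Then z is the
S-orthogonal projection of w to the range of R, \<open>E w = \<lambda> z\<close>, and with \<open>|z| = 1\<close> one has
\<open>|w|\<^sup>2 = \<lambda>\<close>. Hence \<open>\<lambda> \<ge> 1\<close>, and the vector \<open>x = w - z\<close> satisfies \<open>|x|\<^sup>2 = \<lambda> - 1\<close> and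
\<open>|x - E x|\<^sup>2 = \<lambda> (\<lambda> - 1)\<close>. So a bound \<open>|x - E x|\<^sup>2 \<le> K |x|\<^sup>2\<close> for the jump operator \<open>I - E\<close> gives
\<open>\<lambda> \<le> K\<close> and with it the condition number bound (\<open>bddc_condition_number\<close>).

The jump bound is local. On a face or edge C the jump in subdomain i is the sum of
\<open>D\<^sup>(\<^sup>l\<^sup>) (z\<^sub>i - z\<^sub>l)\<close> over the other subdomains l of C, where \<open>z\<^sub>i\<close> is the component of the local
function in the eigenvectors that were not selected (\<open>jump_class\<close>, \<open>nodal_difference_dual\<close>). The energies
of the \<open>D\<^sup>(\<^sup>l\<^sup>) z\<^sub>i\<close> and \<open>D\<^sup>(\<^sup>l\<^sup>) z\<^sub>l\<close> that occur are parts of the left-hand form of the eigenvalue problem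
(\<open>scaled_jump_energy\<close>), an unselected component is bounded by the tolerance times the energy of the
right-hand matrix (\<open>small_eigenvalue_coefficients\<close>), and the latter is a parallel sum of Schur complements, so
it lies below the energy of each subdomain (\<open>parallel_sums_psd\<close>, \<open>schur_complement_le\<close>). Summation over the
classes with the Cauchy--Schwarz inequality gives the constant (\<open>weighted_class_count\<close>, \<open>jump_bound\<close>).

The matrix S is positive definite (\<open>pd_S_tilde\<close>): a vector of zero energy has no dual component, by the
estimate of the unselected components, so it is a function on the whole interface. Its extensions of zero
energy to the subdomains fit together to a finite element function on the domain with gradient zero that
vanishes on the boundary (\<open>zero_energy_imp_zero\<close>).\<close>

section \<open>Vectors, quadratic forms and orthonormal families\<close>

definition ip :: "'a set \<Rightarrow> ('a \<Rightarrow> real) \<Rightarrow> ('a \<Rightarrow> real) \<Rightarrow> real" where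
  "ip I u v = (\<Sum>i\<in>I. u i * v i)"

definition qf :: "'a set \<Rightarrow> ('a, 'a) matx \<Rightarrow> ('a \<Rightarrow> real) \<Rightarrow> real" where
  "qf I A v = ip I v (mvec I A v)"

definition symmetric_on :: "'a set \<Rightarrow> ('a, 'a) matx \<Rightarrow> bool" where
  "symmetric_on I A \<longleftrightarrow> (\<forall>i\<in>I. \<forall>j\<in>I. A i j = A j i)"

definition psd_on :: "'a set \<Rightarrow> ('a, 'a) matx \<Rightarrow> bool" where
  "psd_on I A \<longleftrightarrow> symmetric_on I A \<and> (\<forall>v. 0 \<le> qf I A v)"

definition orthonormal_on :: "'a set \<Rightarrow> 'k set \<Rightarrow> ('k \<Rightarrow> 'a \<Rightarrow> real) \<Rightarrow> bool" where
  "orthonormal_on I K u \<longleftrightarrow>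
     (\<forall>j\<in>K. \<forall>k\<in>K. ip I (u j) (u k) = (if j = k then 1 else 0))"

lemma ip_commute: "ip I u v = ip I v u"
  by (simp add: ip_def mult.commute)

lemma ip_cong:
  assumes "\<And>i. i \<in> I \<Longrightarrow> u i = u' i" and "\<And>i. i \<in> I \<Longrightarrow> v i = v' i"
  shows "ip I u v = ip I u' v'"
  unfolding ip_def using assms by (intro sum.cong) auto

lemma ip_add_left: "ip I (\<lambda>i. u i + v i) w = ip I u w + ip I v w"
  by (simp add: ip_def algebra_simps sum.distrib)

lemma ip_add_right: "ip I w (\<lambda>i. u i + v i) = ip I w u + ip I w v"
  by (simp add: ip_def algebra_simps sum.distrib)

lemma ip_diff_left: "ip I (\<lambda>i. u i - v i) w = ip I u w - ip I v w"
  by (simp add: ip_def algebra_simps sum_subtractf)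

lemma ip_diff_right: "ip I w (\<lambda>i. u i - v i) = ip I w u - ip I w v"
  by (simp add: ip_def algebra_simps sum_subtractf)

lemma ip_scale_left: "ip I (\<lambda>i. c * u i) w = c * ip I u w"
  by (simp add: ip_def sum_distrib_left algebra_simps)

lemma ip_scale_right: "ip I w (\<lambda>i. c * u i) = c * ip I w u"
  by (simp add: ip_def sum_distrib_left algebra_simps)

lemma ip_sum_left: "ip I (\<lambda>i. \<Sum>k\<in>K. u k i) w = (\<Sum>k\<in>K. ip I (u k) w)"
  unfolding ip_def by (subst sum.swap) (simp add: sum_distrib_right)

lemma ip_sum_right: "ip I w (\<lambda>i. \<Sum>k\<in>K. u k i) = (\<Sum>k\<in>K. ip I w (u k))"
  unfolding ip_def by (subst sum.swap) (simp add: sum_distrib_left)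

lemmas ip_linear = ip_add_left ip_add_right ip_diff_left ip_diff_right
  ip_scale_left ip_scale_right ip_sum_left ip_sum_right

lemma ip_self_nonneg: "0 \<le> ip I v v"
  by (simp add: ip_def sum_nonneg)

lemma ip_self_eq_0: "finite I \<Longrightarrow> ip I v v = 0 \<longleftrightarrow> (\<forall>i\<in>I. v i = 0)"
  by (simp add: ip_def sum_nonneg_eq_0_iff)

lemma mvec_cong:
  assumes "\<And>i. i \<in> J \<Longrightarrow> v i = v' i"
  shows "mvec J A v i = mvec J A v' i"
  unfolding mvec_def using assms by (intro sum.cong) auto

lemma mvec_add: "mvec J A (\<lambda>j. u j + v j) = (\<lambda>i. mvec J A u i + mvec J A v i)"
  by (simp add: mvec_def algebra_simps sum.distrib)

lemma mvec_diff: "mvec J A (\<lambda>j. u j - v j) = (\<lambda>i. mvec J A u i - mvec J A v i)"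
  by (simp add: mvec_def algebra_simps sum_subtractf)

lemma mvec_scale: "mvec J A (\<lambda>j. c * u j) = (\<lambda>i. c * mvec J A u i)"
  by (simp add: mvec_def sum_distrib_left algebra_simps)

lemma mvec_sum: "mvec J A (\<lambda>j. \<Sum>k\<in>K. u k j) = (\<lambda>i. \<Sum>k\<in>K. mvec J A (u k) i)"
  unfolding mvec_def by (simp add: sum_distrib_left) (subst sum.swap, rule refl)

lemmas mvec_linear = mvec_add mvec_diff mvec_scale mvec_sum

lemma mvec_mmult: "mvec K (mmult J A B) v = mvec J A (mvec K B v)"
  unfolding mvec_def mmult_def
  by (auto simp: sum_distrib_left sum_distrib_right mult.assoc intro: sum.swap)

lemma mvec_madd: "mvec J (madd A B) v = (\<lambda>i. mvec J A v i + mvec J B v i)"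
  by (simp add: mvec_def madd_def algebra_simps sum.distrib)

lemma mvec_matrix_sum: "mvec J (\<lambda>i j. \<Sum>k\<in>K. A k i j) v = (\<lambda>i. \<Sum>k\<in>K. mvec J (A k) v i)"
  unfolding mvec_def by (simp add: sum_distrib_right) (subst sum.swap, rule refl)

lemma mvec_mone: "finite I \<Longrightarrow> i \<in> I \<Longrightarrow> mvec I mone v i = v i"
  unfolding mvec_def mone_def by (subst sum.cong[OF refl, of _ _ "\<lambda>j. if i = j then v j else 0"]) auto

lemma meq_mvec: "meq I J A B \<Longrightarrow> i \<in> I \<Longrightarrow> mvec J A v i = mvec J B v i"
  unfolding mvec_def meq_def by (intro sum.cong) auto

lemma ip_adjoint: "ip I u (mvec J A v) = ip J (mvec I (mtrans A) u) v"
  unfolding ip_def mvec_def mtrans_def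
  by (simp add: sum_distrib_left sum_distrib_right, subst sum.swap) (simp add: mult_ac)

lemma ip_adjoint_mtrans: "ip I u (mvec J (mtrans A) v) = ip J (mvec I A u) v"
  by (subst ip_adjoint) (simp add: mtrans_def)

lemma ip_symmetric:
  assumes "symmetric_on I A"
  shows "ip I u (mvec I A v) = ip I (mvec I A u) v"
proof -
  have "mvec I (mtrans A) u i = mvec I A u i" if "i \<in> I" for i
    using assms that by (auto simp: mvec_def mtrans_def symmetric_on_def intro!: sum.cong)
  then show ?thesis
    by (subst ip_adjoint) (auto intro: ip_cong)
qed

lemma qf_cong:
  assumes "\<And>i. i \<in> I \<Longrightarrow> v i = v' i"
  shows "qf I A v = qf I A v'"
  unfolding qf_def using assms by (intro ip_cong mvec_cong) auto

lemma unit_vector_sum: "finite I \<Longrightarrow> i \<in> I \<Longrightarrow> (\<Sum>j\<in>I. (if j = i then 1 else 0) * f j) = (f i :: real)"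
  by (subst sum.cong[OF refl, of _ _ "\<lambda>j. if j = i then f j else 0"]) auto

lemma ip_unit_left: "finite I \<Longrightarrow> i \<in> I \<Longrightarrow> ip I (\<lambda>j. if j = i then 1 else 0) v = v i"
  by (simp add: ip_def unit_vector_sum)

lemma ip_unit_right: "finite I \<Longrightarrow> i \<in> I \<Longrightarrow> ip I v (\<lambda>j. if j = i then 1 else 0) = v i"
  by (simp add: ip_commute[of I v] ip_unit_left)

lemma mvec_unit: "finite J \<Longrightarrow> j \<in> J \<Longrightarrow> mvec J A (\<lambda>l. if l = j then 1 else 0) i = A i j"
  by (simp add: mvec_def mult.commute[of "A i _"] unit_vector_sum)

lemma qf_add:
  assumes "symmetric_on I A"
  shows "qf I A (\<lambda>i. u i + v i) = qf I A u + 2 * ip I u (mvec I A v) + qf I A v"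
  using ip_symmetric[OF assms, of v u]
  by (simp add: qf_def mvec_linear ip_linear ip_commute[of I "mvec I A v" u])

lemma qf_scale: "qf I A (\<lambda>i. c * v i) = c\<^sup>2 * qf I A v"
  by (simp add: qf_def mvec_linear ip_linear power2_eq_square)

lemma symmetricI_bilinear:
  assumes "finite I" and "\<And>u v. ip I u (mvec I A v) = ip I v (mvec I A u)"
  shows "symmetric_on I A"
  unfolding symmetric_on_def
proof (intro ballI)
  fix i j assume "i \<in> I" "j \<in> I"
  then show "A i j = A j i"
    using assms(2)[of "\<lambda>l. if l = i then 1 else 0" "\<lambda>l. if l = j then 1 else 0"] \<open>finite I\<close>
    by (simp add: ip_unit_left mvec_unit)
qed

text \<open>Pythagoras for the part of a vector that is orthogonal to an orthonormal family. Bessel's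
inequality and the two counting lemmas below replace dimension theory: the index set has no vector space
type of its own.\<close>

lemma norm_residual:
  assumes "orthonormal_on I K u" and "finite K"
  defines "r \<equiv> \<lambda>v i. v i - (\<Sum>k\<in>K. ip I (u k) v * u k i)"
  shows "ip I (r v) (r v) = ip I v v - (\<Sum>k\<in>K. (ip I (u k) v)\<^sup>2)"
    and "k \<in> K \<Longrightarrow> ip I (u k) (r v) = 0"
proof -
  have orth: "ip I (u k) (r v) = 0" if "k \<in> K" for k
  proof -
    have "(\<Sum>j\<in>K. ip I (u j) v * ip I (u k) (u j)) = (\<Sum>j\<in>K. if j = k then ip I (u k) v else 0)"
      using assms(1) that by (intro sum.cong) (auto simp: orthonormal_on_def)
    then show ?thesis
      using that \<open>finite K\<close> by (simp add: r_def ip_linear)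
  qed
  then show "k \<in> K \<Longrightarrow> ip I (u k) (r v) = 0" .
  have "ip I (r v) (r v) = ip I v (r v) - (\<Sum>k\<in>K. ip I (u k) v * ip I (u k) (r v))"
    by (subst (1) r_def) (simp add: ip_linear)
  also have "\<dots> = ip I v (r v)"
    using orth by simp
  also have "\<dots> = ip I v v - (\<Sum>k\<in>K. (ip I (u k) v)\<^sup>2)"
    by (simp add: r_def ip_linear ip_commute[of I v "u _"] power2_eq_square)
  finally show "ip I (r v) (r v) = ip I v v - (\<Sum>k\<in>K. (ip I (u k) v)\<^sup>2)" .
qed

lemma bessel:
  assumes "orthonormal_on I K u" and "finite K"
  shows "(\<Sum>k\<in>K. (ip I (u k) v)\<^sup>2) \<le> ip I v v"
  using norm_residual(1)[OF assms, of v] ip_self_nonneg by (smt (verit, best))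

text \<open>Bessel's inequality for the unit vectors bounds each inner sum by \<open>1\<close>, and the
double sum counts the members of the family. So the family has at most as many members as there are indices,
and in case of equality every unit vector lies in its span.\<close>

lemma orthonormal_sum_squares:
  assumes "orthonormal_on I K u" and "finite K" and "finite I"
  shows "(\<Sum>i\<in>I. \<Sum>k\<in>K. (u k i)\<^sup>2) = card K" and "i \<in> I \<Longrightarrow> (\<Sum>k\<in>K. (u k i)\<^sup>2) \<le> 1"
proof -
  have "(\<Sum>i\<in>I. \<Sum>k\<in>K. (u k i)\<^sup>2) = (\<Sum>k\<in>K. ip I (u k) (u k))"
    by (subst sum.swap) (simp add: ip_def power2_eq_square)
  also have "\<dots> = card K"
    using assms(1) by (simp add: orthonormal_on_def)
  finally show "(\<Sum>i\<in>I. \<Sum>k\<in>K. (u k i)\<^sup>2) = card K" .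
  show "(\<Sum>k\<in>K. (u k i)\<^sup>2) \<le> 1" if "i \<in> I"
    using bessel[OF assms(1,2), of "\<lambda>j. if j = i then 1 else 0"] that \<open>finite I\<close>
    by (simp add: ip_unit_right)
qed

lemma orthonormal_card_le:
  assumes "orthonormal_on I K u" and "finite K" and "finite I"
  shows "card K \<le> card I"
proof -
  have "real (card K) \<le> (\<Sum>i\<in>I. 1)"
    unfolding orthonormal_sum_squares(1)[OF assms, symmetric]
    by (intro sum_mono orthonormal_sum_squares(2)[OF assms])
  then show ?thesis by simp
qed

lemma orthonormal_complete:
  assumes "orthonormal_on I K u" and "finite K" and "finite I" and "card K = card I"
    and "i \<in> I" and "j \<in> I"
  shows "(\<Sum>k\<in>K. u k i * u k j) = (if i = j then 1 else 0)"
proof -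
  have "(\<Sum>i\<in>I. 1 - (\<Sum>k\<in>K. (u k i)\<^sup>2)) = 0"
    using orthonormal_sum_squares(1)[OF assms(1-3)] assms(4) by (simp add: sum_subtractf)
  then have eq1: "(\<Sum>k\<in>K. (u k i)\<^sup>2) = 1"
    using sum_nonneg_eq_0_iff[OF \<open>finite I\<close>, of "\<lambda>i. 1 - (\<Sum>k\<in>K. (u k i)\<^sup>2)"]
      orthonormal_sum_squares(2)[OF assms(1-3)] \<open>i \<in> I\<close> by simp
  let ?e = "\<lambda>l. if l = i then 1 else (0::real)"
  let ?r = "\<lambda>l. ?e l - (\<Sum>k\<in>K. ip I (u k) ?e * u k l)"
  have "ip I ?r ?r = 0"
    using norm_residual(1)[OF assms(1,2), of ?e] eq1 \<open>finite I\<close> \<open>i \<in> I\<close>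
    by (simp add: ip_unit_right ip_unit_left)
  then have "?r j = 0"
    using \<open>j \<in> I\<close> by (rule ip_self_eq_0[OF \<open>finite I\<close>, THEN iffD1, THEN bspec])
  then show ?thesis
    using \<open>finite I\<close> \<open>i \<in> I\<close> by (auto simp: ip_unit_right)
qed

text \<open>Compactness holds in the product topology of \<open>'a \<Rightarrow> real\<close>, since vectors that vanish
off I and have norm \<open>1\<close> lie in a product of compact intervals.\<close>

lemma compact_unit_sphere:
  assumes "finite I"
  shows "compact {v. (\<forall>i. i \<notin> I \<longrightarrow> v i = 0) \<and> ip I v v = 1 \<and> (\<forall>k\<in>K. ip I (u k) v = (0::real))}"
proof -
  let ?B = "Pi\<^sub>E UNIV (\<lambda>i. if i \<in> I then {-1..1} else {0::real})"
  have "compactin (product_topology (\<lambda>i. euclidean) UNIV) ?B"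
    by (subst compactin_PiE) auto
  then have "compact ?B"
    by (simp add: euclidean_product_topology)
  moreover have "closed {v. ip I v v = (1::real)}" "closed {v. ip I (u k) v = (0::real)}" for k
    unfolding ip_def by (intro closed_Collect_eq continuous_intros continuous_on_product_coordinates)+
  then have "closed ({v. ip I v v = (1::real)} \<inter> (\<Inter>k\<in>K. {v. ip I (u k) v = 0}))"
    by (intro closed_Int closed_INT) auto
  moreover have "\<bar>v i\<bar> \<le> 1" if "ip I v v = 1" "i \<in> I" for v i
  proof -
    have "(v i)\<^sup>2 \<le> ip I v v"
      unfolding ip_def using member_le_sum[of i I "\<lambda>i. v i * v i"] that \<open>finite I\<close>
      by (simp add: power2_eq_square)
    then show ?thesis using that by (simp add: abs_square_le_1)
  qed
  then have "{v. (\<forall>i. i \<notin> I \<longrightarrow> v i = 0) \<and> ip I v v = 1 \<and> (\<forall>k\<in>K. ip I (u k) v = 0)}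
     = ?B \<inter> ({v. ip I v v = (1::real)} \<inter> (\<Inter>k\<in>K. {v. ip I (u k) v = 0}))"
    by (auto simp: PiE_def Pi_def extensional_def abs_le_iff split: if_splits)
  ultimately show ?thesis
    by (simp only: compact_Int_closed)
qed

section \<open>Spectral theorem for symmetric matrices\<close>

text \<open>The first-order condition at a maximum of a quadratic function of one variable.\<close>

lemma linear_term_eq_0:
  fixes a b :: real
  assumes "\<And>t. 2 * t * a + t\<^sup>2 * b \<le> 0"
  shows "a = 0"
proof (rule ccontr)
  assume "a \<noteq> 0"
  define B where "B = \<bar>b\<bar> + 1"
  have B: "B > 0" "2 * B + b > 0"
    by (auto simp: B_def)
  have "2 * (a / B) * a + (a / B)\<^sup>2 * b = (a / B)\<^sup>2 * (2 * B + b)"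
    using B(1) by (simp add: power2_eq_square field_simps)
  moreover have "(a / B)\<^sup>2 * (2 * B + b) > 0"
    using \<open>a \<noteq> 0\<close> B by (intro mult_pos_pos) auto
  ultimately show False
    using assms[of "a / B"] by linarith
qed

text \<open>A maximizer of the Rayleigh quotient on the orthogonal complement of the eigenvectors found so
far is a further eigenvector. The complement is nontrivial because an orthonormal family with fewer members than
indices does not exhaust the unit vectors.\<close>

lemma next_eigenvector:
  fixes A :: "('a, 'a) matx" and u :: "nat \<Rightarrow> 'a \<Rightarrow> real"
  assumes "finite I" and sym: "symmetric_on I A" and orth: "orthonormal_on I {..<m} u"
    and eig: "\<And>k i. k < m \<Longrightarrow> i \<in> I \<Longrightarrow> mvec I A (u k) i = l k * u k i" and "m < card I"
  obtains v \<mu> where "ip I v v = 1" "\<And>k. k < m \<Longrightarrow> ip I (u k) v = 0"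
    "\<And>i. i \<in> I \<Longrightarrow> mvec I A v i = \<mu> * v i"
proof -
  let ?K = "{v. (\<forall>i. i \<notin> I \<longrightarrow> v i = 0) \<and> ip I v v = 1 \<and> (\<forall>k\<in>{..<m}. ip I (u k) v = (0::real))}"
  have normalize: "(\<lambda>i. if i \<in> I then h i / sqrt (ip I h h) else 0) \<in> ?K" (is "?n \<in> _")
    if h: "ip I h h \<noteq> 0" "\<And>k. k < m \<Longrightarrow> ip I (u k) h = 0" for h
  proof -
    let ?c = "1 / sqrt (ip I h h)"
    have n: "?n i = ?c * h i" if "i \<in> I" for i
      using that by simp
    have "ip I ?n ?n = ip I (\<lambda>i. ?c * h i) (\<lambda>i. ?c * h i)"
      by (intro ip_cong n)
    also have "\<dots> = 1"
      using h(1) ip_self_nonneg[of I h] by (simp only: ip_linear) (simp add: field_simps)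
    finally have 1: "ip I ?n ?n = 1" .
    have "ip I (u k) ?n = 0" if "k < m" for k
    proof -
      have "ip I (u k) ?n = ip I (u k) (\<lambda>i. ?c * h i)"
        by (intro ip_cong[OF refl] n)
      then show ?thesis
        using h(2)[OF that] by (simp only: ip_scale_right mult_zero_right)
    qed
    with 1 show ?thesis
      by simp
  qed
  have "\<exists>i\<in>I. (\<Sum>k<m. (u k i)\<^sup>2) < 1"
  proof (rule ccontr)
    assume "\<not> ?thesis"
    then have "(\<Sum>i\<in>I. 1) \<le> (\<Sum>i\<in>I. \<Sum>k<m. (u k i)\<^sup>2)"
      by (intro sum_mono) (simp add: not_less)
    then show False
      using orthonormal_sum_squares(1)[OF orth] assms(1,5) by simp
  qed
  then obtain i where i: "i \<in> I" "(\<Sum>k<m. (u k i)\<^sup>2) < 1"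
    by blast
  let ?e = "\<lambda>l. if l = i then 1 else (0::real)"
  let ?r = "\<lambda>l. ?e l - (\<Sum>k<m. ip I (u k) ?e * u k l)"
  have "ip I ?r ?r = 1 - (\<Sum>k<m. (u k i)\<^sup>2)"
    using norm_residual(1)[OF orth, of ?e] i \<open>finite I\<close> by (simp add: ip_unit_right ip_unit_left)
  then have "ip I ?r ?r \<noteq> 0"
    using i by linarith
  moreover have "ip I (u k) ?r = 0" if "k < m" for k
    using norm_residual(2)[OF orth, of k ?e] that by simp
  ultimately have mem: "(\<lambda>i. if i \<in> I then ?r i / sqrt (ip I ?r ?r) else 0) \<in> ?K"
    by (rule normalize)
  have ne: "?K \<noteq> {}"
  proof
    assume "?K = {}"
    from equals0D[OF this] mem show False
      by (rule notE)
  qed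
  have "continuous_on ?K (qf I A)"
    unfolding qf_def ip_def mvec_def
    by (intro continuous_intros continuous_on_subset[OF continuous_on_product_coordinates subset_UNIV])
  from continuous_attains_sup[OF compact_unit_sphere[OF \<open>finite I\<close>] ne this]
  obtain v where v: "v \<in> ?K" and sup: "\<forall>w\<in>?K. qf I A w \<le> qf I A v"
    by (elim bexE)
  then have v1: "ip I v v = 1" and v2: "\<And>k. k < m \<Longrightarrow> ip I (u k) v = 0"
    by simp_all
  let ?\<mu> = "qf I A v"
  have bound: "qf I A w \<le> ?\<mu> * ip I w w" if w: "\<And>k. k < m \<Longrightarrow> ip I (u k) w = 0" for w
  proof (cases "ip I w w = 0")
    case True
    then have "\<forall>i\<in>I. w i = 0"
      by (rule ip_self_eq_0[OF \<open>finite I\<close>, THEN iffD1])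
    then have "qf I A w = 0"
      by (simp add: qf_def ip_def)
    with True show ?thesis by simp
  next
    case False
    have "qf I A (\<lambda>i. 1 / sqrt (ip I w w) * w i) = qf I A (\<lambda>i. if i \<in> I then w i / sqrt (ip I w w) else 0)"
      by (rule qf_cong) simp
    also have "\<dots> \<le> ?\<mu>"
      by (intro bspec[OF sup] normalize False w)
    finally show ?thesis
      using False ip_self_nonneg[of I w]
      by (simp only: qf_scale) (simp add: power_divide field_simps)
  qed
  define h where "h = (\<lambda>i. mvec I A v i - ?\<mu> * v i)"
  have h_orth: "ip I (u k) h = 0" if "k < m" for k
  proof -
    have "ip I (u k) (mvec I A v) = ip I (mvec I A (u k)) v"
      by (rule ip_symmetric[OF sym])
    also have "\<dots> = ip I (\<lambda>i. l k * u k i) v"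
      using eig that by (intro ip_cong) auto
    finally show ?thesis
      using v2[OF that] by (simp add: h_def ip_linear)
  qed
  \<comment> \<open>The maximality of v along the line with direction h, the residual of the eigenvalue equation.\<close>
  have ineq: "2 * t * ip I h h + t\<^sup>2 * (qf I A h - ?\<mu> * ip I h h) \<le> 0" for t
  proof -
    have "qf I A (\<lambda>i. v i + t * h i) \<le> ?\<mu> * ip I (\<lambda>i. v i + t * h i) (\<lambda>i. v i + t * h i)"
      using v2 h_orth by (intro bound) (simp add: ip_linear)
    moreover have "qf I A (\<lambda>i. v i + t * h i) = ?\<mu> + 2 * t * ip I h (mvec I A v) + t\<^sup>2 * qf I A h"
      using ip_symmetric[OF sym, of v h]
      by (simp only: qf_add[OF sym] qf_scale mvec_linear ip_linear)
        (simp add: ip_commute[of I "mvec I A v" h] qf_def power2_eq_square algebra_simps)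
    moreover have "ip I (\<lambda>i. v i + t * h i) (\<lambda>i. v i + t * h i) = 1 + 2 * t * ip I h v + t\<^sup>2 * ip I h h"
      using v1 by (simp add: ip_linear ip_commute[of I v h] algebra_simps power2_eq_square)
    ultimately have "?\<mu> + 2 * t * ip I h (mvec I A v) + t\<^sup>2 * qf I A h
        \<le> ?\<mu> * (1 + 2 * t * ip I h v + t\<^sup>2 * ip I h h)"
      by metis
    moreover have "ip I h (mvec I A v) = ip I h h + ?\<mu> * ip I h v"
      by (subst (3) h_def) (simp add: ip_linear)
    ultimately show ?thesis
      by (simp add: algebra_simps)
  qed
  have "ip I h h = 0"
    by (rule linear_term_eq_0[OF ineq])
  then have "mvec I A v i = ?\<mu> * v i" if "i \<in> I" for i
    using that by (simp add: ip_self_eq_0[OF \<open>finite I\<close>] h_def)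
  then show thesis
    by (intro that[of v ?\<mu>] v1 v2)
qed

theorem spectral_theorem:
  fixes A :: "('a, 'a) matx"
  assumes "finite I" and "symmetric_on I A"
  obtains u :: "nat \<Rightarrow> 'a \<Rightarrow> real" and l :: "nat \<Rightarrow> real"
  where "orthonormal_on I {..<card I} u"
    and "\<And>k i. k < card I \<Longrightarrow> i \<in> I \<Longrightarrow> mvec I A (u k) i = l k * u k i"
proof -
  have "\<exists>(u :: nat \<Rightarrow> 'a \<Rightarrow> real) l. orthonormal_on I {..<m} u \<and>
      (\<forall>k<m. \<forall>i\<in>I. mvec I A (u k) i = l k * u k i)" if "m \<le> card I" for m
    using that
  proof (induction m)
    case 0
    then show ?case by (simp add: orthonormal_on_def)
  next
    case (Suc m)
    then obtain u :: "nat \<Rightarrow> 'a \<Rightarrow> real" and l where u: "orthonormal_on I {..<m} u"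
      "\<And>k i. k < m \<Longrightarrow> i \<in> I \<Longrightarrow> mvec I A (u k) i = l k * u k i"
      by auto
    obtain v \<mu> where v: "ip I v v = 1" "\<And>k. k < m \<Longrightarrow> ip I (u k) v = 0"
      "\<And>i. i \<in> I \<Longrightarrow> mvec I A v i = \<mu> * v i"
      using next_eigenvector[OF assms u] Suc.prems by auto
    have "ip I v (u k) = 0" if "k < m" for k
      using v(2)[OF that] by (simp add: ip_commute)
    then have "orthonormal_on I {..<Suc m} (u(m := v))"
      using u(1) v(1,2) by (auto simp: orthonormal_on_def less_Suc_eq)
    moreover have "\<forall>k<Suc m. \<forall>i\<in>I. mvec I A ((u(m := v)) k) i = (l(m := \<mu>)) k * (u(m := v)) k i"
      using u(2) v(3) by (auto simp: less_Suc_eq)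
    ultimately show ?case by blast
  qed
  from this[of "card I"] show thesis
    using that by auto
qed

section \<open>Pseudo-inverses, square roots and inverses\<close>

definition pd_on :: "'a set \<Rightarrow> ('a, 'a) matx \<Rightarrow> bool" where
  "pd_on I A \<longleftrightarrow> symmetric_on I A \<and> (\<forall>v. (\<exists>i\<in>I. v i \<noteq> 0) \<longrightarrow> 0 < qf I A v)"

text \<open>For eigenvectors u of a symmetric matrix and \<open>f = g \<circ> l\<close> with the eigenvalues l this is
the function g of the matrix.\<close>

definition spectral_matrix :: "('k \<Rightarrow> 'a \<Rightarrow> real) \<Rightarrow> 'k set \<Rightarrow> ('k \<Rightarrow> real) \<Rightarrow> ('a, 'a) matx" where
  "spectral_matrix u K f = (\<lambda>i j. \<Sum>k\<in>K. f k * u k i * u k j)"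

lemma symmetric_spectral_matrix: "symmetric_on I (spectral_matrix u K f)"
  by (simp add: symmetric_on_def spectral_matrix_def mult_ac)

lemma mtrans_spectral_matrix: "mtrans (spectral_matrix u K f) = spectral_matrix u K f"
  by (intro ext) (simp add: mtrans_def spectral_matrix_def mult_ac)

lemma mvec_spectral_matrix:
  "mvec I (spectral_matrix u K f) v = (\<lambda>i. \<Sum>k\<in>K. f k * ip I (u k) v * u k i)"
  unfolding mvec_def spectral_matrix_def ip_def
  by (simp add: sum_distrib_left sum_distrib_right, subst sum.swap) (simp add: mult_ac)

lemma spectral_matrix_mult:
  assumes "orthonormal_on I K u" and "finite K"
  shows "mmult I (spectral_matrix u K f) (spectral_matrix u K g) = spectral_matrix u K (\<lambda>k. f k * g k)"
proof (intro ext)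
  fix i j
  have "mmult I (spectral_matrix u K f) (spectral_matrix u K g) i j
      = mvec I (spectral_matrix u K f) (\<lambda>l. \<Sum>k\<in>K. (g k * u k j) * u k l) i"
    by (simp add: mmult_def mvec_def spectral_matrix_def mult_ac)
  also have "\<dots> = (\<Sum>k\<in>K. f k * (\<Sum>m\<in>K. (g m * u m j) * ip I (u k) (u m)) * u k i)"
    by (simp only: mvec_spectral_matrix ip_linear)
  also have "\<dots> = (\<Sum>k\<in>K. f k * (g k * u k j) * u k i)"
  proof (intro sum.cong refl)
    fix k assume "k \<in> K"
    have "(\<Sum>m\<in>K. (g m * u m j) * ip I (u k) (u m)) = (\<Sum>m\<in>K. if m = k then g k * u k j else 0)"
      using assms(1) \<open>k \<in> K\<close> by (intro sum.cong) (auto simp: orthonormal_on_def)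
    then show "f k * (\<Sum>m\<in>K. (g m * u m j) * ip I (u k) (u m)) * u k i = f k * (g k * u k j) * u k i"
      using \<open>k \<in> K\<close> \<open>finite K\<close> by simp
  qed
  also have "\<dots> = spectral_matrix u K (\<lambda>k. f k * g k) i j"
    by (simp add: spectral_matrix_def mult_ac)
  finally show "mmult I (spectral_matrix u K f) (spectral_matrix u K g) i j
      = spectral_matrix u K (\<lambda>k. f k * g k) i j" .
qed

lemma mmult_cong:
  assumes "meq I J A A'" and "meq J K B B'"
  shows "meq I K (mmult J A B) (mmult J A' B')"
  using assms unfolding meq_def mmult_def by (auto intro!: sum.cong)

lemma meq_trans: "meq I J A B \<Longrightarrow> meq I J B C \<Longrightarrow> meq I J A C"
  by (simp add: meq_def)

lemma meq_sym: "meq I J A B \<Longrightarrow> meq I J B A"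
  by (simp add: meq_def)

lemma meq_refl: "meq I J A A"
  by (simp add: meq_def)

lemma meq_mtrans: "meq I J A B \<Longrightarrow> meq J I (mtrans A) (mtrans B)"
  by (simp add: meq_def mtrans_def)

lemma meqI_mvec:
  assumes "finite J" and "\<And>v i. i \<in> I \<Longrightarrow> mvec J A v i = mvec J B v i"
  shows "meq I J A B"
  unfolding meq_def
proof (intro ballI)
  fix i j assume "i \<in> I" "j \<in> J"
  then show "A i j = B i j"
    using assms(2)[of i "\<lambda>l. if l = j then 1 else 0"] \<open>finite J\<close> by (simp add: mvec_unit)
qed

lemma spectral_decomposition:
  fixes A :: "('a, 'a) matx"
  assumes "finite I" and "symmetric_on I A"
  obtains u :: "nat \<Rightarrow> 'a \<Rightarrow> real" and l
  where "orthonormal_on I {..<card I} u"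
    and "meq I I A (spectral_matrix u {..<card I} l)"
    and "meq I I mone (spectral_matrix u {..<card I} (\<lambda>k. 1))"
    and "\<And>k. k < card I \<Longrightarrow> qf I A (u k) = l k"
proof -
  obtain u :: "nat \<Rightarrow> 'a \<Rightarrow> real" and l where u: "orthonormal_on I {..<card I} u"
    and eig: "\<And>k i. k < card I \<Longrightarrow> i \<in> I \<Longrightarrow> mvec I A (u k) i = l k * u k i"
    using spectral_theorem[OF assms] by metis
  have one: "(\<Sum>k<card I. u k i * u k j) = (if i = j then 1 else 0)" if "i \<in> I" "j \<in> I" for i j
    by (rule orthonormal_complete[OF u]) (use that \<open>finite I\<close> in auto)
  have "A i j = spectral_matrix u {..<card I} l i j" if "i \<in> I" "j \<in> I" for i j
  proof -
    have "A i j = (\<Sum>m\<in>I. A i m * (if m = j then 1 else 0))"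
      using mvec_unit[OF \<open>finite I\<close> \<open>j \<in> I\<close>, of A i] by (simp add: mvec_def)
    also have "\<dots> = (\<Sum>m\<in>I. A i m * (\<Sum>k<card I. u k j * u k m))"
      using one[OF \<open>j \<in> I\<close>] by (intro sum.cong) auto
    also have "\<dots> = mvec I A (\<lambda>m. \<Sum>k<card I. u k j * u k m) i"
      by (simp add: mvec_def)
    also have "\<dots> = (\<Sum>k<card I. u k j * mvec I A (u k) i)"
      by (simp only: mvec_linear)
    also have "\<dots> = spectral_matrix u {..<card I} l i j"
      using eig \<open>i \<in> I\<close> by (simp add: spectral_matrix_def mult_ac)
    finally show ?thesis .
  qed
  then have "meq I I A (spectral_matrix u {..<card I} l)"
    by (simp add: meq_def)
  moreover have "meq I I mone (spectral_matrix u {..<card I} (\<lambda>k. 1))"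
    using one by (simp add: meq_def mone_def spectral_matrix_def)
  moreover have "qf I A (u k) = l k" if "k < card I" for k
  proof -
    have "qf I A (u k) = ip I (u k) (\<lambda>i. l k * u k i)"
      unfolding qf_def using eig[OF that] by (intro ip_cong) auto
    also have "\<dots> = l k * ip I (u k) (u k)"
      by (rule ip_scale_right)
    finally show ?thesis
      using u that by (simp add: orthonormal_on_def)
  qed
  ultimately show thesis
    by (rule that[OF u])
qed

text \<open>Inverting the nonzero eigenvalues gives a Moore--Penrose inverse, so the choice in
\<open>pinverse\<close> is a choice from a nonempty set.\<close>

lemma pinverse_symmetric:
  fixes A :: "('a, 'a) matx"
  assumes "finite I" and "symmetric_on I A"
  shows "meq I I (mmult I A (mmult I (pinverse I A) A)) A"
    and "symmetric_on I (mmult I A (pinverse I A))"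
proof -
  obtain u :: "nat \<Rightarrow> 'a \<Rightarrow> real" and l where u: "orthonormal_on I {..<card I} u"
    and A: "meq I I A (spectral_matrix u {..<card I} l)"
    by (rule spectral_decomposition[OF assms])
  let ?F = "spectral_matrix u {..<card I}"
  let ?P = "\<lambda>X. meq I I (mmult I A (mmult I X A)) A
            \<and> meq I I (mmult I X (mmult I A X)) X
            \<and> meq I I (mtrans (mmult I A X)) (mmult I A X)
            \<and> meq I I (mtrans (mmult I X A)) (mmult I X A)"
  let ?X = "?F (\<lambda>k. inverse (l k))"
  have AX: "meq I I (mmult I A ?X) (?F (\<lambda>k. l k * inverse (l k)))"
    by (subst spectral_matrix_mult[symmetric, OF u finite_lessThan]) (intro mmult_cong A meq_refl)
  have XA: "meq I I (mmult I ?X A) (?F (\<lambda>k. inverse (l k) * l k))"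
    by (subst spectral_matrix_mult[symmetric, OF u finite_lessThan]) (intro mmult_cong A meq_refl)
  have "meq I I (mmult I A (mmult I ?X A)) (?F (\<lambda>k. l k * (inverse (l k) * l k)))"
    by (subst spectral_matrix_mult[symmetric, OF u finite_lessThan]) (intro mmult_cong A XA)
  moreover have "l k * (inverse (l k) * l k) = l k" for k
    by (cases "l k = 0") simp_all
  ultimately have 1: "meq I I (mmult I A (mmult I ?X A)) A"
    using meq_trans[OF _ meq_sym[OF A]] by simp
  have "meq I I (mmult I ?X (mmult I A ?X)) (?F (\<lambda>k. inverse (l k) * (l k * inverse (l k))))"
    by (subst spectral_matrix_mult[symmetric, OF u finite_lessThan]) (intro mmult_cong AX meq_refl)
  moreover have "inverse (l k) * (l k * inverse (l k)) = inverse (l k)" for k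
    by (cases "l k = 0") simp_all
  ultimately have 2: "meq I I (mmult I ?X (mmult I A ?X)) ?X"
    by simp
  have 3: "meq I I (mtrans (mmult I A ?X)) (mmult I A ?X)"
    using meq_trans[OF meq_mtrans[OF AX, unfolded mtrans_spectral_matrix] meq_sym[OF AX]] .
  have 4: "meq I I (mtrans (mmult I ?X A)) (mmult I ?X A)"
    using meq_trans[OF meq_mtrans[OF XA, unfolded mtrans_spectral_matrix] meq_sym[OF XA]] .
  have "?P ?X"
    by (intro conjI 1 2 3 4)
  then have "?P (pinverse I A)"
    unfolding pinverse_def by (rule someI[of ?P])
  then show "meq I I (mmult I A (mmult I (pinverse I A) A)) A"
    and "symmetric_on I (mmult I A (pinverse I A))"
    by (simp_all add: symmetric_on_def meq_def mtrans_def)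
qed

lemma pd_sqrt:
  fixes A :: "('a, 'a) matx"
  assumes "finite I" and "pd_on I A"
  obtains H G where "symmetric_on I H" "symmetric_on I G"
    "\<And>v i. i \<in> I \<Longrightarrow> mvec I H (mvec I H v) i = mvec I A v i"
    "\<And>v i. i \<in> I \<Longrightarrow> mvec I H (mvec I G v) i = v i"
    "\<And>v i. i \<in> I \<Longrightarrow> mvec I G (mvec I H v) i = v i"
proof -
  have sym: "symmetric_on I A"
    using assms(2) by (simp add: pd_on_def)
  obtain u :: "nat \<Rightarrow> 'a \<Rightarrow> real" and l where u: "orthonormal_on I {..<card I} u"
    and A: "meq I I A (spectral_matrix u {..<card I} l)"
    and one: "meq I I mone (spectral_matrix u {..<card I} (\<lambda>k. 1))"
    and l: "\<And>k. k < card I \<Longrightarrow> qf I A (u k) = l k"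
    by (rule spectral_decomposition[OF \<open>finite I\<close> sym], rule that)
  have pos: "0 < l k" if "k < card I" for k
  proof -
    have "ip I (u k) (u k) \<noteq> 0"
      using u that by (simp add: orthonormal_on_def)
    then have "\<exists>i\<in>I. u k i \<noteq> 0"
      by (simp add: ip_self_eq_0[OF \<open>finite I\<close>])
    then show ?thesis
      using assms(2) l[OF that] by (auto simp: pd_on_def)
  qed
  let ?F = "spectral_matrix u {..<card I}"
  let ?H = "?F (\<lambda>k. sqrt (l k))" and ?G = "?F (\<lambda>k. 1 / sqrt (l k))"
  have eq: "?F f = ?F g" if "\<And>k. k < card I \<Longrightarrow> f k = g k" for f g
    using that by (simp add: spectral_matrix_def)
  have "mmult I ?H ?H = ?F l" "mmult I ?H ?G = ?F (\<lambda>k. 1)" "mmult I ?G ?H = ?F (\<lambda>k. 1)"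
    using pos by (auto simp: spectral_matrix_mult[OF u] less_imp_le intro!: eq)
      (metis less_irrefl)+
  then have HH: "meq I I (mmult I ?H ?H) A" and HG: "meq I I (mmult I ?H ?G) mone"
    and GH: "meq I I (mmult I ?G ?H) mone"
    using A one by (simp_all add: meq_sym)
  have "mvec I ?H (mvec I ?H v) i = mvec I A v i" "mvec I ?H (mvec I ?G v) i = v i"
    "mvec I ?G (mvec I ?H v) i = v i" if "i \<in> I" for v i
    using meq_mvec[OF HH that, of v] meq_mvec[OF HG that, of v] meq_mvec[OF GH that, of v] that \<open>finite I\<close>
    by (simp_all add: mvec_mmult mvec_mone)
  then show thesis
    by (intro that[of ?H ?G] symmetric_spectral_matrix)
qed

lemma minverse_pd:
  fixes A :: "('a, 'a) matx"
  assumes "finite I" and "pd_on I A"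
  shows "meq I I (mmult I A (minverse I I A)) mone" and "symmetric_on I (minverse I I A)"
proof -
  let ?P = "\<lambda>X. meq I I (mmult I X A) mone \<and> meq I I (mmult I A X) mone"
  obtain H G where "symmetric_on I H" "symmetric_on I G"
    and HH: "\<And>v i. i \<in> I \<Longrightarrow> mvec I H (mvec I H v) i = mvec I A v i"
    and HGv: "\<And>v i. i \<in> I \<Longrightarrow> mvec I H (mvec I G v) i = v i"
      "\<And>v i. i \<in> I \<Longrightarrow> mvec I G (mvec I H v) i = v i"
    by (rule pd_sqrt[OF assms], rule that)
  note A = HH[symmetric]
  have "?P (mmult I G G)"
  proof (intro conjI meqI_mvec[OF \<open>finite I\<close>])
    fix v i assume i: "i \<in> I"
    have "mvec I (mmult I (mmult I G G) A) v i = mvec I G (mvec I G (mvec I H (mvec I H v))) i"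
      unfolding mvec_mmult by (intro mvec_cong) (simp add: A)
    also have "\<dots> = mvec I G (mvec I H v) i"
      by (intro mvec_cong HGv)
    finally show "mvec I (mmult I (mmult I G G) A) v i = mvec I mone v i"
      using i \<open>finite I\<close> by (simp add: HGv mvec_mone)
    have "mvec I (mmult I A (mmult I G G)) v i = mvec I H (mvec I H (mvec I G (mvec I G v))) i"
      unfolding mvec_mmult by (rule A[OF i])
    also have "\<dots> = mvec I H (mvec I G v) i"
      by (intro mvec_cong HGv)
    finally show "mvec I (mmult I A (mmult I G G)) v i = mvec I mone v i"
      using i \<open>finite I\<close> by (simp add: HGv mvec_mone)
  qed
  then have P: "?P (minverse I I A)"
    unfolding minverse_def by (rule someI[of ?P])
  then show AX: "meq I I (mmult I A (minverse I I A)) mone"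
    by blast
  let ?X = "minverse I I A"
  have AXv: "mvec I A (mvec I ?X v) i = v i" if "i \<in> I" for v i
    using meq_mvec[OF AX that, of v] that \<open>finite I\<close> by (simp add: mvec_mmult mvec_mone)
  show "symmetric_on I ?X"
  proof (rule symmetricI_bilinear[OF \<open>finite I\<close>])
    fix u v
    have "ip I u (mvec I ?X v) = ip I (mvec I A (mvec I ?X u)) (mvec I ?X v)"
      by (rule ip_cong) (simp_all add: AXv)
    also have "\<dots> = ip I (mvec I ?X u) (mvec I A (mvec I ?X v))"
      using assms(2) ip_symmetric[of I A] by (simp add: pd_on_def)
    also have "\<dots> = ip I (mvec I ?X u) v"
      by (rule ip_cong) (simp_all add: AXv)
    finally show "ip I u (mvec I ?X v) = ip I v (mvec I ?X u)"
      by (simp add: ip_commute)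
  qed
qed

section \<open>Spectra of products and the abstract condition number bound\<close>

text \<open>With H the square root of S, the product \<open>M S\<close> is similar to the
symmetric matrix \<open>H M H\<close>.\<close>

lemma eigenvalues_product_nonempty:
  fixes M S :: "('a, 'a) matx"
  assumes "finite I" and "I \<noteq> {}" and "symmetric_on I M" and "pd_on I S"
  shows "eigenvalues_on I (mmult I M S) \<noteq> {}"
proof -
  obtain H G where H: "symmetric_on I H" and "symmetric_on I G"
    and HH: "\<And>v i. i \<in> I \<Longrightarrow> mvec I H (mvec I H v) i = mvec I S v i"
    and HG: "\<And>v i. i \<in> I \<Longrightarrow> mvec I H (mvec I G v) i = v i"
    and GH: "\<And>v i. i \<in> I \<Longrightarrow> mvec I G (mvec I H v) i = v i"
    by (rule pd_sqrt[OF assms(1,4)], rule that)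
  let ?T = "mmult I H (mmult I M H)"
  have T: "symmetric_on I ?T"
  proof (rule symmetricI_bilinear[OF \<open>finite I\<close>])
    fix u v
    have "ip I u (mvec I ?T v) = ip I (mvec I ?T u) v"
      by (simp only: mvec_mmult ip_symmetric[OF H] ip_symmetric[OF assms(3)])
    then show "ip I u (mvec I ?T v) = ip I v (mvec I ?T u)"
      by (simp add: ip_commute)
  qed
  obtain w l where w: "orthonormal_on I {..<card I} w"
    and eig: "\<And>k i. k < card I \<Longrightarrow> i \<in> I \<Longrightarrow> mvec I ?T (w k) i = l k * w k i"
    by (rule spectral_theorem[OF \<open>finite I\<close> T], rule that)
  have card: "0 < card I"
    using assms(1,2) by (simp add: card_gt_0_iff)
  let ?v = "mvec I G (w 0)"
  have "mvec I (mmult I M S) ?v i = l 0 * ?v i" if i: "i \<in> I" for i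
  proof -
    have "mvec I (mmult I M S) ?v i = mvec I M (mvec I H (mvec I H ?v)) i"
      unfolding mvec_mmult by (intro mvec_cong) (simp add: HH)
    also have "\<dots> = mvec I M (mvec I H (w 0)) i"
      by (intro mvec_cong HG)
    also have "\<dots> = mvec I G (mvec I H (mvec I M (mvec I H (w 0)))) i"
      using GH[OF i] by simp
    also have "\<dots> = mvec I G (\<lambda>i. l 0 * w 0 i) i"
      by (rule mvec_cong) (use eig[OF card] in \<open>simp add: mvec_mmult\<close>)
    finally show ?thesis
      by (simp add: mvec_scale)
  qed
  moreover have "\<exists>i\<in>I. ?v i \<noteq> 0"
  proof (rule ccontr)
    assume "\<not> ?thesis"
    then have "mvec I H ?v i = 0" for i
      by (simp add: mvec_def[of I H])
    then have "w 0 i = 0" if "i \<in> I" for i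
      using HG[OF that, of "w 0"] by simp
    then have "ip I (w 0) (w 0) = 0"
      by (simp add: ip_self_eq_0[OF \<open>finite I\<close>])
    then show False
      using w card by (simp add: orthonormal_on_def)
  qed
  ultimately have "l 0 \<in> eigenvalues_on I (mmult I M S)"
    unfolding eigenvalues_on_def by (intro CollectI exI[of _ ?v] conjI ballI)
  then show ?thesis
    by (metis empty_iff)
qed

text \<open>Eigenvectors for different eigenvalues are S-orthogonal, so there are at most as many
eigenvalues as indices.\<close>

lemma eigenvalues_product_finite:
  fixes M S :: "('a, 'a) matx"
  assumes "finite I" and "symmetric_on I M" and "pd_on I S"
  shows "finite (eigenvalues_on I (mmult I M S))"
proof (rule ccontr)
  assume "infinite (eigenvalues_on I (mmult I M S))"
  then obtain F where F: "finite F" "card F = Suc (card I)" "F \<subseteq> eigenvalues_on I (mmult I M S)"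
    by (meson infinite_arbitrarily_large)
  obtain H G where H: "symmetric_on I H" and "symmetric_on I G"
    and HH: "\<And>v i. i \<in> I \<Longrightarrow> mvec I H (mvec I H v) i = mvec I S v i"
    and HG: "\<And>v i. i \<in> I \<Longrightarrow> mvec I H (mvec I G v) i = v i"
    and GH: "\<And>v i. i \<in> I \<Longrightarrow> mvec I G (mvec I H v) i = v i"
    by (rule pd_sqrt[OF assms(1,3)], rule that)
  have "\<forall>\<mu>\<in>F. \<exists>v. (\<exists>i\<in>I. v i \<noteq> 0) \<and> (\<forall>i\<in>I. mvec I (mmult I M S) v i = \<mu> * v i)"
    using F(3) unfolding eigenvalues_on_def by auto
  then obtain v where v: "\<And>\<mu>. \<mu> \<in> F \<Longrightarrow> \<exists>i\<in>I. v \<mu> i \<noteq> 0"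
    and eig: "\<And>\<mu> i. \<mu> \<in> F \<Longrightarrow> i \<in> I \<Longrightarrow> mvec I M (mvec I S (v \<mu>)) i = \<mu> * v \<mu> i"
    unfolding mvec_mmult by metis
  have S: "symmetric_on I S"
    using assms(3) by (simp add: pd_on_def)
  have HS: "ip I (mvec I H x) (mvec I H y) = ip I x (mvec I S y)" for x y
  proof -
    have "ip I x (mvec I S y) = ip I x (mvec I H (mvec I H y))"
      by (rule ip_cong) (simp_all add: HH)
    then show ?thesis
      by (simp add: ip_symmetric[OF H])
  qed
  have orth: "ip I (v \<mu>) (mvec I S (v \<nu>)) = 0" if "\<mu> \<in> F" "\<nu> \<in> F" "\<mu> \<noteq> \<nu>" for \<mu> \<nu>
  proof -
    let ?s = "mvec I S (v \<mu>)" and ?t = "mvec I S (v \<nu>)"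
    have "ip I ?t (mvec I M ?s) = ip I ?t (\<lambda>i. \<mu> * v \<mu> i)"
      by (rule ip_cong) (simp_all add: eig that)
    moreover have "ip I ?s (mvec I M ?t) = ip I ?s (\<lambda>i. \<nu> * v \<nu> i)"
      by (rule ip_cong) (simp_all add: eig that)
    moreover have "ip I ?t (mvec I M ?s) = ip I ?s (mvec I M ?t)"
      using ip_symmetric[OF assms(2), of ?t ?s] by (simp add: ip_commute)
    moreover have "ip I ?s (v \<nu>) = ip I ?t (v \<mu>)"
      using ip_symmetric[OF S, of "v \<nu>" "v \<mu>"] by (simp add: ip_commute)
    ultimately have "\<mu> * ip I ?t (v \<mu>) = \<nu> * ip I ?t (v \<mu>)"
      by (simp only: ip_scale_right)
    then have "ip I ?t (v \<mu>) = 0"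
      using that(3) by (simp only: mult_cancel_right) simp
    then show ?thesis
      by (simp only: ip_commute[of I "v \<mu>"])
  qed
  define y where "y = (\<lambda>\<mu> i. (1 / sqrt (qf I S (v \<mu>))) * mvec I H (v \<mu>) i)"
  have pos: "0 < qf I S (v \<mu>)" if "\<mu> \<in> F" for \<mu>
    using assms(3) v[OF that] by (simp add: pd_on_def)
  have "orthonormal_on I F y"
    unfolding orthonormal_on_def
  proof (intro ballI)
    fix \<mu> \<nu> assume \<mu>\<nu>: "\<mu> \<in> F" "\<nu> \<in> F"
    show "ip I (y \<mu>) (y \<nu>) = (if \<mu> = \<nu> then 1 else 0)"
    proof (cases "\<mu> = \<nu>")
      case True
      have "ip I (v \<nu>) (mvec I S (v \<nu>)) = qf I S (v \<nu>)"
        by (simp add: qf_def)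
      with True show ?thesis
        using pos[OF \<mu>\<nu>(2)]
        unfolding y_def ip_scale_left ip_scale_right HS by (simp add: field_simps)
    next
      case False
      then show ?thesis
        unfolding y_def ip_scale_left ip_scale_right HS using orth[OF \<mu>\<nu>] by simp
    qed
  qed
  then have "card F \<le> card I"
    by (rule orthonormal_card_le[OF _ F(1) assms(1)])
  then show False
    using F(2) by simp
qed

text \<open>The columns of \<open>P (P\<^sup>T P)\<^sup>-\<^sup>1\<^sup>/\<^sup>2\<close> are orthonormal, and there are as many of them as
rows, so they span and P is surjective.\<close>

lemma left_inverse_imp_right_inverse:
  fixes P :: "('a, 'b) matx" and X :: "('b, 'a) matx"
  assumes "finite I" and "finite K" and "card I = card K" and "meq K K (mmult I X P) mone"
  shows "meq I I (mmult K P X) mone"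
proof -
  have XP: "mvec I X (mvec K P v) k = v k" if "k \<in> K" for v k
    using meq_mvec[OF assms(4) that, of v] that \<open>finite K\<close> by (simp add: mvec_mmult mvec_mone)
  let ?G = "mmult I (mtrans P) P"
  have G: "ip K u (mvec K ?G v) = ip I (mvec K P u) (mvec K P v)" for u v
    by (simp add: mvec_mmult ip_adjoint[of I "mvec K P u"] ip_commute)
       (simp add: ip_adjoint[of K] mtrans_def ip_commute)
  have pdG: "pd_on K ?G"
    unfolding pd_on_def
  proof (intro conjI allI impI)
    show "symmetric_on K ?G"
      by (rule symmetricI_bilinear[OF \<open>finite K\<close>]) (simp add: G ip_commute)
    fix v :: "'b \<Rightarrow> real" assume v: "\<exists>k\<in>K. v k \<noteq> 0"
    have "ip I (mvec K P v) (mvec K P v) \<noteq> 0"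
    proof
      assume "ip I (mvec K P v) (mvec K P v) = 0"
      then have "mvec I X (mvec K P v) k = 0" for k
        unfolding mvec_def[of I X] by (simp add: ip_self_eq_0[OF \<open>finite I\<close>])
      then have "v k = 0" if "k \<in> K" for k
        using XP[OF that, of v] by simp
      then show False
        using v by auto
    qed
    then show "0 < qf K ?G v"
      using ip_self_nonneg[of I "mvec K P v"] by (simp add: qf_def G)
  qed
  obtain H Y where "symmetric_on K H" and Y: "symmetric_on K Y"
    and HH: "\<And>v i. i \<in> K \<Longrightarrow> mvec K H (mvec K H v) i = mvec K ?G v i"
    and HY: "\<And>v i. i \<in> K \<Longrightarrow> mvec K H (mvec K Y v) i = v i"
    and YH: "\<And>v i. i \<in> K \<Longrightarrow> mvec K Y (mvec K H v) i = v i"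
    by (rule pd_sqrt[OF \<open>finite K\<close> pdG], rule that)
  define u where "u = (\<lambda>k. mvec K P (\<lambda>l. Y l k))"
  have u: "u k = mvec K P (mvec K Y (\<lambda>l. if l = k then 1 else 0))" if "k \<in> K" for k
  proof -
    have "mvec K Y (\<lambda>l. if l = k then 1 else 0) = (\<lambda>l. Y l k)"
      by (rule ext) (simp add: mvec_unit that \<open>finite K\<close>)
    then show ?thesis
      by (simp add: u_def)
  qed
  have "orthonormal_on I K u"
    unfolding orthonormal_on_def
  proof (intro ballI)
    fix j k assume jk: "j \<in> K" "k \<in> K"
    let ?e = "\<lambda>k l. if l = k then 1 else (0::real)"
    have "ip I (u j) (u k) = ip K (mvec K Y (?e j)) (mvec K ?G (mvec K Y (?e k)))"
      by (simp only: u[OF jk(1)] u[OF jk(2)] G)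
    also have "\<dots> = ip K (mvec K Y (?e j)) (mvec K H (mvec K H (mvec K Y (?e k))))"
      by (rule ip_cong) (simp_all only: HH)
    also have "\<dots> = ip K (mvec K Y (?e j)) (mvec K H (?e k))"
      by (intro ip_cong mvec_cong refl HY)
    also have "\<dots> = ip K (?e j) (mvec K Y (mvec K H (?e k)))"
      by (simp only: ip_symmetric[OF Y])
    also have "\<dots> = ip K (?e j) (?e k)"
      by (intro ip_cong refl YH)
    also have "\<dots> = (if j = k then 1 else 0)"
      using jk by (simp add: ip_unit_left[OF \<open>finite K\<close>])
    finally show "ip I (u j) (u k) = (if j = k then 1 else 0)" .
  qed
  then have complete: "(\<Sum>k\<in>K. u k i * u k j) = (if i = j then 1 else 0)" if "i \<in> I" "j \<in> I" for i j
    by (rule orthonormal_complete) (use that assms in auto)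
  have range: "mvec K P (\<lambda>l. \<Sum>k\<in>K. ip I (u k) v * Y l k) i = v i" if "i \<in> I" for v i
  proof -
    have "mvec K P (\<lambda>l. \<Sum>k\<in>K. ip I (u k) v * Y l k) i = (\<Sum>k\<in>K. ip I (u k) v * u k i)"
      by (simp only: mvec_linear u_def)
    also have "\<dots> = (\<Sum>j\<in>I. (\<Sum>k\<in>K. u k i * u k j) * v j)"
      unfolding ip_def sum_distrib_right by (subst sum.swap) (simp add: mult_ac)
    also have "\<dots> = (\<Sum>j\<in>I. if j = i then v j else 0)"
      using complete[OF that] by (intro sum.cong) auto
    finally show ?thesis
      using that \<open>finite I\<close> by simp
  qed
  show ?thesis
  proof (rule meqI_mvec[OF \<open>finite I\<close>])
    fix v i assume i: "i \<in> I"
    let ?c = "\<lambda>l. \<Sum>k\<in>K. ip I (u k) v * Y l k"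
    have "mvec I (mmult K P X) v i = mvec K P (mvec I X (mvec K P ?c)) i"
      unfolding mvec_mmult by (intro mvec_cong) (simp add: range)
    also have "\<dots> = mvec K P ?c i"
      by (intro mvec_cong XP)
    also have "\<dots> = mvec I mone v i"
      using i \<open>finite I\<close> by (simp only: range mvec_mone)
    finally show "mvec I (mmult K P X) v i = mvec I mone v i" .
  qed
qed

text \<open>For a projection E other than zero and the identity the norms of E and \<open>I - E\<close> agree; the
computation below is the proof of this for one eigenvector. The direct estimate of \<open>w - E w\<close> would only give
\<open>1 + K\<close>.\<close>

lemma bddc_condition_number:
  fixes S D :: "('p, 'p) matx" and R :: "('p, 'c) matx"
  assumes "finite I" and "I \<noteq> {}" and "finite J" and pd: "pd_on J S"
    and pou: "\<And>v c. c \<in> I \<Longrightarrow> mvec J (mtrans R) (mvec J D (mvec I R v)) c = v c"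
    and jump: "\<And>w. qf J S (\<lambda>p. w p - mvec I R (mvec J (mtrans R) (mvec J D w)) p) \<le> K * qf J S w"
    and "1 \<le> K"
  defines "M \<equiv> mmult J (mtrans R) (mmult J D (mmult J (minverse J J S) (mmult J (mtrans D) R)))"
  shows "cond_number I (mmult I M (mmult J (mtrans R) (mmult J S R))) \<le> K"
proof -
  let ?X = "minverse J J S" and ?S = "mmult J (mtrans R) (mmult J S R)"
  have S: "symmetric_on J S"
    using pd by (simp add: pd_on_def)
  have X: "symmetric_on J ?X" and SX: "\<And>v p. p \<in> J \<Longrightarrow> mvec J S (mvec J ?X v) p = v p"
    using minverse_pd[OF \<open>finite J\<close> pd] \<open>finite J\<close>
    by (auto simp: mvec_mmult[symmetric] meq_mvec mvec_mone)
  have adj: "ip I u (mvec J (mtrans R) w) = ip J (mvec I R u) w" for u w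
    by (simp add: ip_adjoint[of I] mtrans_def)
  have adjD: "ip J w (mvec J D w') = ip J (mvec J (mtrans D) w) w'" for w w'
    by (rule ip_adjoint)
  have M: "mvec I M v = mvec J (mtrans R) (mvec J D (mvec J ?X (mvec J (mtrans D) (mvec I R v))))" for v
    by (simp add: M_def mvec_mmult)
  have Mip: "ip I u (mvec I M v)
      = ip J (mvec J (mtrans D) (mvec I R u)) (mvec J ?X (mvec J (mtrans D) (mvec I R v)))" for u v
    by (simp only: M adj adjD)
  have symM: "symmetric_on I M"
  proof (rule symmetricI_bilinear[OF \<open>finite I\<close>])
    fix u v
    show "ip I u (mvec I M v) = ip I v (mvec I M u)"
      unfolding Mip by (subst ip_symmetric[OF X]) (rule ip_commute)
  qed
  have Sip: "ip I u (mvec I ?S v) = ip J (mvec I R u) (mvec J S (mvec I R v))" for u v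
    by (simp only: mvec_mmult adj)
  have pdS: "pd_on I ?S"
    unfolding pd_on_def
  proof (intro conjI allI impI)
    show "symmetric_on I ?S"
    proof (rule symmetricI_bilinear[OF \<open>finite I\<close>])
      fix u v
      show "ip I u (mvec I ?S v) = ip I v (mvec I ?S u)"
        unfolding Sip by (subst ip_symmetric[OF S]) (rule ip_commute)
    qed
    fix v :: "'c \<Rightarrow> real" assume v: "\<exists>c\<in>I. v c \<noteq> 0"
    have "\<exists>p\<in>J. mvec I R v p \<noteq> 0"
    proof (rule ccontr)
      assume "\<not> ?thesis"
      then have "mvec J D (mvec I R v) = (\<lambda>p. 0)"
        by (auto simp: mvec_def[of J D])
      then have "v c = 0" if "c \<in> I" for c
        using pou[OF that, of v] by (simp add: mvec_def)
      with v show False by auto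
    qed
    then show "0 < qf I ?S v"
      using pd by (simp add: qf_def Sip pd_on_def)
  qed
  have bounds: "1 \<le> \<mu> \<and> \<mu> \<le> K" if "\<mu> \<in> eigenvalues_on I (mmult I M ?S)" for \<mu>
  proof -
    from that obtain v where v: "\<exists>c\<in>I. v c \<noteq> 0"
      and "\<forall>c\<in>I. mvec I (mmult I M ?S) v c = \<mu> * v c"
      unfolding eigenvalues_on_def by (elim CollectE exE conjE)
    then have eig: "mvec I M (mvec I ?S v) c = \<mu> * v c" if "c \<in> I" for c
      using that by (simp only: mvec_mmult)
    define f where "f = mvec J (mtrans D) (mvec I R (mvec I ?S v))"
    define w where "w = mvec J ?X f"
    define z where "z = mvec I R v"
    define s where "s = qf J S z"
    have s: "0 < s"
      using pdS v by (simp add: pd_on_def s_def z_def qf_def Sip)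
    have Sw: "ip J x (mvec J S w) = ip J x f" for x
      by (rule ip_cong) (simp_all add: w_def SX)
    have fR: "ip J (mvec I R u) f = ip I u (mvec I ?S v)" for u
    proof -
      have "ip J (mvec I R u) f = ip J (mvec I R (mvec I ?S v)) (mvec J D (mvec I R u))"
        unfolding f_def by (subst ip_commute) (rule adjD[symmetric])
      also have "\<dots> = ip I (mvec I ?S v) (mvec J (mtrans R) (mvec J D (mvec I R u)))"
        by (simp add: adj)
      also have "\<dots> = ip I (mvec I ?S v) u"
        by (rule ip_cong) (simp_all add: pou)
      finally show ?thesis by (simp add: ip_commute)
    qed
    have RDw: "mvec J (mtrans R) (mvec J D w) c = \<mu> * v c" if "c \<in> I" for c
      using eig[OF that] by (simp add: M f_def w_def)
    have zw: "ip J z (mvec J S w) = s"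
      by (simp add: Sw fR s_def z_def qf_def Sip)
    have ww: "qf J S w = \<mu> * s"
    proof -
      have "qf J S w = ip J (mvec I R (mvec I ?S v)) (mvec J D w)"
        by (simp only: qf_def Sw adjD f_def[symmetric] ip_commute[of J w])
      also have "\<dots> = ip I (mvec I ?S v) (\<lambda>c. \<mu> * v c)"
        unfolding adj[symmetric] by (rule ip_cong) (simp_all add: RDw)
      also have "\<dots> = \<mu> * s"
        by (simp add: ip_linear s_def z_def qf_def Sip[symmetric] ip_commute)
      finally show ?thesis .
    qed
    \<comment> \<open>The case \<open>c = 1\<close> is the part of w orthogonal to the range of R, and \<open>c = \<mu>\<close> is the jump of that part.\<close>
    have comb: "qf J S (\<lambda>p. w p - c * z p) = \<mu> * s - 2 * c * s + c\<^sup>2 * s" for c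
    proof -
      have "qf J S (\<lambda>p. (- c) * z p + w p) = c\<^sup>2 * s - 2 * c * s + \<mu> * s"
        by (simp only: qf_add[OF S] qf_scale ip_scale_left zw ww s_def[symmetric]) simp
      moreover have "(\<lambda>p. (- c) * z p + w p) = (\<lambda>p. w p - c * z p)"
        by auto
      ultimately show ?thesis
        by simp
    qed
    have nonneg: "0 \<le> qf J S x" for x
    proof (cases "\<exists>p\<in>J. x p \<noteq> 0")
      case True
      then show ?thesis using pd by (simp add: pd_on_def less_imp_le)
    next
      case False
      then show ?thesis by (simp add: qf_def ip_def)
    qed
    have "0 \<le> (\<mu> - 1) * s"
      using nonneg[of "\<lambda>p. w p - 1 * z p"] unfolding comb by (simp add: algebra_simps)
    then have ge1: "1 \<le> \<mu>"
      using s by (simp add: zero_le_mult_iff)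
    let ?x = "\<lambda>p. w p - z p"
    have "mvec J (mtrans R) (mvec J D ?x) c = (\<mu> - 1) * v c" if "c \<in> I" for c
      using RDw[OF that] pou[OF that, of v]
      by (simp only: mvec_diff z_def) (simp add: algebra_simps)
    then have "mvec I R (mvec J (mtrans R) (mvec J D ?x)) p = mvec I R (\<lambda>c. (\<mu> - 1) * v c) p" for p
      by (rule mvec_cong)
    then have "mvec I R (mvec J (mtrans R) (mvec J D ?x)) p = (\<mu> - 1) * z p" for p
      by (simp only: mvec_scale z_def)
    then have E: "(\<lambda>p. ?x p - mvec I R (mvec J (mtrans R) (mvec J D ?x)) p) = (\<lambda>p. w p - \<mu> * z p)"
      by (simp add: fun_eq_iff algebra_simps)
    have "qf J S (\<lambda>p. w p - \<mu> * z p) \<le> K * qf J S (\<lambda>p. w p - 1 * z p)"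
      using jump[of ?x] unfolding E by simp
    then have "\<mu> * ((\<mu> - 1) * s) \<le> K * ((\<mu> - 1) * s)"
      unfolding comb by (simp add: algebra_simps power2_eq_square)
    then have "\<mu> \<le> K"
      using ge1 s \<open>1 \<le> K\<close> by (cases "\<mu> = 1") (auto dest: mult_right_le_imp_le)
    with ge1 show ?thesis by blast
  qed
  let ?E = "eigenvalues_on I (mmult I M ?S)"
  have E: "finite ?E" "?E \<noteq> {}"
    by (rule eigenvalues_product_finite[OF \<open>finite I\<close> symM pdS])
      (rule eigenvalues_product_nonempty[OF \<open>finite I\<close> \<open>I \<noteq> {}\<close> symM pdS])
  have "Max ?E \<le> K" "1 \<le> Min ?E" "1 \<le> Max ?E"
    using bounds Max_in[OF E] Min_in[OF E] by auto
  then have "Max ?E / Min ?E \<le> Max ?E"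
    by (simp add: divide_le_eq mult_le_cancel_left1)
  also have "\<dots> \<le> K" by fact
  finally show ?thesis
    by (simp add: cond_number_def)
qed

section \<open>Schur complements and parallel sums\<close>

lemma ip_symmetric_block:
  assumes "symmetric_on I A" and "K \<subseteq> I" and "L \<subseteq> I"
  shows "ip K u (mvec L A y) = ip L (mvec K A u) y"
proof -
  have "mvec K (mtrans A) u i = mvec K A u i" if "i \<in> L" for i
    using assms that unfolding mvec_def mtrans_def symmetric_on_def by (intro sum.cong) auto
  then show ?thesis
    by (subst ip_adjoint) (auto intro: ip_cong)
qed

lemma psd_nonneg: "psd_on I A \<Longrightarrow> 0 \<le> qf I A v"
  by (simp add: psd_on_def)

lemma psd_symmetric: "psd_on I A \<Longrightarrow> symmetric_on I A"
  by (simp add: psd_on_def)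

text \<open>A vector of zero energy minimizes the quadratic form, so the gradient vanishes there.\<close>

lemma psd_kernel:
  assumes "finite I" and A: "psd_on I A" and "qf I A v = 0" and "i \<in> I"
  shows "mvec I A v i = 0"
proof -
  let ?h = "mvec I A v"
  have "2 * t * (- ip I ?h ?h) + t\<^sup>2 * (- qf I A ?h) \<le> 0" for t
  proof -
    have "0 \<le> qf I A (\<lambda>i. t * ?h i + v i)"
      by (rule psd_nonneg[OF A])
    also have "\<dots> = t\<^sup>2 * qf I A ?h + 2 * t * ip I ?h ?h"
      by (simp only: qf_add[OF psd_symmetric[OF A]] qf_scale ip_scale_left assms(3) add_0_right)
    finally show ?thesis by simp
  qed
  then have "- ip I ?h ?h = 0"
    by (rule linear_term_eq_0)
  then show ?thesis
    using ip_self_eq_0[OF \<open>finite I\<close>, of ?h] \<open>i \<in> I\<close> by simp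
qed

lemma ip_extend:
  assumes "finite I" and "K \<subseteq> I" and "\<And>i. i \<in> I - K \<Longrightarrow> v i = 0"
  shows "ip I u v = ip K u v" and "ip I v u = ip K v u"
  unfolding ip_def using assms by (auto intro!: sum.mono_neutral_right)

lemma mvec_extend:
  assumes "finite I" and "K \<subseteq> I" and "\<And>i. i \<in> I - K \<Longrightarrow> v i = 0"
  shows "mvec I A v = mvec K A v"
  unfolding mvec_def using assms by (auto intro!: sum.mono_neutral_right)

lemma qf_extend:
  assumes "finite I" and "K \<subseteq> I" and "\<And>i. i \<in> I - K \<Longrightarrow> v i = 0"
  shows "qf I A v = qf K A v"
proof -
  have "mvec I A v = mvec K A v"
    by (rule mvec_extend[OF assms])
  moreover have "ip I v u = ip K v u" for u
    by (rule ip_extend(2)[OF assms])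
  ultimately show ?thesis
    by (simp only: qf_def)
qed

lemma psd_subset:
  assumes "psd_on I A" and "finite I" and "K \<subseteq> I"
  shows "psd_on K A"
  unfolding psd_on_def
proof (intro conjI allI)
  show "symmetric_on K A"
    using assms by (auto simp: psd_on_def symmetric_on_def)
  fix v
  have "qf K A v = qf K A (\<lambda>i. if i \<in> K then v i else 0)"
    by (rule qf_cong) simp
  also have "\<dots> = qf I A (\<lambda>i. if i \<in> K then v i else 0)"
    by (rule qf_extend[symmetric]) (use assms in auto)
  finally show "0 \<le> qf K A v"
    using psd_nonneg[OF assms(1)] by simp
qed

lemma psd_two_ip_le:
  assumes "psd_on I A"
  shows "2 * ip I u (mvec I A v) \<le> qf I A u + qf I A v"
proof -
  have "0 \<le> qf I A (\<lambda>i. u i + (-1) * v i)"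
    by (rule psd_nonneg[OF assms])
  then show ?thesis
    by (simp only: qf_add[OF psd_symmetric[OF assms]] qf_scale mvec_scale ip_scale_right) simp
qed

lemma qf_sum_le:
  assumes "psd_on I A" and "finite F"
  shows "qf I A (\<lambda>i. \<Sum>c\<in>F. x c i) \<le> card F * (\<Sum>c\<in>F. qf I A (x c))"
proof -
  have "2 * qf I A (\<lambda>i. \<Sum>c\<in>F. x c i) = (\<Sum>c\<in>F. \<Sum>d\<in>F. 2 * ip I (x c) (mvec I A (x d)))"
    by (simp only: qf_def mvec_linear ip_linear sum_distrib_left)
  also have "\<dots> \<le> (\<Sum>c\<in>F. \<Sum>d\<in>F. qf I A (x c) + qf I A (x d))"
    by (intro sum_mono psd_two_ip_le assms)
  also have "\<dots> = 2 * (card F * (\<Sum>c\<in>F. qf I A (x c)))"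
    by (simp add: sum.distrib sum_distrib_left)
  finally show ?thesis by simp
qed

lemma qf_diff_le:
  assumes "psd_on I A"
  shows "qf I A (\<lambda>i. u i - v i) \<le> 2 * (qf I A u + qf I A v)"
proof -
  have "0 \<le> qf I A (\<lambda>i. u i + v i)"
    by (rule psd_nonneg[OF assms])
  moreover have "qf I A (\<lambda>i. u i - v i) = qf I A (\<lambda>i. u i + (-1) * v i)"
    by simp
  ultimately show ?thesis
    by (simp only: qf_add[OF psd_symmetric[OF assms]] qf_scale mvec_scale ip_scale_right) simp
qed

lemma psd_add_le:
  assumes "psd_on I A"
  shows "qf I A (\<lambda>i. u i + v i) \<le> 2 * (qf I A u + qf I A v)"
proof -
  have "qf I A (\<lambda>i. u i + v i) = qf I A (\<lambda>i. u i - (-1) * v i)"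
    by simp
  also have "\<dots> \<le> 2 * (qf I A u + qf I A (\<lambda>i. (-1) * v i))"
    by (rule qf_diff_le[OF assms])
  finally show ?thesis
    by (simp only: qf_scale) simp
qed

text \<open>The range of a symmetric matrix is the orthogonal complement of its kernel: the residual
r of the proposed solution lies in the kernel and is orthogonal to b and to the range, hence to itself.\<close>

lemma pinverse_solves:
  fixes C :: "('a, 'a) matx"
  assumes "finite L" and sym: "symmetric_on L C"
    and ker: "\<And>z. (\<And>i. i \<in> L \<Longrightarrow> mvec L C z i = 0) \<Longrightarrow> ip L z b = 0"
    and "i \<in> L"
  shows "mvec L C (mvec L (pinverse L C) b) i = b i"
proof -
  let ?X = "pinverse L C"
  have CXC: "mvec L C (mvec L ?X (mvec L C v)) i = mvec L C v i" if "i \<in> L" for v i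
    using meq_mvec[OF pinverse_symmetric(1)[OF assms(1,2)] that, of v] by (simp add: mvec_mmult)
  have symCX: "ip L u (mvec L C (mvec L ?X v)) = ip L (mvec L C (mvec L ?X u)) v" for u v
    using ip_symmetric[OF pinverse_symmetric(2)[OF assms(1,2)], of u v] by (simp add: mvec_mmult)
  define r where "r = (\<lambda>i. b i - mvec L C (mvec L ?X b) i)"
  have "ip L y (mvec L C r) = 0" for y
  proof -
    have "ip L y (mvec L C (mvec L C (mvec L ?X b))) = ip L (mvec L C (mvec L ?X (mvec L C y))) b"
      by (simp only: ip_symmetric[OF sym, of y] symCX)
    also have "\<dots> = ip L (mvec L C y) b"
      by (rule ip_cong) (simp_all add: CXC)
    also have "\<dots> = ip L y (mvec L C b)"
      by (simp only: ip_symmetric[OF sym])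
    finally show ?thesis
      by (simp add: r_def mvec_linear ip_linear)
  qed
  then have Cr: "mvec L C r i = 0" if "i \<in> L" for i
    using ip_self_eq_0[OF \<open>finite L\<close>, of "mvec L C r"] that by simp
  have "ip L r (mvec L C (mvec L ?X b)) = ip L (mvec L C r) (mvec L ?X b)"
    by (rule ip_symmetric[OF sym])
  also have "\<dots> = 0"
    by (simp add: ip_def Cr)
  finally have "ip L r r = ip L r b"
    by (subst (2) r_def) (simp add: ip_linear)
  also have "\<dots> = 0"
    by (rule ker) (rule Cr)
  finally have "r i = 0"
    using ip_self_eq_0[OF \<open>finite L\<close>, of r] \<open>i \<in> L\<close> by simp
  then show ?thesis
    by (simp add: r_def)
qed

text \<open>Completion of the square. For a positive semidefinite matrix the off-diagonal block maps into the range of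
the eliminated block, even if the latter is singular, because kernel vectors of the eliminated block have zero
energy and so are annihilated by the whole matrix. Thus the Schur complement is the energy of the extension by
\<open>- y v\<close>, and no other extension has less.\<close>

lemma schur_complement_energy:
  fixes A :: "('a, 'a) matx"
  assumes "finite I" and A: "psd_on I A" and "L \<subseteq> I"
  defines "y \<equiv> \<lambda>v. mvec L (pinverse L A) (mvec (I - L) A v)"
  shows "qf I A v = qf (I - L) (schur_complement L A) v + qf L A (\<lambda>i. v i + y v i)"
    and "symmetric_on (I - L) (schur_complement L A)"
proof -
  let ?K = "I - L"
  have sub: "?K \<subseteq> I" by auto
  have "finite L" "finite ?K"
    using assms(1,3) by (auto intro: finite_subset)
  have sym: "symmetric_on I A" and symL: "symmetric_on L A"
    using A psd_subset[OF A \<open>finite I\<close> \<open>L \<subseteq> I\<close>] by (simp_all add: psd_on_def)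
  have block: "ip K u (mvec K' A w) = ip K' (mvec K A u) w" if "K \<subseteq> I" "K' \<subseteq> I" for K K' u w
    by (rule ip_symmetric_block[OF sym that])
  let ?b = "mvec ?K A"
  have solve: "mvec L A (y v) i = ?b v i" if "i \<in> L" for v i
    unfolding y_def
  proof (rule pinverse_solves[OF \<open>finite L\<close> symL _ that])
    fix z assume z: "\<And>i. i \<in> L \<Longrightarrow> mvec L A z i = 0"
    define z0 where "z0 = (\<lambda>i. if i \<in> L then z i else 0)"
    have z0: "mvec I A z0 = mvec L A z"
    proof -
      have "mvec I A z0 = mvec L A z0"
        by (rule mvec_extend[OF assms(1,3)]) (simp add: z0_def)
      also have "\<dots> = mvec L A z"
        by (intro ext mvec_cong) (simp add: z0_def)
      finally show ?thesis .
    qed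
    have "qf I A z0 = ip L z0 (mvec L A z)"
      unfolding qf_def z0 by (rule ip_extend(2)[OF assms(1,3)]) (simp add: z0_def)
    also have "\<dots> = 0"
      by (simp add: ip_def z)
    finally have "mvec L A z i = 0" if "i \<in> I" for i
      using psd_kernel[OF \<open>finite I\<close> A _ that] z0 by metis
    then have "ip ?K (mvec L A z) v = 0"
      by (simp add: ip_def)
    then show "ip L z (?b v) = 0"
      by (simp only: block[OF assms(3) sub])
  qed
  have S: "mvec ?K (schur_complement L A) v i = ?b v i - mvec L A (y v) i" for v i
  proof -
    have "mvec ?K (schur_complement L A) v i
        = ?b v i - mvec ?K (mmult L A (mmult L (pinverse L A) A)) v i"
      by (simp add: schur_complement_def mvec_def algebra_simps sum_subtractf)
    then show ?thesis
      by (simp add: mvec_mmult y_def)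
  qed
  have bil: "ip ?K u (mvec ?K (schur_complement L A) v) = ip ?K u (?b v) - ip L (y u) (mvec L A (y v))"
    for u v
  proof -
    have "ip ?K u (mvec ?K (schur_complement L A) v) = ip ?K u (?b v) - ip ?K u (mvec L A (y v))"
      unfolding S by (rule ip_diff_right)
    also have "ip ?K u (mvec L A (y v)) = ip L (?b u) (y v)"
      by (rule block[OF sub assms(3)])
    also have "\<dots> = ip L (mvec L A (y u)) (y v)"
      by (rule ip_cong) (simp_all add: solve)
    also have "\<dots> = ip L (y u) (mvec L A (y v))"
      by (rule ip_symmetric[OF symL, symmetric])
    finally show ?thesis .
  qed
  show "symmetric_on ?K (schur_complement L A)"
  proof (rule symmetricI_bilinear[OF \<open>finite ?K\<close>])
    fix u v
    show "ip ?K u (mvec ?K (schur_complement L A) v) = ip ?K v (mvec ?K (schur_complement L A) u)"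
      unfolding bil using block[OF sub sub, of u v] ip_symmetric[OF symL, of "y u" "y v"]
      by (simp add: ip_commute)
  qed
  have split_ip: "ip I u w = ip ?K u w + ip L u w" for u w
    unfolding ip_def using sum.subset_diff[OF assms(3,1)] by auto
  have split_mvec: "mvec I A w = (\<lambda>i. ?b w i + mvec L A w i)" for w
    unfolding mvec_def using sum.subset_diff[OF assms(3,1)] by auto
  have "qf I A v = ip ?K v (?b v) + ip ?K v (mvec L A v) + ip L v (?b v) + qf L A v"
    by (simp add: qf_def split_ip split_mvec ip_linear)
  also have "ip ?K v (mvec L A v) = ip L v (?b v)"
    by (simp only: block[OF sub assms(3)] ip_commute)
  also have "ip L v (?b v) = ip L v (mvec L A (y v))"
    by (rule ip_cong) (simp_all add: solve)
  finally have "qf I A v = ip ?K v (?b v) + 2 * ip L v (mvec L A (y v)) + qf L A v"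
    by simp
  then show "qf I A v = qf ?K (schur_complement L A) v + qf L A (\<lambda>i. v i + y v i)"
    by (simp only: qf_add[OF symL]) (simp add: qf_def bil)
qed

lemma schur_complement_le:
  assumes "finite I" and "psd_on I A" and "L \<subseteq> I"
  shows "qf (I - L) (schur_complement L A) v \<le> qf I A v"
  using schur_complement_energy(1)[OF assms, of v] psd_nonneg[OF psd_subset[OF assms(2,1,3)]]
  by simp

lemma schur_complement_attained:
  assumes "finite I" and "psd_on I A" and "L \<subseteq> I"
  obtains v' where "\<And>i. i \<notin> L \<Longrightarrow> v' i = v i" and "qf I A v' = qf (I - L) (schur_complement L A) v"
proof -
  let ?y = "mvec L (pinverse L A) (mvec (I - L) A v)"
  define v' where "v' = (\<lambda>i. if i \<in> L then - ?y i else v i)"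
  have "mvec (I - L) A v' = mvec (I - L) A v"
    by (intro ext mvec_cong) (simp add: v'_def)
  then have "qf I A v' = qf (I - L) (schur_complement L A) v' + qf L A (\<lambda>i. v' i + ?y i)"
    using schur_complement_energy(1)[OF assms, of v'] by simp
  also have "qf L A (\<lambda>i. v' i + ?y i) = qf L A (\<lambda>i. 0)"
    by (rule qf_cong) (simp add: v'_def)
  also have "\<dots> = 0"
    by (simp add: qf_def ip_def)
  also have "qf (I - L) (schur_complement L A) v' = qf (I - L) (schur_complement L A) v"
    by (rule qf_cong) (simp add: v'_def)
  finally have "qf I A v' = qf (I - L) (schur_complement L A) v"
    by simp
  moreover have "v' i = v i" if "i \<notin> L" for i
    using that by (simp add: v'_def)
  ultimately show thesis
    by (intro that)
qed

lemma psd_schur_complement: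
  assumes "finite I" and "psd_on I A" and "L \<subseteq> I"
  shows "psd_on (I - L) (schur_complement L A)"
  unfolding psd_on_def
proof (intro conjI allI)
  show "symmetric_on (I - L) (schur_complement L A)"
    by (rule schur_complement_energy(2)[OF assms])
  fix v
  obtain v' where "qf I A v' = qf (I - L) (schur_complement L A) v"
    by (rule schur_complement_attained[OF assms])
  then show "0 \<le> qf (I - L) (schur_complement L A) v"
    using psd_nonneg[OF assms(2)] by metis
qed

text \<open>The parallel sum is the infimal convolution of the two quadratic forms: its value at x is the minimum over
z of the energies of \<open>x - z\<close> and z, attained at \<open>z = y x\<close>. The choices \<open>z = 0\<close> and \<open>z = x\<close> give the
bounds by the two summands.\<close>

lemma parallel_sum_psd:
  fixes A B :: "('a, 'a) matx"
  assumes "finite I" and A: "psd_on I A" and B: "psd_on I B"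
  shows "psd_on I (parallel_sum I A B)"
    and "qf I (parallel_sum I A B) x \<le> qf I A x"
    and "qf I (parallel_sum I A B) x \<le> qf I B x"
proof -
  let ?C = "madd A B" and ?P = "parallel_sum I A B"
  define y where "y = (\<lambda>x. mvec I (pinverse I ?C) (mvec I A x))"
  have C: "mvec I ?C v = (\<lambda>i. mvec I A v i + mvec I B v i)" for v
    by (rule mvec_madd)
  have symA: "symmetric_on I A" and symB: "symmetric_on I B"
    using A B by (simp_all add: psd_on_def)
  then have symC: "symmetric_on I ?C"
    by (simp add: symmetric_on_def madd_def)
  have solve: "mvec I A (y x) i + mvec I B (y x) i = mvec I A x i" if "i \<in> I" for x i
  proof -
    have "mvec I ?C (y x) i = mvec I A x i"
      unfolding y_def
    proof (rule pinverse_solves[OF \<open>finite I\<close> symC _ that])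
      fix z assume "\<And>i. i \<in> I \<Longrightarrow> mvec I ?C z i = 0"
      then have "qf I A z + qf I B z = 0"
        unfolding qf_def ip_add_right[symmetric] C[symmetric] by (simp add: ip_def)
      then have "qf I A z = 0"
        using psd_nonneg[OF A, of z] psd_nonneg[OF B, of z] by linarith
      then have "ip I (mvec I A z) x = 0"
        using psd_kernel[OF \<open>finite I\<close> A] by (simp add: ip_def)
      then show "ip I z (mvec I A x) = 0"
        by (simp only: ip_symmetric[OF symA])
    qed
    then show ?thesis by (simp add: C)
  qed
  have solve_ip: "ip I u (mvec I A x) = ip I u (mvec I A (y x)) + ip I u (mvec I B (y x))" for u x
    unfolding ip_add_right[symmetric] by (rule ip_cong) (simp_all add: solve)
  have P: "mvec I ?P x = mvec I B (y x)" for x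
    by (simp add: parallel_sum_def mvec_mmult y_def)
  have bil: "ip I u (mvec I ?P x) = ip I u (mvec I A x) - ip I (y u) (mvec I A (y x)) - ip I (y u) (mvec I B (y x))"
    for u x
  proof -
    have "ip I u (mvec I A (y x)) = ip I (y x) (mvec I A u)"
      using ip_symmetric[OF symA, of u "y x"] by (simp add: ip_commute)
    also have "\<dots> = ip I (y x) (mvec I A (y u)) + ip I (y x) (mvec I B (y u))"
      by (rule solve_ip)
    also have "\<dots> = ip I (y u) (mvec I A (y x)) + ip I (y u) (mvec I B (y x))"
      using ip_symmetric[OF symA, of "y u" "y x"] ip_symmetric[OF symB, of "y u" "y x"]
      by (simp add: ip_commute)
    finally show ?thesis
      using solve_ip[of u x] by (simp add: P)
  qed
  have symP: "symmetric_on I ?P"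
  proof (rule symmetricI_bilinear[OF \<open>finite I\<close>])
    fix u v
    show "ip I u (mvec I ?P v) = ip I v (mvec I ?P u)"
      unfolding bil using ip_symmetric[OF symA, of u v] ip_symmetric[OF symA, of "y u" "y v"]
        ip_symmetric[OF symB, of "y u" "y v"]
      by (simp add: ip_commute)
  qed
  have q: "qf I ?P x = qf I A x - qf I A (y x) - qf I B (y x)" for x
    unfolding qf_def by (rule bil)
  \<comment> \<open>The excess over the minimum is the energy of \<open>z - y x\<close>.\<close>
  have inf_conv: "qf I A (\<lambda>i. x i - z i) + qf I B z
      = qf I ?P x + qf I A (\<lambda>i. z i - y x i) + qf I B (\<lambda>i. z i - y x i)" for x z
  proof -
    have d: "qf I M (\<lambda>i. u i - v i) = qf I M u - 2 * ip I u (mvec I M v) + qf I M v"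
      if "symmetric_on I M" for M and u v :: "'a \<Rightarrow> real"
    proof -
      have "qf I M (\<lambda>i. u i - v i) = qf I M (\<lambda>i. u i + (-1) * v i)"
        by simp
      then show ?thesis
        by (simp only: qf_add[OF that] qf_scale mvec_scale ip_scale_right) simp
    qed
    have "ip I x (mvec I A z) = ip I z (mvec I A x)"
      using ip_symmetric[OF symA, of x z] by (simp add: ip_commute)
    then show ?thesis
      using solve_ip[of z x] by (simp only: d[OF symA] d[OF symB] q) simp
  qed
  show "psd_on I ?P"
    unfolding psd_on_def
  proof (intro conjI allI symP)
    fix x
    have "qf I ?P x = qf I A (\<lambda>i. x i - y x i) + qf I B (y x)"
      unfolding inf_conv by (simp add: qf_def ip_def mvec_def)
    then show "0 \<le> qf I ?P x"
      using psd_nonneg[OF A] psd_nonneg[OF B] by simp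
  qed
  show "qf I ?P x \<le> qf I A x"
    unfolding q using psd_nonneg[OF A, of "y x"] psd_nonneg[OF B, of "y x"] by simp
  have "qf I ?P x \<le> qf I A (\<lambda>i. x i - x i) + qf I B x"
    unfolding inf_conv
    using psd_nonneg[OF A, of "\<lambda>i. x i - y x i"] psd_nonneg[OF B, of "\<lambda>i. x i - y x i"] by simp
  then show "qf I ?P x \<le> qf I B x"
    by (simp add: qf_def ip_def mvec_def)
qed

lemma parallel_sums_psd:
  fixes As :: "('a, 'a) matx list"
  assumes "finite I" and "\<And>A. A \<in> set As \<Longrightarrow> psd_on I A"
  shows "psd_on I (parallel_sums I As)"
    and "A \<in> set As \<Longrightarrow> qf I (parallel_sums I As) x \<le> qf I A x"
proof -
  have "psd_on I (parallel_sums I As) \<and> (\<forall>A\<in>set As. qf I (parallel_sums I As) x \<le> qf I A x)"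
    using assms(2)
  proof (induction As)
    case Nil
    then show ?case
      by (simp add: psd_on_def symmetric_on_def qf_def ip_def mvec_def)
  next
    case (Cons A As)
    show ?case
    proof (cases As)
      case Nil
      then show ?thesis
        using Cons.prems by simp
    next
      case (Cons B Bs)
      have IH: "psd_on I (parallel_sums I As)" "\<And>A. A \<in> set As \<Longrightarrow> qf I (parallel_sums I As) x \<le> qf I A x"
        using Cons.IH Cons.prems by auto
      have A: "psd_on I A"
        using Cons.prems by simp
      have eq: "parallel_sums I (A # As) = parallel_sum I A (parallel_sums I As)"
        by (simp add: Cons)
      show ?thesis
        unfolding eq using parallel_sum_psd[OF \<open>finite I\<close> A IH(1)] IH(2) order_trans
        by (metis set_ConsD)
    qed
  qed
  then show "psd_on I (parallel_sums I As)"
    and "A \<in> set As \<Longrightarrow> qf I (parallel_sums I As) x \<le> qf I A x"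
    by auto
qed

section \<open>Eigenvalue problems and counting of classes\<close>

lemma eigenbasis_energy:
  fixes P :: "('a, nat) matx"
  assumes "meq {..<n} {..<n} (mmult C (mtrans P) (mmult C A P)) mone"
  shows "qf C A (mvec {..<n} P c) = (\<Sum>k<n. (c k)\<^sup>2)"
proof -
  have "qf C A (mvec {..<n} P c)
      = ip {..<n} (mvec C (mtrans P) (mvec C A (mvec {..<n} P c))) c"
    unfolding qf_def by (subst ip_commute) (rule ip_adjoint)
  also have "\<dots> = ip {..<n} c c"
  proof (rule ip_cong[OF _ refl])
    fix k assume k: "k \<in> {..<n}"
    show "mvec C (mtrans P) (mvec C A (mvec {..<n} P c)) k = c k"
      using meq_mvec[OF assms k, of c] mvec_mone[OF finite_lessThan k, of c]
      by (simp only: mvec_mmult)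
  qed
  finally show ?thesis
    by (simp add: ip_def power2_eq_square)
qed

text \<open>The basis that is orthonormal for A is orthogonal for B, with diagonal entries
\<open>1 / \<mu>\<close> for an eigenvalue \<mu> and \<open>0\<close> for \<open>\<mu> = \<infinity>\<close>.\<close>

lemma small_eigenvalue_coefficients:
  fixes A B :: "('a, 'a) matx" and P :: "('a, nat) matx"
  assumes "psd_on C B"
    and eig: "\<And>k. k < n \<Longrightarrow> gen_eigenpair C A B (ev k) (\<lambda>x. P x k)"
    and orth: "meq {..<n} {..<n} (mmult C (mtrans P) (mmult C A P)) mone"
    and U: "U \<subseteq> {..<n}" "\<And>k. k \<in> U \<Longrightarrow> ev k \<le> ereal t" and "0 \<le> t"
  shows "(\<Sum>k\<in>U. (c k)\<^sup>2) \<le> t * qf C B (mvec {..<n} P c)"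
proof -
  let ?p = "\<lambda>k x. P x k"
  define s where "s = (\<lambda>k. qf C B (?p k))"
  have s: "0 \<le> s k" for k
    using psd_nonneg[OF assms(1)] by (simp add: s_def)
  have A: "ip C (?p k) (mvec C A (?p l)) = (if k = l then 1 else 0)" if "k < n" "l < n" for k l
    using orth that by (simp add: meq_def mmult_def mtrans_def ip_def mvec_def mone_def)
  have A_rB: "ip C (?p k) (mvec C A (?p l)) = r * ip C (?p k) (mvec C B (?p l))"
    if "ev l = ereal r" "l < n" for k l r
  proof -
    have "mvec C A (?p l) x = r * mvec C B (?p l) x" if "x \<in> C" for x
      using eig[OF \<open>l < n\<close>] \<open>ev l = ereal r\<close> that by (auto simp: gen_eigenpair_def)
    then have "ip C (?p k) (mvec C A (?p l)) = ip C (?p k) (\<lambda>x. r * mvec C B (?p l) x)"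
      by (intro ip_cong) auto
    then show ?thesis
      by (simp only: ip_scale_right)
  qed
  have B: "ip C (?p k) (mvec C B (?p l)) = (if k = l then s l else 0)" if "k < n" "l < n" for k l
  proof (cases "k = l")
    case True
    then show ?thesis by (simp add: s_def qf_def)
  next
    case False
    from eig[OF \<open>l < n\<close>] consider r where "ev l = ereal r" | "\<forall>x\<in>C. mvec C B (?p l) x = 0"
      unfolding gen_eigenpair_def by auto
    then show ?thesis
    proof cases
      case 1
      then show ?thesis
        using A_rB[OF 1 \<open>l < n\<close>, of l] A_rB[OF 1 \<open>l < n\<close>, of k] A[OF that] A[OF \<open>l < n\<close> \<open>l < n\<close>] False
        by auto
    next
      case 2
      then show ?thesis
        using False by (simp add: ip_def)
    qed
  qed
  have "qf C B (mvec {..<n} P c) = (\<Sum>k<n. \<Sum>l<n. c k * c l * ip C (?p k) (mvec C B (?p l)))"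
  proof -
    have "mvec {..<n} P c = (\<lambda>x. \<Sum>k<n. c k * ?p k x)"
      by (simp add: mvec_def mult.commute)
    then show ?thesis
      by (simp only: qf_def mvec_linear ip_linear) (simp add: sum_distrib_left mult_ac)
  qed
  also have "\<dots> = (\<Sum>k<n. \<Sum>l<n. if k = l then (c l)\<^sup>2 * s l else 0)"
    by (intro sum.cong refl) (simp add: B power2_eq_square)
  also have "\<dots> = (\<Sum>k<n. (c k)\<^sup>2 * s k)"
    by simp
  finally have q: "qf C B (mvec {..<n} P c) = (\<Sum>k<n. (c k)\<^sup>2 * s k)" .
  have "(c k)\<^sup>2 \<le> t * ((c k)\<^sup>2 * s k)" if "k \<in> U" for k
  proof -
    have k: "k < n"
      using U(1) that by auto
    have "ev k \<le> ereal t"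
      by (rule U(2)[OF that])
    then obtain r where r: "ev k = ereal r" "r \<le> t"
      using eig[OF k] unfolding gen_eigenpair_def by (cases "ev k") auto
    have "1 = r * s k"
      using A_rB[OF r(1) k, of k] A[OF k k] by (simp add: s_def qf_def)
    also have "\<dots> \<le> t * s k"
      using r(2) s by (rule mult_right_mono)
    finally have "(c k)\<^sup>2 * 1 \<le> (c k)\<^sup>2 * (t * s k)"
      by (intro mult_left_mono) auto
    then show ?thesis by (simp add: mult_ac)
  qed
  then have "(\<Sum>k\<in>U. (c k)\<^sup>2) \<le> (\<Sum>k\<in>U. t * ((c k)\<^sup>2 * s k))"
    by (rule sum_mono)
  also have "\<dots> \<le> (\<Sum>k<n. t * ((c k)\<^sup>2 * s k))"
    using U(1) s \<open>0 \<le> t\<close> by (intro sum_mono2) auto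
  finally show ?thesis
    by (simp add: q sum_distrib_left)
qed

text \<open>After the Cauchy--Schwarz inequality every difference \<open>z m - z l\<close> contributes the energies of
its two terms in subdomain m. For a fixed \<open>z i\<close> these are the pairs \<open>(m, l)\<close> with \<open>m = i\<close> and those with \<open>l = i\<close>;
they are disjoint parts of the double sum A.\<close>

lemma scaled_jump_energy:
  fixes S D :: "nat \<Rightarrow> ('a, 'a) matx"
  assumes "finite N" and psd: "\<And>m. m \<in> N \<Longrightarrow> psd_on C (S m)"
  defines "A \<equiv> \<lambda>x y. \<Sum>m\<in>N. \<Sum>l\<in>N - {m}. mmult C (mtrans (D l)) (mmult C (S m) (D l)) x y"
  shows "(\<Sum>m\<in>N. qf C (S m) (\<lambda>x. \<Sum>l\<in>N - {m}. mvec C (D l) (\<lambda>y. z m y - z l y) x))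
     \<le> 2 * (real (card N) - 1) * (\<Sum>m\<in>N. qf C A (z m))"
proof -
  define q where "q = (\<lambda>m l i. qf C (S m) (mvec C (D l) (z i)))"
  have q: "0 \<le> q m l i" if "m \<in> N" for m l i
    unfolding q_def by (rule psd_nonneg[OF psd[OF that]])
  have A: "qf C A (z i) = (\<Sum>m\<in>N. \<Sum>l\<in>N - {m}. q m l i)" for i
  proof -
    have "qf C A (z i) = (\<Sum>m\<in>N. \<Sum>l\<in>N - {m}.
        ip C (z i) (mvec C (mtrans (D l)) (mvec C (S m) (mvec C (D l) (z i)))))"
      by (simp only: qf_def A_def mvec_matrix_sum mvec_mmult ip_sum_right)
    moreover have "ip C x (mvec C (mtrans M) y) = ip C (mvec C M x) y" for x y and M :: "('a, 'a) matx"
      by (subst ip_adjoint) (simp add: mtrans_def)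
    ultimately show ?thesis
      by (simp only: q_def qf_def)
  qed
  have "qf C (S m) (\<lambda>x. \<Sum>l\<in>N - {m}. mvec C (D l) (\<lambda>y. z m y - z l y) x)
      \<le> (real (card N) - 1) * (\<Sum>l\<in>N - {m}. 2 * (q m l m + q m l l))" if m: "m \<in> N" for m
  proof -
    have card: "real (card (N - {m})) = real (card N) - 1"
      using m \<open>finite N\<close> card_gt_0_iff[of N] by (auto simp: card_Diff_singleton of_nat_diff)
    have "qf C (S m) (\<lambda>x. \<Sum>l\<in>N - {m}. mvec C (D l) (\<lambda>y. z m y - z l y) x)
        \<le> real (card (N - {m})) * (\<Sum>l\<in>N - {m}. qf C (S m) (mvec C (D l) (\<lambda>y. z m y - z l y)))"
      by (rule qf_sum_le[OF psd[OF m]]) (use \<open>finite N\<close> in simp)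
    also have "\<dots> \<le> real (card (N - {m})) * (\<Sum>l\<in>N - {m}. 2 * (q m l m + q m l l))"
      unfolding q_def mvec_diff by (intro mult_left_mono sum_mono qf_diff_le psd m) simp
    finally show ?thesis
      by (simp only: card)
  qed
  then have "(\<Sum>m\<in>N. qf C (S m) (\<lambda>x. \<Sum>l\<in>N - {m}. mvec C (D l) (\<lambda>y. z m y - z l y) x))
      \<le> (\<Sum>m\<in>N. (real (card N) - 1) * (\<Sum>l\<in>N - {m}. 2 * (q m l m + q m l l)))"
    by (rule sum_mono)
  also have "\<dots> = 2 * (real (card N) - 1) * (\<Sum>m\<in>N. \<Sum>l\<in>N - {m}. q m l m + q m l l)"
    unfolding sum_distrib_left by (intro sum.cong refl) (simp add: algebra_simps)
  also have "\<dots> \<le> 2 * (real (card N) - 1) * (\<Sum>m\<in>N. \<Sum>l\<in>N - {m}. \<Sum>i\<in>N. q m l i)"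
  proof (cases "N = {}")
    case False
    then have "1 \<le> real (card N)"
      using \<open>finite N\<close> by (simp add: Suc_leI card_gt_0_iff)
    moreover have "q m l m + q m l l \<le> (\<Sum>i\<in>N. q m l i)" if "m \<in> N" "l \<in> N - {m}" for m l
    proof -
      \<comment> \<open>Here \<open>m \<noteq> l\<close> matters: the two terms are different members of the sum over i.\<close>
    have "(\<Sum>i\<in>{m, l}. q m l i) \<le> (\<Sum>i\<in>N. q m l i)"
        using that \<open>finite N\<close> q by (intro sum_mono2) auto
      then show ?thesis
        using that by auto
    qed
    ultimately show ?thesis
      by (intro mult_left_mono sum_mono) auto
  qed simp
  also have "(\<Sum>m\<in>N. \<Sum>l\<in>N - {m}. \<Sum>i\<in>N. q m l i) = (\<Sum>i\<in>N. qf C A (z i))"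
  proof -
    have "(\<Sum>m\<in>N. \<Sum>l\<in>N - {m}. \<Sum>i\<in>N. q m l i) = (\<Sum>m\<in>N. \<Sum>i\<in>N. \<Sum>l\<in>N - {m}. q m l i)"
      by (intro sum.cong refl sum.swap)
    also have "\<dots> = (\<Sum>i\<in>N. \<Sum>m\<in>N. \<Sum>l\<in>N - {m}. q m l i)"
      by (rule sum.swap)
    finally show ?thesis
      by (simp only: A)
  qed
  finally show ?thesis .
qed

text \<open>Here c runs through the classes of one kind, and i has \<open>n i\<close> of them. The constant K couples \<open>n i\<close> and
\<open>w c\<close> only for \<open>i \<in> I c\<close>, so both factors n, the one of i and the one of the neighbour whose energy
appears, are estimated through the shared class: \<open>n i \<le> sqrt (K / w c)\<close> for the first and
\<open>sqrt (w c) \<le> sqrt K / n i\<close> for the second.\<close>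

lemma weighted_class_count:
  fixes a :: "'i \<Rightarrow> 'c \<Rightarrow> real" and w :: "'c \<Rightarrow> real" and Q :: "'i \<Rightarrow> real"
  assumes "finite G" and "finite N" and I: "\<And>c. c \<in> G \<Longrightarrow> I c \<subseteq> N"
    and K: "\<And>c i. c \<in> G \<Longrightarrow> i \<in> I c \<Longrightarrow> (real (card {c\<in>G. i \<in> I c}))\<^sup>2 * w c \<le> K"
    and w: "\<And>c. c \<in> G \<Longrightarrow> 0 < w c" and "0 \<le> K" and "0 \<le> t"
    and a: "\<And>c i. c \<in> G \<Longrightarrow> i \<in> I c \<Longrightarrow> 0 \<le> a i c"
    and Q: "\<And>i. i \<in> N \<Longrightarrow> 0 \<le> Q i"
    and bound: "\<And>c. c \<in> G \<Longrightarrow> (\<Sum>i\<in>I c. a i c) \<le> t * w c * (\<Sum>i\<in>I c. Q i)"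
  shows "(\<Sum>i\<in>N. card {c\<in>G. i \<in> I c} * (\<Sum>c | c \<in> G \<and> i \<in> I c. a i c)) \<le> t * K * (\<Sum>i\<in>N. Q i)"
proof -
  let ?n = "\<lambda>i. real (card {c\<in>G. i \<in> I c})"
  have swap: "(\<Sum>i\<in>N. \<Sum>c | c \<in> G \<and> i \<in> I c. f i c) = (\<Sum>c\<in>G. \<Sum>i\<in>I c. f i c)" for f :: "'i \<Rightarrow> 'c \<Rightarrow> real"
  proof -
    have "(\<Sum>i\<in>N. \<Sum>c | c \<in> G \<and> i \<in> I c. f i c) = (\<Sum>c\<in>G. \<Sum>i | i \<in> N \<and> i \<in> I c. f i c)"
      by (rule sum.swap_restrict[OF \<open>finite N\<close> \<open>finite G\<close>])
    also have "\<dots> = (\<Sum>c\<in>G. \<Sum>i\<in>I c. f i c)"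
      using I by (intro sum.cong refl) auto
    finally show ?thesis .
  qed
  have n_sqrt: "?n i * sqrt (w c) \<le> sqrt K" if "c \<in> G" "i \<in> I c" for c i
    using real_sqrt_le_mono[OF K[OF that]] by (simp add: real_sqrt_mult)
  have "(\<Sum>i\<in>N. ?n i * (\<Sum>c | c \<in> G \<and> i \<in> I c. a i c)) = (\<Sum>c\<in>G. \<Sum>i\<in>I c. ?n i * a i c)"
    by (simp add: sum_distrib_left swap)
  also have "\<dots> \<le> (\<Sum>c\<in>G. \<Sum>i\<in>I c. (sqrt K / sqrt (w c)) * a i c)"
    using n_sqrt w a by (intro sum_mono mult_right_mono) (auto simp: pos_le_divide_eq)
  also have "\<dots> = (\<Sum>c\<in>G. (sqrt K / sqrt (w c)) * (\<Sum>i\<in>I c. a i c))"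
    by (simp add: sum_distrib_left)
  also have "\<dots> \<le> (\<Sum>c\<in>G. (sqrt K / sqrt (w c)) * (t * w c * (\<Sum>i\<in>I c. Q i)))"
    using w \<open>0 \<le> K\<close> by (intro sum_mono mult_left_mono bound) (auto simp: less_imp_le)
  also have "\<dots> = (\<Sum>c\<in>G. \<Sum>i\<in>I c. t * sqrt K * (sqrt (w c) * Q i))"
  proof (intro sum.cong refl)
    fix c assume "c \<in> G"
    have "(sqrt K / sqrt (w c)) * (t * w c) = t * sqrt K * sqrt (w c)"
    proof -
      have "(sqrt K / sqrt (w c)) * (t * w c) = t * sqrt K * (w c / sqrt (w c))"
        by simp
      then show ?thesis
        using w[OF \<open>c \<in> G\<close>] by (simp only: real_div_sqrt less_imp_le)
    qed
    then show "(sqrt K / sqrt (w c)) * (t * w c * (\<Sum>i\<in>I c. Q i)) = (\<Sum>i\<in>I c. t * sqrt K * (sqrt (w c) * Q i))"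
      by (simp add: sum_distrib_left[symmetric] mult.assoc[symmetric])
  qed
  also have "\<dots> = (\<Sum>i\<in>N. \<Sum>c | c \<in> G \<and> i \<in> I c. t * sqrt K * (sqrt (w c) * Q i))"
    by (rule swap[symmetric])
  also have "\<dots> \<le> (\<Sum>i\<in>N. t * K * Q i)"
  proof (intro sum_mono)
    fix i assume i: "i \<in> N"
    let ?G = "{c \<in> G. i \<in> I c}"
    have "(\<Sum>c\<in>?G. sqrt (w c)) \<le> sqrt K"
    proof (cases "?G = {}")
      case True
      then show ?thesis
        using \<open>0 \<le> K\<close> by (simp only: sum.empty real_sqrt_ge_zero)
    next
      case False
      then have n: "0 < ?n i"
        using \<open>finite G\<close> by (simp add: card_gt_0_iff)
      have "(\<Sum>c\<in>?G. sqrt (w c)) \<le> (\<Sum>c\<in>?G. sqrt K / ?n i)"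
        using n_sqrt n by (intro sum_mono) (auto simp: pos_le_divide_eq mult.commute)
      then show ?thesis
        using n by simp
    qed
    then have "t * sqrt K * Q i * (\<Sum>c\<in>?G. sqrt (w c)) \<le> t * sqrt K * Q i * sqrt K"
      using Q[OF i] \<open>0 \<le> t\<close> \<open>0 \<le> K\<close> by (intro mult_left_mono) auto
    also have "\<dots> = t * K * Q i"
      using \<open>0 \<le> K\<close> by (simp add: mult_ac)
    finally show "(\<Sum>c\<in>?G. t * sqrt K * (sqrt (w c) * Q i)) \<le> t * K * Q i"
      by (simp add: sum_distrib_left mult_ac)
  qed
  finally show ?thesis
    by (simp add: sum_distrib_left)
qed

section \<open>Hat functions on a tetrahedral mesh\<close>

lemma affine_interpolation:
  fixes V :: "'a::euclidean_space set"
  assumes "\<not> affine_dependent V"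
  obtains g :: 'a and c where "\<And>v. v \<in> V \<Longrightarrow> g \<bullet> v + c = f v"
proof (cases "V = {}")
  case True
  then show thesis using that by blast
next
  case False
  then obtain a where a: "a \<in> V" by blast
  let ?B = "(\<lambda>x. - a + x) ` (V - {a})"
  have "independent ?B"
    using affine_dependent_iff_dependent[of a "V - {a}"] assms a by (simp add: insert_absorb)
  from linear_independent_extend[OF this, of "\<lambda>x. f (a + x) - f a"]
  obtain h :: "'a \<Rightarrow> real" where h: "linear h" "\<forall>x\<in>?B. h x = f (a + x) - f a"
    by blast
  let ?g = "adjoint h 1"
  have g: "?g \<bullet> x = h x" for x
    using adjoint_works[OF h(1), of x 1] by (simp add: inner_commute)
  have "?g \<bullet> v + (f a - ?g \<bullet> a) = f v" if "v \<in> V" for v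
  proof (cases "v = a")
    case False
    then have "h (- a + v) = f v - f a"
      using bspec[OF h(2), of "- a + v"] that by auto
    then show ?thesis
      using linear_add[OF h(1), of "- a" v] linear_neg[OF h(1), of a] by (simp add: g)
  qed simp
  then show thesis by (rule that)
qed

lemma affine_eq_on_convex_hull:
  fixes g g' :: "'a::euclidean_space"
  assumes "\<And>v. v \<in> V \<Longrightarrow> g \<bullet> v + c = g' \<bullet> v + c'" and "x \<in> convex hull V"
  shows "g \<bullet> x + c = g' \<bullet> x + c'"
proof -
  have "convex hull V \<subseteq> {x. (g - g') \<bullet> x = c' - c}"
    using assms(1) by (intro hull_minimal convex_hyperplane) (auto simp: inner_diff_left algebra_simps)
  then have "(g - g') \<bullet> x = c' - c"
    using assms(2) by auto
  then show ?thesis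
    by (simp add: inner_diff_left algebra_simps)
qed

lemma gradient_of_affine:
  assumes "\<And>x. x \<in> T \<Longrightarrow> u x = g \<bullet> x + c" and "y \<in> interior T"
  shows "grad u y = g"
proof -
  have aff: "GDERIV (\<lambda>x. g \<bullet> x + c) y :> g"
    unfolding gderiv_def by (auto intro!: derivative_eq_intros simp: inner_commute)
  have der: "GDERIV u y :> g"
    unfolding gderiv_def
  proof (rule has_derivative_transform_within_open[OF aff[unfolded gderiv_def] open_interior assms(2)])
    fix x assume "x \<in> interior T"
    then show "g \<bullet> x + c = u x"
      using assms(1) interior_subset by (metis subsetD)
  qed
  have "g' = g" if "GDERIV u y :> g'" for g'
  proof -
    have "(\<lambda>h. h \<bullet> g') = (\<lambda>h. h \<bullet> g)"
      using has_derivative_unique[OF that[unfolded gderiv_def] der[unfolded gderiv_def]] .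
    then show ?thesis
      by (metis inner_eq_zero_iff inner_diff_right right_minus_eq)
  qed
  then show ?thesis
    unfolding grad_def using der by (rule the_equality[rotated])
qed

lemma triangulation_simplex:
  fixes \<T> :: "point set set"
  assumes "mesh_of \<Omega> \<T>" and "T \<in> \<T>"
  shows "convex T" and "compact T" and "interior T \<noteq> {}"
    and "T = convex hull {v. v extreme_point_of T}"
    and "\<not> affine_dependent {v. v extreme_point_of T}"
    and "finite {v. v extreme_point_of T}"
    and "T \<subseteq> closure \<Omega>"
proof -
  have T: "3 simplex T"
    using assms by (simp add: mesh_of_def)
  then show "convex T" "compact T"
    by (auto intro: convex_simplex compact_simplex)
  obtain V where V: "finite V" "\<not> affine_dependent V" "T = convex hull V"
    using T unfolding simplex by blast
  then have "{v. v extreme_point_of T} = V"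
    by (auto simp: extreme_point_of_convex_hull_affine_independent)
  with V show "T = convex hull {v. v extreme_point_of T}"
    "\<not> affine_dependent {v. v extreme_point_of T}" "finite {v. v extreme_point_of T}"
    by simp_all
  have dim: "aff_dim T = 3"
    using T by (rule aff_dim_simplex)
  then have "T \<noteq> {}" by auto
  then show "interior T \<noteq> {}"
    using interior_rel_interior[of T] rel_interior_eq_empty[OF \<open>convex T\<close>] dim by simp
  show "T \<subseteq> closure \<Omega>"
    using assms by (auto simp: mesh_of_def)
qed

lemma mesh_finite: "mesh_of \<Omega> \<T> \<Longrightarrow> finite \<T>"
  by (simp add: mesh_of_def triangulation_def)

lemma mesh_face:
  "mesh_of \<Omega> \<T> \<Longrightarrow> T \<in> \<T> \<Longrightarrow> T' \<in> \<T> \<Longrightarrow> T \<inter> T' face_of T"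
  by (simp add: mesh_of_def triangulation_def)

lemma nodes_finite:
  assumes "mesh_of \<Omega> \<T>"
  shows "finite (nodes \<T>)"
proof -
  have "nodes \<T> = (\<Union>T\<in>\<T>. {v. v extreme_point_of T})"
    by (auto simp: nodes_def)
  then show ?thesis
    using mesh_finite[OF assms] triangulation_simplex(6)[OF assms] by simp
qed

text \<open>The intersection is a face of both elements, and a proper face misses the interior. If it
is all of T, then T is a proper face of \<open>T'\<close>, which cannot have interior points.\<close>

lemma elements_interior_disjoint:
  assumes "mesh_of \<Omega> \<T>" and "T \<in> \<T>" and "T' \<in> \<T>" and "T \<noteq> T'"
  shows "interior T \<inter> T' = {}"
proof (cases "T \<inter> T' = T")
  case False
  then have "(T \<inter> T') \<inter> interior T = {}"
    using mesh_face[OF assms(1-3)] by (intro face_of_disjoint_interior)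
  then show ?thesis
    using interior_subset[of T] by auto
next
  case True
  have "T' \<inter> T face_of T'"
    by (rule mesh_face[OF assms(1,3,2)])
  then have "T face_of T'"
    using True by (simp add: Int_commute)
  then have "T \<inter> interior T' = {}"
    using assms(4) by (intro face_of_disjoint_interior)
  moreover have "interior T \<subseteq> interior T'"
    using True by (intro interior_mono) auto
  ultimately have "interior T = {}"
    using interior_subset[of T] by auto
  then show ?thesis by simp
qed

lemma continuous_on_finite_closed_Union:
  assumes "finite \<T>" and "\<And>T. T \<in> \<T> \<Longrightarrow> closed T" and "\<And>T. T \<in> \<T> \<Longrightarrow> continuous_on T f"
  shows "continuous_on (\<Union>\<T>) f"
  using assms
proof (induction \<T> rule: finite_induct)
  case (insert T \<T>)
  then have "continuous_on (T \<union> \<Union>\<T>) f"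
    by (intro continuous_on_closed_Un closed_Union) auto
  then show ?case by simp
qed simp

text \<open>On each element take the affine function with the prescribed vertex values. On the
intersection of two elements, which is the convex hull of common vertices, the two affine functions agree.
Likewise the function vanishes on the frontier, a union of faces whose vertices differ from x.\<close>

lemma hat_function_exists:
  assumes mesh: "mesh_of \<Omega> \<T>" and "x \<notin> frontier \<Omega>"
  shows "\<exists>u. u \<in> fe_space \<Omega> \<T> \<and> (\<forall>y\<in>nodes \<T>. u y = (if y = x then 1 else 0))"
proof -
  let ?V = "\<lambda>T. {v. v extreme_point_of T}"
  let ?e = "\<lambda>v. if v = x then 1 else (0::real)"
  have "\<exists>g c. \<forall>v\<in>?V T. g \<bullet> v + c = ?e v" if "T \<in> \<T>" for T
    by (rule affine_interpolation[OF triangulation_simplex(5)[OF mesh that], of ?e]) blast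
  then obtain g c where gc: "\<And>T v. T \<in> \<T> \<Longrightarrow> v extreme_point_of T \<Longrightarrow> g T \<bullet> v + c T = ?e v"
    by (metis mem_Collect_eq)
  define u where "u = (\<lambda>y. let T = (SOME T. T \<in> \<T> \<and> y \<in> T) in g T \<bullet> y + c T)"
  have agree: "g T \<bullet> y + c T = g T' \<bullet> y + c T'"
    if "T \<in> \<T>" "T' \<in> \<T>" "y \<in> T" "y \<in> T'" for T T' y
  proof (rule affine_eq_on_convex_hull)
    have F: "T \<inter> T' face_of T" "T' \<inter> T face_of T'"
      using mesh_face[OF mesh] that by auto
    have "compact (T \<inter> T')" "convex (T \<inter> T')"
      using triangulation_simplex(1,2)[OF mesh] that by (auto intro: convex_Int compact_Int)
    then have "T \<inter> T' = convex hull ?V (T \<inter> T')"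
      by (rule Krein_Milman_Minkowski)
    then show "y \<in> convex hull ?V (T \<inter> T')"
      using that by blast
    fix v assume "v \<in> ?V (T \<inter> T')"
    then have "v extreme_point_of T" "v extreme_point_of T'"
      using extreme_point_of_face[OF F(1)] extreme_point_of_face[OF F(2)] by (auto simp: Int_commute)
    then show "g T \<bullet> v + c T = g T' \<bullet> v + c T'"
      using gc that by simp
  qed
  have u: "u y = g T \<bullet> y + c T" if "T \<in> \<T>" "y \<in> T" for T y
  proof -
    have "(SOME T. T \<in> \<T> \<and> y \<in> T) \<in> \<T> \<and> y \<in> (SOME T. T \<in> \<T> \<and> y \<in> T)"
      by (rule someI[of "\<lambda>T. T \<in> \<T> \<and> y \<in> T"]) (use that in simp)
    then show ?thesis
      unfolding u_def Let_def using agree that by blast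
  qed
  have "continuous_on T u" if "T \<in> \<T>" for T
  proof (rule continuous_on_eq[of _ "\<lambda>y. g T \<bullet> y + c T"])
    show "continuous_on T (\<lambda>y. g T \<bullet> y + c T)"
      by (intro continuous_intros)
    show "g T \<bullet> y + c T = u y" if "y \<in> T" for y
      by (rule u[OF \<open>T \<in> \<T>\<close> that, symmetric])
  qed
  then have "continuous_on (\<Union>\<T>) u"
    using mesh_finite[OF mesh] triangulation_simplex(2)[OF mesh]
    by (intro continuous_on_finite_closed_Union compact_imp_closed)
  then have 1: "continuous_on (closure \<Omega>) u"
    using mesh by (simp add: mesh_of_def)
  have 2: "\<forall>T\<in>\<T>. \<exists>g c. \<forall>x\<in>T. u x = g \<bullet> x + c"
    using u by blast
  have 3: "u y = 0" if y: "y \<in> frontier \<Omega>" for y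
  proof -
    have "frontier \<Omega> = \<Union>{S. S \<subseteq> frontier \<Omega> \<and> (\<exists>T\<in>\<T>. S face_of T)}"
      using mesh by (simp add: mesh_of_def)
    then obtain S T where S: "y \<in> S" "S \<subseteq> frontier \<Omega>" "T \<in> \<T>" "S face_of T"
      using y by blast
    have "compact S" "convex S"
      using face_of_imp_compact[OF triangulation_simplex(1,2)[OF mesh S(3)] S(4)]
        face_of_imp_convex[OF S(4)] by auto
    then have "S = convex hull ?V S"
      by (rule Krein_Milman_Minkowski)
    then have "y \<in> convex hull ?V S"
      using S(1) by blast
    then have "g T \<bullet> y + c T = 0 \<bullet> y + 0"
    proof (rule affine_eq_on_convex_hull[rotated])
      fix v assume v: "v \<in> ?V S"
      then have "v extreme_point_of T"
        using extreme_point_of_face[OF S(4)] by simp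
      moreover have "v \<in> S"
        using v by (simp add: extreme_point_of_def)
      then have "v \<noteq> x"
        using S(2) assms(2) by blast
      ultimately show "g T \<bullet> v + c T = 0 \<bullet> v + 0"
        using gc[OF S(3)] by simp
    qed
    then show ?thesis
      using u[OF S(3)] face_of_imp_subset[OF S(4)] S(1) by auto
  qed
  have 4: "u y = ?e y" if y: "y \<in> nodes \<T>" for y
  proof -
    obtain T where T: "T \<in> \<T>" "y extreme_point_of T"
      using y by (auto simp: nodes_def)
    then show ?thesis
      using u[OF T(1), of y] gc[OF T] by (auto simp: extreme_point_of_def)
  qed
  show ?thesis
    using 1 2 3 4 unfolding fe_space_def by (intro exI[of _ u]) auto
qed

lemma nodal_basis_hat:
  assumes "mesh_of \<Omega> \<T>" and "x \<notin> frontier \<Omega>"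
  shows "nodal_basis \<Omega> \<T> x \<in> fe_space \<Omega> \<T>"
    and "y \<in> nodes \<T> \<Longrightarrow> nodal_basis \<Omega> \<T> x y = (if y = x then 1 else 0)"
  using someI_ex[OF hat_function_exists[OF assms]] by (auto simp: nodal_basis_def)

section \<open>Assembly of the stiffness matrices from elements\<close>

text \<open>An element that is a face inside the frontier of \<Omega> would contain a point of \<Omega>; so the
frontier consists of proper faces.\<close>

lemma frontier_negligible:
  assumes "mesh_of \<Omega> \<T>" and "open \<Omega>"
  shows "negligible (frontier \<Omega>)"
proof -
  have "frontier \<Omega> \<subseteq> (\<Union>T\<in>\<T>. frontier T)"
  proof
    fix y assume y: "y \<in> frontier \<Omega>"
    have "frontier \<Omega> = \<Union>{S. S \<subseteq> frontier \<Omega> \<and> (\<exists>T\<in>\<T>. S face_of T)}"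
      using assms by (simp add: mesh_of_def)
    then obtain S T where S: "y \<in> S" "S \<subseteq> frontier \<Omega>" "T \<in> \<T>" "S face_of T"
      using y by blast
    note T = triangulation_simplex[OF assms(1) S(3)]
    have "interior T \<inter> closure \<Omega> \<noteq> {}"
      using T(3,7) interior_subset[of T] by blast
    then have "interior T \<inter> \<Omega> \<noteq> {}"
      using open_Int_closure_eq_empty[OF open_interior] by blast
    then have "S \<noteq> T"
      using S(2) \<open>open \<Omega>\<close> interior_subset[of T] by (auto simp: frontier_def interior_open)
    then have "S \<inter> interior T = {}"
      using S(4) by (intro face_of_disjoint_interior)
    then have "y \<in> T - interior T"
      using S(1) face_of_imp_subset[OF S(4)] by blast
    then show "y \<in> (\<Union>T\<in>\<T>. frontier T)"
      using S(3) closure_subset[of T] by (auto simp: frontier_def)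
  qed
  moreover have "negligible (\<Union>T\<in>\<T>. frontier T)"
    using mesh_finite[OF assms(1)] triangulation_simplex(1)[OF assms(1)]
    by (intro negligible_Union) (auto intro: negligible_convex_frontier)
  ultimately show ?thesis
    by (rule negligible_subset[rotated])
qed

lemma coefficient_on_element:
  fixes \<rho> :: "point \<Rightarrow> real"
  assumes mesh: "mesh_of \<Omega> \<T>" and "open \<Omega>" and \<rho>: "\<rho> absolutely_integrable_on \<Omega>"
    and "0 < \<rho>0" and lb: "\<And>x. x \<in> \<Omega> \<Longrightarrow> \<rho>0 \<le> \<rho> x" and T: "T \<in> \<T>"
  shows "\<rho> absolutely_integrable_on T" and "0 < integral T \<rho>"
proof -
  note tri = triangulation_simplex[OF mesh T]
  have sub: "T - \<Omega> \<subseteq> frontier \<Omega>"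
    using tri(7) \<open>open \<Omega>\<close> by (auto simp: frontier_def interior_open)
  then have negl: "negligible (T - \<Omega>)"
    using frontier_negligible[OF mesh \<open>open \<Omega>\<close>] negligible_subset by blast
  have meas: "T \<in> lmeasurable"
    by (rule lmeasurable_compact[OF tri(2)])
  have "\<rho> absolutely_integrable_on (T \<inter> \<Omega>)"
    by (rule set_integrable_subset[OF \<rho>]) (use meas \<open>open \<Omega>\<close> in auto)
  moreover have "negligible {x \<in> T \<inter> \<Omega> - T. \<rho> x \<noteq> 0}"
    by (rule negligible_subset[OF negligible_empty]) auto
  moreover have "negligible {x \<in> T - T \<inter> \<Omega>. \<rho> x \<noteq> 0}"
    by (rule negligible_subset[OF negl]) auto
  ultimately show int: "\<rho> absolutely_integrable_on T"
    using absolutely_integrable_spike_set_eq[of "T \<inter> \<Omega>" T \<rho>] by blast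
  then have "(\<rho> has_integral integral T \<rho>) T"
    using absolutely_integrable_on_def integrable_integral by blast
  \<comment> \<open>Off \<Omega> the coefficient may be anything, so it is replaced there before the comparison.\<close>
  then have "((\<lambda>x. if x \<in> \<Omega> then \<rho> x else \<rho>0) has_integral integral T \<rho>) T"
    by (rule has_integral_spike[OF negl, rotated]) auto
  moreover have "((\<lambda>x. \<rho>0 * 1) has_integral \<rho>0 * measure lebesgue T) T"
    using integrable_integral[OF integrable_on_const[OF meas, of "1::real"]]
    by (intro has_integral_mult_right) (simp add: lmeasure_integral[OF meas])
  ultimately have "\<rho>0 * measure lebesgue T \<le> integral T \<rho>"
    using lb by (elim has_integral_le[rotated]) auto
  moreover have "measure lebesgue T \<noteq> 0"
    using tri(3) open_not_negligible[OF open_interior tri(3)] negligible_subset[OF _ interior_subset]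
      negligible_iff_measure0[OF meas] by blast
  then have "0 < measure lebesgue T"
    using measure_nonneg[of lebesgue T] by linarith
  ultimately show "0 < integral T \<rho>"
    using \<open>0 < \<rho>0\<close> by (meson less_le_trans mult_pos_pos)
qed

lemma energy_form_elementwise:
  fixes f :: "point \<Rightarrow> real"
  assumes mesh: "mesh_of \<Omega> \<T>" and "\<S> \<subseteq> \<T>"
    and \<rho>: "\<And>T. T \<in> \<S> \<Longrightarrow> \<rho> absolutely_integrable_on T"
    and u: "\<And>T x. T \<in> \<S> \<Longrightarrow> x \<in> interior T \<Longrightarrow> grad u x = g T"
    and v: "\<And>T x. T \<in> \<S> \<Longrightarrow> x \<in> interior T \<Longrightarrow> grad v x = h T"
  shows "energy_form \<rho> (\<Union>\<S>) u v = (\<Sum>T\<in>\<S>. integral T \<rho> * (g T \<bullet> h T))"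
proof -
  have fin: "finite \<S>"
    using finite_subset[OF assms(2) mesh_finite[OF mesh]] .
  let ?f = "\<lambda>x. \<rho> x * (grad u x \<bullet> grad v x)"
  have negl: "negligible (frontier T)" and closed: "closed T" if "T \<in> \<S>" for T
    using triangulation_simplex(1,2)[OF mesh, of T] that assms(2)
    by (auto intro: negligible_convex_frontier compact_imp_closed)
  have f: "?f x = \<rho> x * (g T \<bullet> h T)" if "T \<in> \<S>" "x \<in> T - frontier T" for T x
  proof -
    have "x \<in> interior T"
      using that closed[OF that(1)] by (auto simp: frontier_def)
    then show ?thesis
      using u[OF that(1)] v[OF that(1)] by simp
  qed
  have abs_int: "?f absolutely_integrable_on T" if "T \<in> \<S>" for T
  proof (rule absolutely_integrable_spike[OF _ negl[OF that] f[OF that]])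
    show "(\<lambda>x. \<rho> x * (g T \<bullet> h T)) absolutely_integrable_on T"
      using \<rho>[OF that] by (cases "g T \<bullet> h T = 0") auto
  qed
  have int: "(?f has_integral integral T \<rho> * (g T \<bullet> h T)) T" if "T \<in> \<S>" for T
  proof (rule has_integral_spike[OF negl[OF that] f[OF that]])
    show "((\<lambda>x. \<rho> x * (g T \<bullet> h T)) has_integral integral T \<rho> * (g T \<bullet> h T)) T"
      using \<rho>[OF that] absolutely_integrable_on_def
      by (intro has_integral_mult_left integrable_integral) auto
  qed
  have "?f absolutely_integrable_on \<Union>\<S>"
    using fin abs_int
  proof (induction \<S> rule: finite_induct)
    case (insert T \<S>)
    then show ?case
      by (simp add: absolutely_integrable_Un)
  qed (simp add: set_integrable_def)
  then have "energy_form \<rho> (\<Union>\<S>) u v = integral (\<Union>\<S>) ?f"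
    unfolding energy_form_def by (rule set_lebesgue_integral_eq_integral(2))
  also have "(?f has_integral (\<Sum>T\<in>\<S>. integral T \<rho> * (g T \<bullet> h T))) (\<Union>\<S>)"
  proof (rule has_integral_Union[OF fin int])
    show "pairwise (\<lambda>S S'. negligible (S \<inter> S')) \<S>"
      unfolding pairwise_def
    proof (intro ballI impI)
      fix S S' assume S: "S \<in> \<S>" "S' \<in> \<S>" "S \<noteq> S'"
      then have "interior S \<inter> S' = {}"
        using assms(2) by (intro elements_interior_disjoint[OF mesh]) auto
      then have "S \<inter> S' \<subseteq> frontier S"
        using closure_subset[of S] by (auto simp: frontier_def)
      then show "negligible (S \<inter> S')"
        by (rule negligible_subset[OF negl[OF S(1)]])
    qed
  qed
  then have "integral (\<Union>\<S>) ?f = (\<Sum>T\<in>\<S>. integral T \<rho> * (g T \<bullet> h T))"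
    by (rule integral_unique)
  finally show ?thesis .
qed

definition element_weight :: "bddc \<Rightarrow> point set \<Rightarrow> real" where
  "element_weight X T = integral T (coeff X)"

text \<open>The gradient is constant on the interior of the element, so any interior point serves.\<close>

definition element_gradient :: "bddc \<Rightarrow> point set \<Rightarrow> point \<Rightarrow> point" where
  "element_gradient X T x = grad (nodal_basis (dom X) (mesh X) x) (SOME y. y \<in> interior T)"

text \<open>The finite element method in the form used below: the energy is a sum over the elements of positive weights
times squares of gradients, which are local, and a nodal vector all of whose gradients vanish is zero. For the
last property, the corresponding function is continuous with finitely many values on the connected closure of
the domain, so it is constant, and it vanishes on the nonempty frontier.\<close>

lemma stiffness_assembly:
  assumes fe: "fe_discretization X"
  defines "free \<equiv> nodes (mesh X) - frontier (dom X)"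
  shows "T \<in> mesh X \<Longrightarrow> 0 < element_weight X T"
    and "i \<in> {1..nsub X} \<Longrightarrow> x \<in> free \<Longrightarrow> y \<in> free \<Longrightarrow> stiffness X i x y
      = (\<Sum>T\<in>submesh X i. element_weight X T * (element_gradient X T x \<bullet> element_gradient X T y))"
    and "T \<in> mesh X \<Longrightarrow> x \<in> free \<Longrightarrow> x \<notin> T \<Longrightarrow> element_gradient X T x = 0"
    and "(\<And>T. T \<in> mesh X \<Longrightarrow> (\<Sum>x\<in>free. v x *\<^sub>R element_gradient X T x) = 0) \<Longrightarrow> x \<in> free \<Longrightarrow> v x = 0"
proof -
  let ?\<Omega> = "dom X" and ?\<T> = "mesh X" and ?\<phi> = "nodal_basis (dom X) (mesh X)"
  have mesh: "mesh_of ?\<Omega> ?\<T>" and "open ?\<Omega>" and "connected ?\<Omega>" and "bounded ?\<Omega>" and "?\<Omega> \<noteq> {}"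
    and \<rho>: "coeff X absolutely_integrable_on ?\<Omega>"
    and sub: "?\<T> = (\<Union>i\<in>{1..nsub X}. submesh X i)"
    using fe unfolding fe_discretization_def by blast+
  obtain \<rho>0 where \<rho>0: "0 < \<rho>0" "\<And>x. x \<in> ?\<Omega> \<Longrightarrow> \<rho>0 \<le> coeff X x"
    using fe unfolding fe_discretization_def by blast
  have coef: "coeff X absolutely_integrable_on T" "0 < integral T (coeff X)" if "T \<in> ?\<T>" for T
    by (rule coefficient_on_element[OF mesh \<open>open ?\<Omega>\<close> \<rho> \<rho>0(1) _ that], rule \<rho>0(2), assumption)+
  note tri = triangulation_simplex[OF mesh]
  have free: "finite free"
    using nodes_finite[OF mesh] by (simp add: free_def)
  have \<phi>: "?\<phi> x \<in> fe_space ?\<Omega> ?\<T>" "\<And>y. y \<in> nodes ?\<T> \<Longrightarrow> ?\<phi> x y = (if y = x then 1 else 0)"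
    if "x \<in> free" for x
    using nodal_basis_hat[OF mesh, of x] that by (auto simp: free_def)
  have "\<exists>g c. \<forall>y\<in>T. ?\<phi> x y = g \<bullet> y + c" if "T \<in> ?\<T>" "x \<in> free" for T x
    using \<phi>(1)[OF that(2)] that(1) by (simp add: fe_space_def)
  then obtain g c where gc: "\<And>T x y. T \<in> ?\<T> \<Longrightarrow> x \<in> free \<Longrightarrow> y \<in> T \<Longrightarrow> ?\<phi> x y = g T x \<bullet> y + c T x"
    by metis
  have grad: "grad (?\<phi> x) y = g T x" if "T \<in> ?\<T>" "x \<in> free" "y \<in> interior T" for T x y
    using gradient_of_affine[OF gc[OF that(1,2)] that(3)] .
  have eg: "element_gradient X T x = g T x" if "T \<in> ?\<T>" "x \<in> free" for T x
    unfolding element_gradient_def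
    using grad[OF that] someI_ex[of "\<lambda>y. y \<in> interior T"] tri(3)[OF that(1)] by blast
  have r_pos: "0 < integral T (coeff X)" if "T \<in> ?\<T>" for T
    by (rule coef(2)[OF that])
  have assembly: "stiffness X i x y
      = (\<Sum>T\<in>submesh X i. element_weight X T * (element_gradient X T x \<bullet> element_gradient X T y))"
    if "i \<in> {1..nsub X}" "x \<in> free" "y \<in> free" for i x y
  proof -
    have sub: "submesh X i \<subseteq> ?\<T>"
      using sub that(1) by blast
    then have "stiffness X i x y = (\<Sum>T\<in>submesh X i. integral T (coeff X) * (g T x \<bullet> g T y))"
      unfolding stiffness_def subdomain_def
      by (intro energy_form_elementwise[OF mesh] coef(1) grad that) auto
    also have "\<dots> = (\<Sum>T\<in>submesh X i. element_weight X T * (element_gradient X T x \<bullet> element_gradient X T y))"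
      using sub that by (intro sum.cong) (auto simp: eg element_weight_def)
    finally show ?thesis .
  qed
  have local_zero: "g T x = 0" if "T \<in> ?\<T>" "x \<in> free" "x \<notin> T" for T x
  proof -
    have "?\<phi> x y = 0 \<bullet> y + 0" if "y \<in> T" for y
    proof -
      have "y \<in> convex hull {v. v extreme_point_of T}"
        using tri(4)[OF \<open>T \<in> ?\<T>\<close>] that by blast
      then have "g T x \<bullet> y + c T x = 0 \<bullet> y + 0"
      proof (rule affine_eq_on_convex_hull[rotated])
        fix v assume "v \<in> {v. v extreme_point_of T}"
        then have v: "v \<in> T" "v \<in> nodes ?\<T>"
          using \<open>T \<in> ?\<T>\<close> by (auto simp: nodes_def extreme_point_of_def)
        then have "v \<noteq> x"
          using \<open>x \<notin> T\<close> by auto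
        then show "g T x \<bullet> v + c T x = 0 \<bullet> v + 0"
          using gc[OF \<open>T \<in> ?\<T>\<close> \<open>x \<in> free\<close> v(1)] \<phi>(2)[OF \<open>x \<in> free\<close> v(2)] by simp
      qed
      then show ?thesis
        using gc[OF \<open>T \<in> ?\<T>\<close> \<open>x \<in> free\<close> that] by simp
    qed
    moreover obtain y where y: "y \<in> interior T"
      using tri(3)[OF \<open>T \<in> ?\<T>\<close>] by blast
    ultimately have "grad (?\<phi> x) y = 0"
      by (intro gradient_of_affine)
    then show ?thesis
      using grad[OF \<open>T \<in> ?\<T>\<close> \<open>x \<in> free\<close> y] by simp
  qed
  have inj: "v x = 0"
    if v: "\<And>T. T \<in> ?\<T> \<Longrightarrow> (\<Sum>x\<in>free. v x *\<^sub>R g T x) = 0" and x: "x \<in> free" for v :: "point \<Rightarrow> real" and x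
  proof -
    define u where "u = (\<lambda>y. \<Sum>x\<in>free. v x * ?\<phi> x y)"
    have u: "u y = (\<Sum>x\<in>free. v x * c T x)" if "T \<in> ?\<T>" "y \<in> T" for T y
    proof -
      have "u y = (\<Sum>x\<in>free. v x * (g T x \<bullet> y + c T x))"
        unfolding u_def using gc[OF that(1) _ that(2)] by (intro sum.cong) auto
      also have "\<dots> = (\<Sum>x\<in>free. v x *\<^sub>R g T x) \<bullet> y + (\<Sum>x\<in>free. v x * c T x)"
        by (simp add: inner_sum_left sum.distrib algebra_simps)
      finally show ?thesis
        using v[OF that(1)] by simp
    qed
    have cont: "continuous_on (closure ?\<Omega>) u"
      unfolding u_def using \<phi>(1) by (intro continuous_intros) (auto simp: fe_space_def)
    have cover: "closure ?\<Omega> = \<Union>?\<T>"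
      using mesh by (simp add: mesh_of_def)
    have "u ` closure ?\<Omega> \<subseteq> (\<lambda>T. \<Sum>x\<in>free. v x * c T x) ` ?\<T>"
      unfolding cover using u by blast
    then have "finite (u ` closure ?\<Omega>)"
      by (rule finite_subset) (simp add: mesh_finite[OF mesh])
    then have "u constant_on closure ?\<Omega>"
      by (rule continuous_finite_range_constant[OF connected_imp_connected_closure[OF \<open>connected ?\<Omega>\<close>] cont])
    then obtain k where k: "\<And>y. y \<in> closure ?\<Omega> \<Longrightarrow> u y = k"
      by (auto simp: constant_on_def)
    have "?\<Omega> \<noteq> UNIV"
      using \<open>bounded ?\<Omega>\<close> not_bounded_UNIV by auto
    then obtain z where z: "z \<in> frontier ?\<Omega>"
      using frontier_not_empty[OF \<open>?\<Omega> \<noteq> {}\<close>] by blast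
    have "u z = 0"
      unfolding u_def using \<phi>(1) z by (intro sum.neutral) (auto simp: fe_space_def)
    moreover have "z \<in> closure ?\<Omega>"
      using z by (simp add: frontier_def)
    ultimately have "k = 0"
      using k by force
    have x_node: "x \<in> nodes ?\<T>"
      using x by (simp add: free_def)
    then have "x \<in> closure ?\<Omega>"
      unfolding cover by (auto simp: nodes_def extreme_point_of_def)
    then have "0 = u x"
      using k \<open>k = 0\<close> by simp
    also have "\<dots> = (\<Sum>y\<in>free. if y = x then v x else 0)"
      unfolding u_def using \<phi>(2)[OF _ x_node] by (intro sum.cong) auto
    also have "\<dots> = v x"
      using x free by simp
    finally show ?thesis by simp
  qed
  show "T \<in> ?\<T> \<Longrightarrow> 0 < element_weight X T"
    using r_pos by (simp add: element_weight_def)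
  show "i \<in> {1..nsub X} \<Longrightarrow> x \<in> free \<Longrightarrow> y \<in> free \<Longrightarrow> stiffness X i x y
      = (\<Sum>T\<in>submesh X i. element_weight X T * (element_gradient X T x \<bullet> element_gradient X T y))"
    by (rule assembly)
  show "T \<in> ?\<T> \<Longrightarrow> x \<in> free \<Longrightarrow> x \<notin> T \<Longrightarrow> element_gradient X T x = 0"
    using local_zero by (simp add: eg)
  show "v x = 0"
    if v: "\<And>T. T \<in> ?\<T> \<Longrightarrow> (\<Sum>x\<in>free. v x *\<^sub>R element_gradient X T x) = 0" and x: "x \<in> free"
  proof (rule inj[OF _ x])
    fix T assume T: "T \<in> ?\<T>"
    have "(\<Sum>x\<in>free. v x *\<^sub>R g T x) = (\<Sum>x\<in>free. v x *\<^sub>R element_gradient X T x)"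
      by (intro sum.cong refl) (simp add: eg T)
    then show "(\<Sum>x\<in>free. v x *\<^sub>R g T x) = 0"
      using v[OF T] by simp
  qed
qed

section \<open>Geometry of the interface and subdomain energies\<close>

text \<open>The theorem assumes that \<open>bddc_const X * tol X\<close> is at least \<open>1\<close>, which makes the tolerance positive.\<close>

locale adaptive_bddc =
  fixes X :: bddc
  assumes fe: "fe_discretization X"
    and interface: "interface_partition X"
    and unity: "partition_of_unity X"
    and eigenbases: "adaptive_eigenbases X"
    and tol_pos: "0 < tol X"
begin

abbreviation "classes \<equiv> faces X \<union> edges X"
abbreviation "subs \<equiv> {1..nsub X}"

lemma mesh: "mesh_of (dom X) (mesh X)"
  and open_dom: "open (dom X)"
  and mesh_cover: "mesh X = (\<Union>i\<in>subs. submesh X i)"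
  and disjoint_submesh: "disjoint_family_on (submesh X) subs"
  using fe unfolding fe_discretization_def by blast+

lemma closure_dom: "closure (dom X) = (\<Union>i\<in>subs. subdomain X i)"
proof -
  have "closure (dom X) = \<Union>(mesh X)"
    using mesh by (simp add: mesh_of_def)
  then show ?thesis
    unfolding mesh_cover subdomain_def by blast
qed

lemma submesh_subset: "i \<in> subs \<Longrightarrow> submesh X i \<subseteq> mesh X"
  unfolding mesh_cover by blast

lemma closed_subdomain:
  assumes "i \<in> subs"
  shows "closed (subdomain X i)"
  unfolding subdomain_def
proof (rule closed_Union)
  show "finite (submesh X i)"
    using finite_subset[OF submesh_subset[OF assms] mesh_finite[OF mesh]] .
  show "\<forall>T\<in>submesh X i. closed T"
    using triangulation_simplex(2)[OF mesh] submesh_subset[OF assms] by (blast intro: compact_imp_closed)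
qed

text \<open>Every point of an element is a limit of interior points of it, and these lie in no
element of another subdomain.\<close>

lemma shared_point_not_interior:
  assumes i: "i \<in> subs" and j: "j \<in> subs" and "i \<noteq> j" and x: "x \<in> subdomain X j"
  shows "x \<notin> interior (subdomain X i)"
proof
  assume xi: "x \<in> interior (subdomain X i)"
  obtain T where T: "T \<in> submesh X j" "x \<in> T"
    using x by (auto simp: subdomain_def)
  have T_mesh: "T \<in> mesh X"
    using submesh_subset[OF j] T(1) by blast
  note tri = triangulation_simplex[OF mesh T_mesh]
  have "x \<in> closure (interior T)"
    using convex_closure_interior[OF tri(1,3)] closure_subset[of T] T(2) by blast
  then have "interior (subdomain X i) \<inter> interior T \<noteq> {}"
    using open_Int_closure_eq_empty[OF open_interior, of "subdomain X i" "interior T"] xi by blast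
  then obtain y where y: "y \<in> subdomain X i" "y \<in> interior T"
    using interior_subset by blast
  then obtain T' where T': "T' \<in> submesh X i" "y \<in> T'"
    by (auto simp: subdomain_def)
  have "submesh X i \<inter> submesh X j = {}"
    using disjoint_submesh i j \<open>i \<noteq> j\<close> by (simp add: disjoint_family_on_def)
  then have "T \<noteq> T'"
    using T(1) T'(1) by blast
  moreover have "T' \<in> mesh X"
    using submesh_subset[OF i] T'(1) by blast
  ultimately have "interior T \<inter> T' = {}"
    by (intro elements_interior_disjoint[OF mesh T_mesh])
  then show False
    using y(2) T'(2) by blast
qed

lemma frontier_subdomain_subset: "i \<in> subs \<Longrightarrow> frontier (subdomain X i) \<subseteq> subdomain X i"
  using closed_subdomain by (simp add: frontier_subset_closed)

lemma interior_node_unshared: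
  assumes i: "i \<in> subs" and x: "x \<in> interior_nodes X i"
    and j: "j \<in> subs" "x \<in> subdomain X j"
  shows "j = i"
proof (rule ccontr)
  assume "j \<noteq> i"
  then have "x \<notin> interior (subdomain X i)"
    using shared_point_not_interior[OF i j(1) _ j(2)] by blast
  moreover have "x \<in> subdomain X i" "x \<notin> frontier (subdomain X i)"
    using x by (auto simp: interior_nodes_def local_nodes_def)
  ultimately show False
    using closure_subset[of "subdomain X i"] by (auto simp: frontier_def)
qed

lemma interior_node_not_interface:
  assumes i: "i \<in> subs" and x: "x \<in> interior_nodes X i"
  shows "x \<notin> interface_nodes X"
proof
  assume "x \<in> interface_nodes X"
  then obtain j where j: "j \<in> subs" "x \<in> boundary_nodes X j"
    by (auto simp: interface_nodes_def)
  then have "x \<in> subdomain X j" "x \<in> frontier (subdomain X j)"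
    by (auto simp: boundary_nodes_def local_nodes_def)
  then show False
    using interior_node_unshared[OF i x j(1)] x by (auto simp: interior_nodes_def)
qed

text \<open>A node inside the domain on the frontier of one subdomain also lies in another one: otherwise
a neighbourhood of the node would be covered by the first subdomain alone. So every interface node off the
vertices belongs to a face or an edge.\<close>

lemma interface_node_shared:
  assumes "x \<in> interface_nodes X"
  shows "2 \<le> card (sharing X x)"
proof -
  obtain i where i: "i \<in> subs" "x \<in> boundary_nodes X i"
    using assms by (auto simp: interface_nodes_def)
  then have xi: "x \<in> subdomain X i" "x \<in> frontier (subdomain X i)" "x \<notin> frontier (dom X)"
    by (auto simp: boundary_nodes_def local_nodes_def)
  have "x \<in> closure (dom X)"
    using xi(1) i(1) by (auto simp: closure_dom)
  then have x_dom: "x \<in> dom X"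
    using xi(3) open_dom by (auto simp: frontier_def interior_open)
  let ?others = "\<Union>j\<in>subs - {i}. subdomain X j"
  have "x \<in> ?others"
  proof (rule ccontr)
    assume "x \<notin> ?others"
    have "open (dom X - ?others)"
      using open_dom closed_subdomain by (intro open_Diff closed_UN) auto
    moreover have "dom X - ?others \<subseteq> subdomain X i"
      using closure_subset[of "dom X"] unfolding closure_dom by blast
    ultimately have "dom X - ?others \<subseteq> interior (subdomain X i)"
      by (simp add: interior_maximal)
    then show False
      using x_dom \<open>x \<notin> ?others\<close> xi(2) by (auto simp: frontier_def)
  qed
  then obtain j where j: "j \<in> subs" "j \<noteq> i" "x \<in> subdomain X j"
    by blast
  have "x \<notin> interior (subdomain X j)"
    by (rule shared_point_not_interior[OF j(1) i(1) j(2) xi(1)])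
  then have "x \<in> frontier (subdomain X j)"
    using j(3) closure_subset[of "subdomain X j"] by (auto simp: frontier_def)
  then have "{i, j} \<subseteq> sharing X x"
    using i(1) j(1) xi(2) by (auto simp: sharing_def)
  moreover have "finite (sharing X x)"
    by (simp add: sharing_def)
  ultimately have "card {i, j} \<le> card (sharing X x)"
    by (intro card_mono)
  then show ?thesis
    using j(2) by simp
qed

lemma boundary_nodes_iff:
  assumes "i \<in> subs"
  shows "x \<in> boundary_nodes X i \<longleftrightarrow> x \<in> interface_nodes X \<and> i \<in> sharing X x"
proof
  assume "x \<in> boundary_nodes X i"
  then show "x \<in> interface_nodes X \<and> i \<in> sharing X x"
    using assms by (auto simp: interface_nodes_def sharing_def boundary_nodes_def)
next
  assume x: "x \<in> interface_nodes X \<and> i \<in> sharing X x"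
  then have "x \<in> nodes (mesh X) - frontier (dom X)"
    by (auto simp: interface_nodes_def boundary_nodes_def local_nodes_def)
  then show "x \<in> boundary_nodes X i"
    using x frontier_subdomain_subset[OF assms]
    by (auto simp: sharing_def boundary_nodes_def local_nodes_def)
qed

lemma finite_nodes: "finite (local_nodes X i)" "finite (boundary_nodes X i)" "finite (interface_nodes X)"
  using nodes_finite[OF mesh]
  by (auto simp: local_nodes_def boundary_nodes_def interface_nodes_def)

lemma verts_subset: "verts X \<subseteq> interface_nodes X"
  and class_equiv: "equiv (interface_nodes X - verts X) (class_rel X)"
  and class_sharing: "\<And>x y. (x, y) \<in> class_rel X \<Longrightarrow> sharing X x = sharing X y"
  using interface unfolding interface_partition_def by blast+

lemma class_subdoms:
  assumes "C \<in> (interface_nodes X - verts X) // class_rel X" and "x \<in> C"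
  shows "subdoms X C = sharing X x"
proof -
  have same: "sharing X y = sharing X x" if "y \<in> C" for y
    using quotient_eq_iff[OF class_equiv assms(1) assms(1) that assms(2)] by (intro class_sharing) simp
  show ?thesis
  proof (intro set_eqI iffI)
    fix i assume "i \<in> subdoms X C"
    then show "i \<in> sharing X x"
      using assms(2) by (auto simp: subdoms_def sharing_def)
  next
    fix i assume i: "i \<in> sharing X x"
    then have "i \<in> sharing X y" if "y \<in> C" for y
      using same[OF that] by simp
    then show "i \<in> subdoms X C"
      using i by (auto simp: subdoms_def sharing_def)
  qed
qed

lemma classes_eq: "classes = (interface_nodes X - verts X) // class_rel X"
proof -
  have "2 \<le> card (subdoms X C)" if C: "C \<in> (interface_nodes X - verts X) // class_rel X" for C
  proof -
    obtain x where "x \<in> C"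
      using in_quotient_imp_non_empty[OF class_equiv C] by blast
    moreover have "C \<subseteq> interface_nodes X - verts X"
      by (rule in_quotient_imp_subset[OF class_equiv C])
    ultimately show ?thesis
      using interface_node_shared class_subdoms[OF C] by auto
  qed
  then show ?thesis
    by (force simp: faces_def edges_def)
qed

lemma class_nonempty: "C \<in> classes \<Longrightarrow> C \<noteq> {}"
  using in_quotient_imp_non_empty[OF class_equiv] by (simp add: classes_eq)

lemma class_subset: "C \<in> classes \<Longrightarrow> C \<subseteq> interface_nodes X - verts X"
  using in_quotient_imp_subset[OF class_equiv] by (simp add: classes_eq)

lemma finite_class: "C \<in> classes \<Longrightarrow> finite C"
  using class_subset finite_nodes(3) finite_subset by blast

lemma finite_classes: "finite classes"
proof -
  have "classes \<subseteq> Pow (interface_nodes X)"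
    using class_subset by blast
  then show ?thesis
    by (rule finite_subset) (simp add: finite_nodes)
qed

lemma class_unique: "C \<in> classes \<Longrightarrow> C' \<in> classes \<Longrightarrow> x \<in> C \<Longrightarrow> x \<in> C' \<Longrightarrow> C = C'"
  using quotient_disj[OF class_equiv] unfolding classes_eq by blast

lemma subdoms_eq_sharing: "C \<in> classes \<Longrightarrow> x \<in> C \<Longrightarrow> subdoms X C = sharing X x"
  using class_subdoms by (simp add: classes_eq)

lemma finite_subdoms: "finite (subdoms X C)" "subdoms X C \<subseteq> subs"
  by (auto simp: subdoms_def)

lemma interface_node_cases:
  assumes "x \<in> interface_nodes X"
  obtains "x \<in> verts X" | C where "C \<in> classes" "x \<in> C"
proof (cases "x \<in> verts X")
  case False
  then have "x \<in> class_rel X `` {x}" "class_rel X `` {x} \<in> classes"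
    using assms equiv_class_self[OF class_equiv] by (auto simp: classes_eq quotientI)
  then show thesis using that(2) by blast
qed (rule that(1))

lemma class_subset_boundary:
  assumes "C \<in> classes" and "i \<in> subdoms X C"
  shows "C \<subseteq> boundary_nodes X i"
proof
  fix x assume x: "x \<in> C"
  have "i \<in> subs"
    using assms(2) finite_subdoms(2) by blast
  then show "x \<in> boundary_nodes X i"
    using x assms class_subset[OF assms(1)] subdoms_eq_sharing[OF assms(1) x]
    by (auto simp: boundary_nodes_iff)
qed

lemma stiffness_energy:
  assumes i: "i \<in> subs"
  shows "qf (local_nodes X i) (stiffness X i) v
      = (\<Sum>T\<in>submesh X i. element_weight X T *
          (norm (\<Sum>x\<in>local_nodes X i. v x *\<^sub>R element_gradient X T x))\<^sup>2)"
proof -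
  let ?r = "element_weight X" and ?g = "element_gradient X" and ?L = "local_nodes X i"
  have A: "stiffness X i x y = (\<Sum>T\<in>submesh X i. ?r T * (?g T x \<bullet> ?g T y))" if "x \<in> ?L" "y \<in> ?L" for x y
    using that by (intro stiffness_assembly(2)[OF fe i]) (auto simp: local_nodes_def)
  have "qf ?L (stiffness X i) v
      = (\<Sum>x\<in>?L. v x * (\<Sum>y\<in>?L. (\<Sum>T\<in>submesh X i. ?r T * (?g T x \<bullet> ?g T y)) * v y))"
    unfolding qf_def ip_def mvec_def by (simp add: A)
  also have "\<dots> = (\<Sum>x\<in>?L. \<Sum>y\<in>?L. \<Sum>T\<in>submesh X i. ?r T * (v x * v y * (?g T x \<bullet> ?g T y)))"
    by (simp add: sum_distrib_left sum_distrib_right mult_ac)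
  also have "\<dots> = (\<Sum>x\<in>?L. \<Sum>T\<in>submesh X i. \<Sum>y\<in>?L. ?r T * (v x * v y * (?g T x \<bullet> ?g T y)))"
    by (intro sum.cong refl sum.swap)
  also have "\<dots> = (\<Sum>T\<in>submesh X i. \<Sum>x\<in>?L. \<Sum>y\<in>?L. ?r T * (v x * v y * (?g T x \<bullet> ?g T y)))"
    by (rule sum.swap)
  also have "\<dots> = (\<Sum>T\<in>submesh X i. ?r T * (norm (\<Sum>x\<in>?L. v x *\<^sub>R ?g T x))\<^sup>2)"
    unfolding power2_norm_eq_inner
    by (simp add: inner_sum_left inner_sum_right sum_distrib_left mult_ac inner_commute)
  finally show ?thesis .
qed

lemma psd_stiffness:
  assumes i: "i \<in> subs"
  shows "psd_on (local_nodes X i) (stiffness X i)"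
  unfolding psd_on_def
proof (intro conjI allI)
  show "symmetric_on (local_nodes X i) (stiffness X i)"
    unfolding symmetric_on_def
  proof (intro ballI)
    fix x y assume "x \<in> local_nodes X i" "y \<in> local_nodes X i"
    then have "x \<in> nodes (mesh X) - frontier (dom X)" "y \<in> nodes (mesh X) - frontier (dom X)"
      by (auto simp: local_nodes_def)
    then show "stiffness X i x y = stiffness X i y x"
      by (simp only: stiffness_assembly(2)[OF fe i] inner_commute)
  qed
  show "0 \<le> qf (local_nodes X i) (stiffness X i) v" for v
    unfolding stiffness_energy[OF i] using submesh_subset[OF i]
    by (intro sum_nonneg mult_nonneg_nonneg less_imp_le[OF stiffness_assembly(1)[OF fe]]) auto
qed

lemma zero_gradients_imp_zero:
  assumes v: "\<And>i T. i \<in> subs \<Longrightarrow> T \<in> submesh X i \<Longrightarrow>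
        (\<Sum>x\<in>local_nodes X i. v x *\<^sub>R element_gradient X T x) = 0"
    and x: "x \<in> nodes (mesh X) - frontier (dom X)"
  shows "v x = 0"
proof (rule stiffness_assembly(4)[OF fe _ x])
  let ?free = "nodes (mesh X) - frontier (dom X)"
  fix T assume T: "T \<in> mesh X"
  then obtain i where i: "i \<in> subs" "T \<in> submesh X i"
    using mesh_cover by blast
  have "(\<Sum>x\<in>?free. v x *\<^sub>R element_gradient X T x) = (\<Sum>x\<in>local_nodes X i. v x *\<^sub>R element_gradient X T x)"
  proof (rule sum.mono_neutral_right)
    show "finite ?free"
      using nodes_finite[OF mesh] by simp
    show "\<forall>x\<in>?free - local_nodes X i. v x *\<^sub>R element_gradient X T x = 0"
    proof
      fix x assume x: "x \<in> ?free - local_nodes X i"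
      then have "x \<notin> T"
        using i(2) by (auto simp: local_nodes_def subdomain_def)
      then have "element_gradient X T x = 0"
        using x by (intro stiffness_assembly(3)[OF fe T]) auto
      then show "v x *\<^sub>R element_gradient X T x = 0"
        by simp
    qed
  qed (auto simp: local_nodes_def)
  then show "(\<Sum>x\<in>?free. v x *\<^sub>R element_gradient X T x) = 0"
    using v[OF i] by simp
qed

lemma boundary_nodes_eq: "local_nodes X i - interior_nodes X i = boundary_nodes X i"
  by (auto simp: interior_nodes_def boundary_nodes_def)

lemma psd_local_schur:
  assumes "i \<in> subs"
  shows "psd_on (boundary_nodes X i) (local_schur X i)"
  using psd_schur_complement[OF finite_nodes(1) psd_stiffness[OF assms], of "interior_nodes X i"]
  by (simp add: boundary_nodes_eq local_schur_def) (simp add: interior_nodes_def)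

lemma local_schur_extension:
  assumes "i \<in> subs"
  obtains v' where "\<And>x. x \<in> boundary_nodes X i \<Longrightarrow> v' x = v x"
    and "qf (local_nodes X i) (stiffness X i) v' = qf (boundary_nodes X i) (local_schur X i) v"
proof -
  have sub: "interior_nodes X i \<subseteq> local_nodes X i"
    by (auto simp: interior_nodes_def)
  obtain v' where "\<And>x. x \<notin> interior_nodes X i \<Longrightarrow> v' x = v x"
    and "qf (local_nodes X i) (stiffness X i) v' = qf (boundary_nodes X i) (local_schur X i) v"
    by (rule schur_complement_attained[OF finite_nodes(1) psd_stiffness[OF assms] sub, where v = v,
          unfolded boundary_nodes_eq, folded local_schur_def], rule that)
  then show thesis
    by (intro that[of v']) (auto simp: boundary_nodes_def interior_nodes_def)
qed

text \<open>The extensions of u to the subdomains that have zero energy agree on the interface, so they form one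
nodal vector on the whole domain, and all its gradients vanish.\<close>

lemma zero_energy_imp_zero:
  assumes zero: "\<And>i. i \<in> subs \<Longrightarrow> qf (boundary_nodes X i) (local_schur X i) u = 0"
    and x: "x \<in> interface_nodes X"
  shows "u x = 0"
proof -
  have "\<exists>v'. (\<forall>x\<in>boundary_nodes X i. v' x = u x) \<and> qf (local_nodes X i) (stiffness X i) v' = 0"
    if i: "i \<in> subs" for i
    by (rule local_schur_extension[OF i, of u]) (use zero[OF i] in auto)
  then obtain ext where ext: "\<And>i x. i \<in> subs \<Longrightarrow> x \<in> boundary_nodes X i \<Longrightarrow> ext i x = u x"
    and ext0: "\<And>i. i \<in> subs \<Longrightarrow> qf (local_nodes X i) (stiffness X i) (ext i) = 0"
    by metis
  define v where "v = (\<lambda>x. if x \<in> interface_nodes X then u x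
      else ext (SOME i. i \<in> subs \<and> x \<in> interior_nodes X i) x)"
  have v: "v x = ext i x" if i: "i \<in> subs" and x: "x \<in> local_nodes X i" for i x
  proof (cases "x \<in> boundary_nodes X i")
    case True
    then show ?thesis
      using i ext[OF i True] by (auto simp: v_def interface_nodes_def)
  next
    case False
    then have xi: "x \<in> interior_nodes X i"
      using x by (auto simp: interior_nodes_def boundary_nodes_def)
    have "(SOME i. i \<in> subs \<and> x \<in> interior_nodes X i) = i"
    proof (rule some_equality)
      fix j assume "j \<in> subs \<and> x \<in> interior_nodes X j"
      then show "j = i"
        using interior_node_unshared[OF i xi] by (auto simp: interior_nodes_def local_nodes_def)
    qed (use i xi in simp)
    then show ?thesis
      using interior_node_not_interface[OF i xi] by (simp add: v_def)
  qed
  let ?g = "element_gradient X"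
  have "(\<Sum>x\<in>local_nodes X i. v x *\<^sub>R ?g T x) = 0" if i: "i \<in> subs" and T: "T \<in> submesh X i" for i T
  proof -
    let ?e = "\<lambda>T. element_weight X T * (norm (\<Sum>x\<in>local_nodes X i. ext i x *\<^sub>R ?g T x))\<^sup>2"
    have r: "0 < element_weight X T" if "T \<in> submesh X i" for T
      using stiffness_assembly(1)[OF fe] submesh_subset[OF i] that by blast
    have "sum ?e (submesh X i) = 0"
      using stiffness_energy[OF i] ext0[OF i] by simp
    moreover have "finite (submesh X i)"
      using finite_subset[OF submesh_subset[OF i] mesh_finite[OF mesh]] .
    moreover have "0 \<le> ?e T" if "T \<in> submesh X i" for T
      using r[OF that] by simp
    ultimately have "?e T = 0"
      using T sum_nonneg_0[of "submesh X i" ?e T] by blast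
    then have "(\<Sum>x\<in>local_nodes X i. ext i x *\<^sub>R ?g T x) = 0"
      using r[OF T] by simp
    then show ?thesis
      using v[OF i] by simp
  qed
  moreover have "x \<in> nodes (mesh X) - frontier (dom X)"
    using x by (auto simp: interface_nodes_def boundary_nodes_def local_nodes_def)
  ultimately have "v x = 0"
    by (rule zero_gradients_imp_zero)
  then show ?thesis
    using x by (simp add: v_def)
qed

end

section \<open>Coordinates and the averaging operator\<close>

lemma sum_single:
  fixes f :: "'a \<Rightarrow> real"
  assumes "finite A" and "a \<in> A" and "\<And>b. b \<in> A \<Longrightarrow> b \<noteq> a \<Longrightarrow> f b = 0"
  shows "sum f A = f a"
proof -
  have "sum f A = sum f {a}"
    by (rule sum.mono_neutral_right) (use assms in auto)
  then show ?thesis by simp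
qed

lemma sum_modes:
  fixes f :: "coord \<Rightarrow> real"
  assumes "finite L" and "\<And>k. k < card C \<Longrightarrow> Mode C k \<in> L"
    and "\<And>c. c \<in> L \<Longrightarrow> c \<notin> Mode C ` {..<card C} \<Longrightarrow> f c = 0"
  shows "sum f L = (\<Sum>k<card C. f (Mode C k))"
proof -
  have "sum f L = sum f (Mode C ` {..<card C})"
    by (rule sum.mono_neutral_right) (use assms in auto)
  also have "\<dots> = (\<Sum>k<card C. f (Mode C k))"
    by (subst sum.reindex) (auto simp: inj_on_def)
  finally show ?thesis .
qed

context adaptive_bddc
begin

definition local_part :: "nat \<Rightarrow> (pcoord \<Rightarrow> real) \<Rightarrow> coord \<Rightarrow> real" where
  "local_part i w = mvec (pcoords X) (R_local i) w"

definition nodal :: "nat \<Rightarrow> (pcoord \<Rightarrow> real) \<Rightarrow> point \<Rightarrow> real" where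
  "nodal i w = mvec (local_coords X i) (basis_change X) (local_part i w)"

definition distribute :: "(coord \<Rightarrow> real) \<Rightarrow> pcoord \<Rightarrow> real" where
  "distribute v = mvec (coords X) R_tilde v"

definition average :: "(pcoord \<Rightarrow> real) \<Rightarrow> coord \<Rightarrow> real" where
  "average w = mvec (pcoords X) (mtrans R_tilde) (mvec (pcoords X) (D_tilde X) w)"

definition modes :: "point set \<Rightarrow> (coord \<Rightarrow> real) \<Rightarrow> point \<Rightarrow> real" where
  "modes C y = mvec {..<card C} (eigbasis X C) (\<lambda>k. y (Mode C k))"

lemma coords_iff:
  "Vertex v \<in> coords X \<longleftrightarrow> v \<in> verts X"
  "Mode C k \<in> coords X \<longleftrightarrow> C \<in> classes \<and> k < card C"
  by (auto simp: coords_def)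

lemma local_coords_iff:
  "Vertex v \<in> local_coords X i \<longleftrightarrow> v \<in> verts X \<and> i \<in> sharing X v"
  "Mode C k \<in> local_coords X i \<longleftrightarrow> C \<in> classes \<and> i \<in> subdoms X C \<and> k < card C"
  by (auto simp: local_coords_def)

lemma primal_coords_iff:
  "Vertex v \<in> primal_coords X \<longleftrightarrow> v \<in> verts X"
  "Mode C k \<in> primal_coords X \<longleftrightarrow> C \<in> classes \<and> k < card C \<and> selected X C k"
  by (auto simp: primal_coords_def)

lemma pcoords_iff:
  "Primal c \<in> pcoords X \<longleftrightarrow> c \<in> primal_coords X"
  "Dual i c \<in> pcoords X \<longleftrightarrow> i \<in> subs \<and> c \<in> local_coords X i \<and> c \<notin> primal_coords X"
  by (auto simp: pcoords_def)

lemma local_coords_subset: "local_coords X i \<subseteq> coords X"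
  by (auto simp: local_coords_def coords_def)

lemma primal_coords_subset: "primal_coords X \<subseteq> coords X"
  by (auto simp: primal_coords_def coords_def)

lemma finite_coords: "finite (coords X)" "finite (local_coords X i)" "finite (pcoords X)"
proof -
  have "finite (verts X)"
    using verts_subset finite_nodes(3) finite_subset by blast
  moreover have "coords X = Vertex ` verts X \<union> (\<Union>C\<in>classes. Mode C ` {..<card C})"
    by (auto simp: coords_def)
  ultimately show coords: "finite (coords X)"
    using finite_classes by simp
  then show "finite (local_coords X i)" for i
    using finite_subset[OF local_coords_subset] by blast
  have "pcoords X \<subseteq> Primal ` coords X \<union> (\<Union>i\<in>subs. Dual i ` coords X)"
  proof
    fix p assume p: "p \<in> pcoords X"
    show "p \<in> Primal ` coords X \<union> (\<Union>i\<in>subs. Dual i ` coords X)"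
    proof (cases p)
      case (Primal c)
      then have "c \<in> coords X"
        using p primal_coords_subset by (auto simp: pcoords_iff)
      then show ?thesis
        using Primal by blast
    next
      case (Dual i c)
      then have "c \<in> local_coords X i" and i: "i \<in> subs"
        using p pcoords_iff(2)[of i c] by simp_all
      then have "c \<in> coords X"
        using local_coords_subset by blast
      then show ?thesis
        using Dual i by blast
    qed
  qed
  then show "finite (pcoords X)"
    by (rule finite_subset) (use coords in simp)
qed

lemma basis_change_modes:
  assumes "L \<subseteq> coords X" and C: "C \<in> classes" and x: "x \<in> C"
    and "\<And>k. k < card C \<Longrightarrow> Mode C k \<in> L"
  shows "mvec L (basis_change X) y x = modes C y x"
proof -
  have "mvec L (basis_change X) y x = (\<Sum>k<card C. basis_change X x (Mode C k) * y (Mode C k))"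
    unfolding mvec_def
  proof (rule sum_modes)
    show "finite L"
      using finite_subset[OF assms(1)] finite_coords by blast
    fix c assume c: "c \<in> L" "c \<notin> Mode C ` {..<card C}"
    show "basis_change X x c * y c = 0"
    proof (cases c)
      case (Vertex v)
      then have "v \<in> verts X"
        using c(1) assms(1) coords_iff by blast
      then show ?thesis
        using Vertex x class_subset[OF C] by auto
    next
      case (Mode C' k)
      then have "C' \<in> classes" "k < card C'"
        using c(1) assms(1) coords_iff by blast+
      then have "x \<notin> C'"
        using class_unique[OF C _ x] c(2) Mode by auto
      then show ?thesis
        using Mode by simp
    qed
  qed (rule assms(4))
  then show ?thesis
    using x by (simp add: modes_def mvec_def)
qed

lemma basis_change_vertex:
  assumes "L \<subseteq> coords X" and x: "x \<in> verts X" and "Vertex x \<in> L"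
  shows "mvec L (basis_change X) y x = y (Vertex x)"
proof -
  have "mvec L (basis_change X) y x = basis_change X x (Vertex x) * y (Vertex x)"
    unfolding mvec_def
  proof (rule sum_single)
    show "finite L"
      using finite_subset[OF assms(1)] finite_coords by blast
    fix c assume c: "c \<in> L" "c \<noteq> Vertex x"
    show "basis_change X x c * y c = 0"
    proof (cases c)
      case (Mode C' k)
      then have "C' \<in> classes"
        using c(1) assms(1) coords_iff by blast
      then have "x \<notin> C'"
        using class_subset x by blast
      then show ?thesis
        using Mode by simp
    qed (use c in auto)
  qed (rule assms(3))
  then show ?thesis by simp
qed

lemma local_part_eq:
  assumes "i \<in> subs" and c: "c \<in> local_coords X i"
  shows "local_part i w c = w (if c \<in> primal_coords X then Primal c else Dual i c)"
proof -
  let ?p = "if c \<in> primal_coords X then Primal c else Dual i c"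
  have "local_part i w c = R_local i c ?p * w ?p"
    unfolding local_part_def mvec_def
  proof (rule sum_single)
    show "?p \<in> pcoords X"
      using assms by (simp add: pcoords_iff)
    fix p assume p: "p \<in> pcoords X" "p \<noteq> ?p"
    show "R_local i c p * w p = 0"
      using p by (cases p) (auto simp: pcoords_iff split: if_splits)
  qed (rule finite_coords)
  then show ?thesis by (simp split: if_splits)
qed

lemma distribute_eq:
  "Primal c \<in> pcoords X \<Longrightarrow> distribute v (Primal c) = v c"
  "Dual i c \<in> pcoords X \<Longrightarrow> distribute v (Dual i c) = v c"
proof -
  show "distribute v (Primal c) = v c" if "Primal c \<in> pcoords X"
  proof -
    have "distribute v (Primal c) = R_tilde (Primal c) c * v c"
      unfolding distribute_def mvec_def
      by (rule sum_single) (use that finite_coords primal_coords_subset in \<open>auto simp: pcoords_iff\<close>)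
    then show ?thesis by simp
  qed
  show "distribute v (Dual i c) = v c" if "Dual i c \<in> pcoords X"
  proof -
    have "distribute v (Dual i c) = R_tilde (Dual i c) c * v c"
      unfolding distribute_def mvec_def
      by (rule sum_single) (use that finite_coords local_coords_subset in \<open>auto simp: pcoords_iff\<close>)
    then show ?thesis by simp
  qed
qed

lemma local_part_distribute:
  assumes "i \<in> subs" and "c \<in> local_coords X i"
  shows "local_part i (distribute v) c = v c"
  using assms by (auto simp: local_part_eq pcoords_iff distribute_eq)

lemma nodal_modes:
  assumes "C \<in> classes" and "i \<in> subdoms X C" and "x \<in> C"
  shows "nodal i w x = modes C (local_part i w) x"
  unfolding nodal_def
  by (rule basis_change_modes[OF local_coords_subset]) (use assms in \<open>auto simp: local_coords_iff\<close>)

lemma nodal_vertex: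
  assumes "x \<in> verts X" and "i \<in> sharing X x"
  shows "nodal i w x = w (Primal (Vertex x))"
proof -
  have i: "i \<in> subs"
    using assms(2) by (simp add: sharing_def)
  have c: "Vertex x \<in> local_coords X i"
    using assms by (simp add: local_coords_iff)
  have "nodal i w x = local_part i w (Vertex x)"
    unfolding nodal_def by (rule basis_change_vertex[OF local_coords_subset assms(1) c])
  then show ?thesis
    using assms(1) by (simp add: local_part_eq[OF i c] primal_coords_iff)
qed

lemma nodal_diff: "nodal i (\<lambda>p. u p - w p) x = nodal i u x - nodal i w x"
  unfolding nodal_def local_part_def mvec_diff ..

lemma modes_cong: "(\<And>k. k < card C \<Longrightarrow> y (Mode C k) = y' (Mode C k)) \<Longrightarrow> modes C y x = modes C y' x"
  unfolding modes_def by (rule mvec_cong) simp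

lemma modes_diff: "modes C (\<lambda>c. y c - y' c) x = modes C y x - modes C y' x"
  by (simp add: modes_def mvec_diff)

lemma S_tilde_ip:
  "ip (pcoords X) u (mvec (pcoords X) (S_tilde X) w)
    = (\<Sum>i\<in>subs. ip (boundary_nodes X i) (nodal i u) (mvec (boundary_nodes X i) (local_schur X i) (nodal i w)))"
  unfolding S_tilde_def mvec_matrix_sum mvec_mmult ip_sum_right ip_adjoint_mtrans
    transformed_schur_def nodal_def local_part_def ..

lemma S_tilde_energy:
  "qf (pcoords X) (S_tilde X) w = (\<Sum>i\<in>subs. qf (boundary_nodes X i) (local_schur X i) (nodal i w))"
  unfolding qf_def by (rule S_tilde_ip)

lemma average_eq:
  assumes "c \<in> coords X"
  shows "average w c = (\<Sum>i | i \<in> subs \<and> c \<in> local_coords X i.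
    mvec (local_coords X i) (transformed_scal X i) (local_part i w) c)"
proof -
  let ?e = "\<lambda>d. if d = c then 1 else (0::real)"
  let ?y = "\<lambda>i. mvec (local_coords X i) (transformed_scal X i) (local_part i w)"
  have "average w c = ip (coords X) ?e (average w)"
    using assms finite_coords by (simp add: ip_unit_left)
  also have "\<dots> = ip (pcoords X) (distribute ?e) (mvec (pcoords X) (D_tilde X) w)"
    unfolding average_def distribute_def by (rule ip_adjoint_mtrans)
  also have "\<dots> = (\<Sum>i\<in>subs. ip (local_coords X i) (local_part i (distribute ?e)) (?y i))"
    unfolding D_tilde_def mvec_matrix_sum mvec_mmult ip_sum_right ip_adjoint_mtrans local_part_def ..
  also have "\<dots> = (\<Sum>i\<in>subs. if c \<in> local_coords X i then ?y i c else 0)"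
  proof (rule sum.cong[OF refl])
    fix i assume i: "i \<in> subs"
    have "ip (local_coords X i) (local_part i (distribute ?e)) (?y i) = ip (local_coords X i) ?e (?y i)"
      by (rule ip_cong) (simp_all only: local_part_distribute[OF i])
    also have "\<dots> = (if c \<in> local_coords X i then ?y i c else 0)"
    proof (cases "c \<in> local_coords X i")
      case False
      then show ?thesis
        unfolding ip_def by (subst sum.neutral) auto
    qed (simp add: ip_unit_left[OF finite_coords(2)])
    finally show "ip (local_coords X i) (local_part i (distribute ?e)) (?y i)
        = (if c \<in> local_coords X i then ?y i c else 0)" .
  qed
  also have "\<dots> = (\<Sum>i | i \<in> subs \<and> c \<in> local_coords X i. ?y i c)"
    by (rule sum.inter_filter[symmetric]) simp
  finally show ?thesis .
qed

lemma scaling_vertex: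
  assumes "Vertex v \<in> local_coords X i"
  shows "mvec (local_coords X i) (transformed_scal X i) y (Vertex v) = scal_vert X i v * y (Vertex v)"
proof -
  have "mvec (local_coords X i) (transformed_scal X i) y (Vertex v)
      = transformed_scal X i (Vertex v) (Vertex v) * y (Vertex v)"
    unfolding mvec_def
  proof (rule sum_single[OF finite_coords(2) assms])
    fix c assume "c \<noteq> Vertex v"
    then show "transformed_scal X i (Vertex v) c * y c = 0"
      by (cases c) auto
  qed
  then show ?thesis by simp
qed

abbreviation eigbasis_inverse :: "point set \<Rightarrow> (nat, point) matx" where
  "eigbasis_inverse C \<equiv> minverse C {..<card C} (eigbasis X C)"

lemma scaling_modes:
  assumes "C \<in> classes" and "i \<in> subdoms X C"
  shows "mvec (local_coords X i) (transformed_scal X i) y (Mode C k)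
    = mvec C (eigbasis_inverse C) (mvec C (scal X i C) (modes C y)) k"
proof -
  have "mvec (local_coords X i) (transformed_scal X i) y (Mode C k)
      = (\<Sum>l<card C. transformed_scal X i (Mode C k) (Mode C l) * y (Mode C l))"
    unfolding mvec_def
  proof (rule sum_modes[OF finite_coords(2)])
    show "Mode C l \<in> local_coords X i" if "l < card C" for l
      using assms that by (simp add: local_coords_iff)
    fix c assume "c \<in> local_coords X i" "c \<notin> Mode C ` {..<card C}"
    then show "transformed_scal X i (Mode C k) c * y c = 0"
      by (cases c) (auto simp: local_coords_iff)
  qed
  also have "\<dots> = mvec {..<card C} (mmult C (eigbasis_inverse C) (mmult C (scal X i C) (eigbasis X C)))
      (\<lambda>l. y (Mode C l)) k"
    by (simp add: mvec_def)
  finally show ?thesis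
    by (simp only: mvec_mmult modes_def)
qed

lemma eigenbasis_orthonormal:
  assumes "C \<in> classes"
  shows "meq {..<card C} {..<card C}
       (mmult C (mtrans (eigbasis X C)) (mmult C (eig_lhs X C) (eigbasis X C))) mone"
  using eigenbases assms unfolding adaptive_eigenbases_def by blast

lemma eigbasis_inverse:
  assumes C: "C \<in> classes"
  shows "k < card C \<Longrightarrow> mvec C (eigbasis_inverse C) (mvec {..<card C} (eigbasis X C) c) k = c k"
    and "x \<in> C \<Longrightarrow> mvec {..<card C} (eigbasis X C) (mvec C (eigbasis_inverse C) v) x = v x"
proof -
  let ?P = "eigbasis X C" and ?K = "{..<card C}"
  let ?Q = "\<lambda>Y. meq ?K ?K (mmult C Y ?P) mone \<and> meq C C (mmult ?K ?P Y) mone"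
  let ?Y = "mmult C (mtrans ?P) (eig_lhs X C)"
  have YP: "meq ?K ?K (mmult C ?Y ?P) mone"
  proof (rule meqI_mvec)
    fix v k assume "k \<in> ?K"
    then show "mvec ?K (mmult C ?Y ?P) v k = mvec ?K mone v k"
      using meq_mvec[OF eigenbasis_orthonormal[OF C], of k v] by (simp only: mvec_mmult)
  qed simp
  have "meq C C (mmult ?K ?P ?Y) mone"
    by (rule left_inverse_imp_right_inverse[OF finite_class[OF C] finite_lessThan _ YP]) simp
  with YP have "?Q ?Y" by blast
  then have Q: "?Q (eigbasis_inverse C)"
    unfolding minverse_def by (rule someI[of ?Q])
  show "mvec C (eigbasis_inverse C) (mvec ?K ?P c) k = c k" if "k < card C"
    using meq_mvec[OF conjunct1[OF Q], of k c] mvec_mone[OF finite_lessThan, of k "card C" c] that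
    by (simp add: mvec_mmult)
  show "mvec ?K ?P (mvec C (eigbasis_inverse C) v) x = v x" if "x \<in> C"
    using meq_mvec[OF conjunct2[OF Q] that, of v] mvec_mone[OF finite_class[OF C] that, of v]
    by (simp add: mvec_mmult)
qed

lemma scaling_unity:
  assumes C: "C \<in> classes" and "x \<in> C"
  shows "(\<Sum>l\<in>subdoms X C. mvec C (scal X l C) v x) = v x"
proof -
  have "meq C C (\<lambda>x y. \<Sum>l\<in>subdoms X C. scal X l C x y) mone"
    using unity C unfolding partition_of_unity_def by blast
  from meq_mvec[OF this assms(2), of v] show ?thesis
    by (simp add: mvec_matrix_sum mvec_mone[OF finite_class[OF C] assms(2)])
qed

lemma average_vertex:
  assumes "v \<in> verts X"
  shows "average w (Vertex v) = w (Primal (Vertex v))"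
proof -
  have "average w (Vertex v) = (\<Sum>i | i \<in> subs \<and> Vertex v \<in> local_coords X i.
      mvec (local_coords X i) (transformed_scal X i) (local_part i w) (Vertex v))"
    using assms by (intro average_eq) (simp add: coords_iff)
  also have "\<dots> = (\<Sum>i\<in>sharing X v. scal_vert X i v * w (Primal (Vertex v)))"
  proof (rule sum.cong)
    show "{i. i \<in> subs \<and> Vertex v \<in> local_coords X i} = sharing X v"
      using assms by (auto simp: local_coords_iff sharing_def)
    fix i assume i: "i \<in> sharing X v"
    then have "i \<in> subs" "Vertex v \<in> local_coords X i"
      using assms by (simp_all add: local_coords_iff sharing_def)
    then show "mvec (local_coords X i) (transformed_scal X i) (local_part i w) (Vertex v)
        = scal_vert X i v * w (Primal (Vertex v))"
      using assms by (simp add: scaling_vertex local_part_eq primal_coords_iff)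
  qed
  also have "\<dots> = (\<Sum>i\<in>sharing X v. scal_vert X i v) * w (Primal (Vertex v))"
    by (rule sum_distrib_right[symmetric])
  also have "\<dots> = w (Primal (Vertex v))"
    using unity assms by (simp add: partition_of_unity_def)
  finally show ?thesis .
qed

text \<open>In nodal values the averaging is multiplication by the original scalings; the change of basis cancels
because the eigenbasis is invertible.\<close>

lemma average_modes:
  assumes C: "C \<in> classes" and x: "x \<in> C"
  shows "modes C (average w) x = (\<Sum>l\<in>subdoms X C. mvec C (scal X l C) (nodal l w) x)"
proof -
  have avg: "average w (Mode C k)
      = mvec C (eigbasis_inverse C) (\<lambda>y. \<Sum>l\<in>subdoms X C. mvec C (scal X l C) (nodal l w) y) k"
    if k: "k < card C" for k
  proof -
    have "average w (Mode C k) = (\<Sum>i | i \<in> subs \<and> Mode C k \<in> local_coords X i.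
        mvec (local_coords X i) (transformed_scal X i) (local_part i w) (Mode C k))"
      using C k by (intro average_eq) (simp add: coords_iff)
    also have "\<dots> = (\<Sum>i\<in>subdoms X C. mvec C (eigbasis_inverse C) (mvec C (scal X i C) (nodal i w)) k)"
    proof (rule sum.cong)
      show "{i. i \<in> subs \<and> Mode C k \<in> local_coords X i} = subdoms X C"
        using C k by (auto simp: local_coords_iff subdoms_def)
      fix i assume i: "i \<in> subdoms X C"
      have "mvec C (eigbasis_inverse C) (mvec C (scal X i C) (modes C (local_part i w))) k
          = mvec C (eigbasis_inverse C) (mvec C (scal X i C) (nodal i w)) k"
        by (intro mvec_cong) (simp add: nodal_modes[OF C i])
      then show "mvec (local_coords X i) (transformed_scal X i) (local_part i w) (Mode C k)
          = mvec C (eigbasis_inverse C) (mvec C (scal X i C) (nodal i w)) k"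
        by (simp add: scaling_modes[OF C i])
    qed
    finally show ?thesis
      by (simp add: mvec_sum)
  qed
  have "modes C (average w) x = mvec {..<card C} (eigbasis X C)
      (mvec C (eigbasis_inverse C) (\<lambda>y. \<Sum>l\<in>subdoms X C. mvec C (scal X l C) (nodal l w) y)) x"
    unfolding modes_def by (rule mvec_cong) (simp add: avg)
  then show ?thesis
    by (simp add: eigbasis_inverse(2)[OF C x])
qed

lemma nodal_distribute:
  assumes C: "C \<in> classes" and i: "i \<in> subdoms X C" and x: "x \<in> C"
  shows "nodal i (distribute v) x = modes C v x"
proof -
  have "i \<in> subs"
    using i finite_subdoms(2) by blast
  then have "modes C (local_part i (distribute v)) x = modes C v x"
    using C i by (intro modes_cong) (simp add: local_part_distribute local_coords_iff)
  then show ?thesis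
    by (simp add: nodal_modes[OF assms])
qed

lemma average_distribute:
  assumes "c \<in> coords X"
  shows "average (distribute v) c = v c"
proof (cases c)
  case (Vertex x)
  then show ?thesis
    using assms by (simp add: average_vertex coords_iff distribute_eq pcoords_iff primal_coords_iff)
next
  case (Mode C k)
  then have C: "C \<in> classes" and k: "k < card C"
    using assms coords_iff by blast+
  have "modes C (average (distribute v)) x = modes C v x" if x: "x \<in> C" for x
  proof -
    have "modes C (average (distribute v)) x = (\<Sum>l\<in>subdoms X C. mvec C (scal X l C) (modes C v) x)"
      unfolding average_modes[OF C x]
      by (intro sum.cong refl mvec_cong) (simp add: nodal_distribute[OF C])
    then show ?thesis
      by (simp add: scaling_unity[OF C x])
  qed
  then have "mvec C (eigbasis_inverse C) (modes C (average (distribute v))) k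
      = mvec C (eigbasis_inverse C) (modes C v) k"
    by (rule mvec_cong)
  then show ?thesis
    using k by (simp add: modes_def eigbasis_inverse(1)[OF C] Mode)
qed

lemma jump_vertex:
  assumes "x \<in> verts X" and "i \<in> sharing X x"
  shows "nodal i (\<lambda>p. w p - distribute (average w) p) x = 0"
  using assms by (simp add: nodal_diff nodal_vertex distribute_eq pcoords_iff primal_coords_iff average_vertex)

text \<open>The partition of unity writes the nodal values in subdomain i as the sum of their scalings, so that the
term \<open>l = i\<close> cancels.\<close>

lemma jump_class:
  assumes C: "C \<in> classes" and i: "i \<in> subdoms X C" and x: "x \<in> C"
  shows "nodal i (\<lambda>p. w p - distribute (average w) p) x
    = (\<Sum>l\<in>subdoms X C - {i}. mvec C (scal X l C) (\<lambda>y. nodal i w y - nodal l w y) x)"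
proof -
  have "nodal i (\<lambda>p. w p - distribute (average w) p) x
      = nodal i w x - (\<Sum>l\<in>subdoms X C. mvec C (scal X l C) (nodal l w) x)"
    by (simp add: nodal_diff nodal_distribute[OF assms] average_modes[OF C x])
  also have "\<dots> = (\<Sum>l\<in>subdoms X C. mvec C (scal X l C) (\<lambda>y. nodal i w y - nodal l w y) x)"
    by (simp add: mvec_diff sum_subtractf scaling_unity[OF C x])
  also have "\<dots> = (\<Sum>l\<in>subdoms X C - {i}. mvec C (scal X l C) (\<lambda>y. nodal i w y - nodal l w y) x)"
    by (rule sum.mono_neutral_right) (auto simp: finite_subdoms mvec_def)
  finally show ?thesis .
qed

end

section \<open>Energy of the jump\<close>

context adaptive_bddc
begin

abbreviation energy :: "nat \<Rightarrow> (point \<Rightarrow> real) \<Rightarrow> real" where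
  "energy i v \<equiv> qf (boundary_nodes X i) (local_schur X i) v"

lemma subdoms_index: "i \<in> subdoms X C \<Longrightarrow> i \<in> subs"
  by (simp add: subdoms_def)

lemma class_schur_energy:
  assumes C: "C \<in> classes" and i: "i \<in> subdoms X C"
  shows "psd_on C (class_schur X i C)" and "qf C (class_schur X i C) v \<le> energy i v"
proof -
  have "boundary_nodes X i - (boundary_nodes X i - C) = C"
    using class_subset_boundary[OF C i] by blast
  then show "psd_on C (class_schur X i C)" "qf C (class_schur X i C) v \<le> energy i v"
    using psd_schur_complement[OF finite_nodes(2) psd_local_schur[OF subdoms_index[OF i]], of "boundary_nodes X i - C"]
      schur_complement_le[OF finite_nodes(2) psd_local_schur[OF subdoms_index[OF i]], of "boundary_nodes X i - C" v]
    by (simp_all add: class_schur_def)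
qed

lemma eig_rhs_energy:
  assumes C: "C \<in> classes"
  shows "psd_on C (eig_rhs X C)" and "i \<in> subdoms X C \<Longrightarrow> qf C (eig_rhs X C) v \<le> energy i v"
proof -
  let ?As = "map (\<lambda>m. class_schur X m C) (sorted_list_of_set (subdoms X C))"
  have set: "set ?As = (\<lambda>m. class_schur X m C) ` subdoms X C"
    by (simp add: finite_subdoms)
  have psd: "psd_on C A" if "A \<in> set ?As" for A
    using that class_schur_energy(1)[OF C] unfolding set by blast
  show "psd_on C (eig_rhs X C)"
    unfolding eig_rhs_def by (rule parallel_sums_psd(1)[OF finite_class[OF C] psd])
  assume i: "i \<in> subdoms X C"
  then have mem: "class_schur X i C \<in> set ?As"
    unfolding set by blast
  have "qf C (eig_rhs X C) v \<le> qf C (class_schur X i C) v"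
    unfolding eig_rhs_def by (rule parallel_sums_psd(2)[OF finite_class[OF C] psd mem])
  also have "\<dots> \<le> energy i v"
    by (rule class_schur_energy(2)[OF C i])
  finally show "qf C (eig_rhs X C) v \<le> energy i v" .
qed

text \<open>This estimate serves twice: it bounds the jump, and for vectors of zero energy it shows that the dual
coordinates vanish.\<close>

lemma unselected_coefficients:
  assumes C: "C \<in> classes" and i: "i \<in> subdoms X C"
  shows "(\<Sum>k | k < card C \<and> \<not> selected X C k. (local_part i w (Mode C k))\<^sup>2) \<le> tol X * energy i (nodal i w)"
proof -
  let ?U = "{k. k < card C \<and> \<not> selected X C k}" and ?c = "\<lambda>k. local_part i w (Mode C k)"
  have "(\<Sum>k\<in>?U. (?c k)\<^sup>2) \<le> tol X * qf C (eig_rhs X C) (mvec {..<card C} (eigbasis X C) ?c)"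
  proof (rule small_eigenvalue_coefficients[OF eig_rhs_energy(1)[OF C] _ eigenbasis_orthonormal[OF C]])
    show "gen_eigenpair C (eig_lhs X C) (eig_rhs X C) (eigval X C k) (\<lambda>x. eigbasis X C x k)"
      if "k < card C" for k
      using eigenbases C that unfolding adaptive_eigenbases_def by blast
    show "eigval X C k \<le> ereal (tol X)" if "k \<in> ?U" for k
      using that C by (auto simp: selected_def)
  qed (use tol_pos in auto)
  also have "qf C (eig_rhs X C) (mvec {..<card C} (eigbasis X C) ?c) = qf C (eig_rhs X C) (nodal i w)"
    by (rule qf_cong) (simp add: nodal_modes[OF C i] modes_def)
  also have "tol X * \<dots> \<le> tol X * energy i (nodal i w)"
    using eig_rhs_energy(2)[OF C i] tol_pos by (intro mult_left_mono) auto
  finally show ?thesis .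
qed

text \<open>The component in the unselected eigenvectors, that is, the \<open>z\<^sub>i\<close> of the jump formula.\<close>

definition dual_part :: "point set \<Rightarrow> nat \<Rightarrow> (pcoord \<Rightarrow> real) \<Rightarrow> point \<Rightarrow> real" where
  "dual_part C i w = modes C (\<lambda>c. if c \<in> primal_coords X then 0 else local_part i w c)"

lemma dual_part_energy:
  assumes C: "C \<in> classes" and i: "i \<in> subdoms X C"
  shows "qf C (eig_lhs X C) (dual_part C i w) \<le> tol X * energy i (nodal i w)"
proof -
  let ?c = "\<lambda>k. local_part i w (Mode C k)"
  have "qf C (eig_lhs X C) (dual_part C i w)
      = (\<Sum>k<card C. (if Mode C k \<in> primal_coords X then 0 else ?c k)\<^sup>2)"
    unfolding dual_part_def modes_def by (rule eigenbasis_energy[OF eigenbasis_orthonormal[OF C]])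
  also have "\<dots> = (\<Sum>k<card C. if \<not> selected X C k then (?c k)\<^sup>2 else 0)"
    using C by (intro sum.cong) (auto simp: primal_coords_iff)
  also have "\<dots> = (\<Sum>k | k \<in> {..<card C} \<and> \<not> selected X C k. (?c k)\<^sup>2)"
    by (rule sum.inter_filter[symmetric]) simp
  also have "\<dots> \<le> tol X * energy i (nodal i w)"
    using unselected_coefficients[OF assms, of w] by simp
  finally show ?thesis .
qed

text \<open>The primal coordinates have one common copy and cancel in differences.\<close>

lemma nodal_difference_dual:
  assumes C: "C \<in> classes" and i: "i \<in> subdoms X C" and l: "l \<in> subdoms X C" and x: "x \<in> C"
  shows "nodal i w x - nodal l w x = dual_part C i w x - dual_part C l w x"
proof -
  have "local_part i w (Mode C k) = local_part l w (Mode C k)"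
    if "k < card C" "Mode C k \<in> primal_coords X" for k
    using that C i l local_part_eq[OF subdoms_index[OF i], of "Mode C k" w]
      local_part_eq[OF subdoms_index[OF l], of "Mode C k" w]
    by (simp add: local_coords_iff)
  then have "modes C (\<lambda>c. local_part i w c - local_part l w c) x
    = modes C (\<lambda>c. (if c \<in> primal_coords X then 0 else local_part i w c)
        - (if c \<in> primal_coords X then 0 else local_part l w c)) x"
    by (intro modes_cong) simp
  then show ?thesis
    by (simp add: modes_diff nodal_modes[OF C _ x] i l dual_part_def)
qed

text \<open>The operator \<open>I - R R\<^sup>T D\<close>.\<close>

definition jump :: "(pcoord \<Rightarrow> real) \<Rightarrow> pcoord \<Rightarrow> real" where
  "jump w = (\<lambda>p. w p - distribute (average w) p)"

lemma class_jump_energy: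
  assumes C: "C \<in> classes"
  shows "(\<Sum>i\<in>subdoms X C. qf C (local_schur X i) (nodal i (jump w)))
    \<le> 2 * tol X * (real (card (subdoms X C)) - 1) * (\<Sum>i\<in>subdoms X C. energy i (nodal i w))"
proof -
  let ?N = "subdoms X C" and ?z = "\<lambda>i. dual_part C i w"
  have psd: "psd_on C (local_schur X i)" if "i \<in> ?N" for i
    by (rule psd_subset[OF psd_local_schur[OF subdoms_index[OF that]] finite_nodes(2) class_subset_boundary[OF C that]])
  have "qf C (local_schur X i) (nodal i (jump w))
      = qf C (local_schur X i) (\<lambda>x. \<Sum>l\<in>?N - {i}. mvec C (scal X l C) (\<lambda>y. ?z i y - ?z l y) x)"
    if i: "i \<in> ?N" for i
  proof (rule qf_cong)
    fix x assume x: "x \<in> C"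
    have "nodal i (jump w) x = (\<Sum>l\<in>?N - {i}. mvec C (scal X l C) (\<lambda>y. nodal i w y - nodal l w y) x)"
      unfolding jump_def by (rule jump_class[OF C i x])
    also have "\<dots> = (\<Sum>l\<in>?N - {i}. mvec C (scal X l C) (\<lambda>y. ?z i y - ?z l y) x)"
      by (intro sum.cong refl mvec_cong nodal_difference_dual[OF C i]) auto
    finally show "nodal i (jump w) x = (\<Sum>l\<in>?N - {i}. mvec C (scal X l C) (\<lambda>y. ?z i y - ?z l y) x)" .
  qed
  then have "(\<Sum>i\<in>?N. qf C (local_schur X i) (nodal i (jump w)))
      = (\<Sum>i\<in>?N. qf C (local_schur X i) (\<lambda>x. \<Sum>l\<in>?N - {i}. mvec C (scal X l C) (\<lambda>y. ?z i y - ?z l y) x))"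
    by simp
  also have "\<dots> \<le> 2 * (real (card ?N) - 1) * (\<Sum>i\<in>?N. qf C (eig_lhs X C) (?z i))"
    unfolding eig_lhs_def by (rule scaled_jump_energy[OF finite_subdoms(1) psd])
  also have "\<dots> \<le> 2 * (real (card ?N) - 1) * (\<Sum>i\<in>?N. tol X * energy i (nodal i w))"
  proof (intro mult_left_mono sum_mono dual_part_energy[OF C])
    have "2 \<le> card ?N"
      using C by (auto simp: faces_def edges_def)
    then show "0 \<le> 2 * (real (card ?N) - 1)" by simp
  qed
  also have "\<dots> = 2 * tol X * (real (card ?N) - 1) * (\<Sum>i\<in>?N. energy i (nodal i w))"
    by (simp add: sum_distrib_left[symmetric])
  finally show ?thesis .
qed

text \<open>The jump vanishes at the vertices, so it is the sum of its restrictions to faces and edges.\<close>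

lemma jump_energy_classwise:
  fixes w :: "pcoord \<Rightarrow> real"
  assumes i: "i \<in> subs"
  defines "a \<equiv> \<lambda>C. qf C (local_schur X i) (nodal i (jump w))"
  shows "energy i (nodal i (jump w))
    \<le> 2 * (real (card (faces_of X i)) * (\<Sum>F\<in>faces_of X i. a F)
        + real (card (edges_of X i)) * (\<Sum>E\<in>edges_of X i. a E))"
proof -
  let ?f = "nodal i (jump w)" and ?B = "boundary_nodes X i" and ?S = "local_schur X i"
  let ?r = "\<lambda>C x. if x \<in> C then ?f x else 0"
  have psd: "psd_on ?B ?S"
    by (rule psd_local_schur[OF i])
  have classes: "faces_of X i \<union> edges_of X i = {C \<in> classes. i \<in> subdoms X C}"
    and disj: "faces_of X i \<inter> edges_of X i = {}"
    by (auto simp: faces_of_def edges_of_def faces_def edges_def)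
  have fin: "finite (faces_of X i)" "finite (edges_of X i)"
    using finite_classes by (auto simp: faces_of_def edges_of_def)
  have restrict: "energy i (?r C) = a C" if "C \<in> classes" "i \<in> subdoms X C" for C
  proof -
    have "energy i (?r C) = qf C ?S (?r C)"
      by (rule qf_extend[OF finite_nodes(2) class_subset_boundary[OF that]]) simp
    also have "\<dots> = a C"
      unfolding a_def by (rule qf_cong) simp
    finally show ?thesis .
  qed
  have part: "energy i (\<lambda>x. \<Sum>C\<in>G. ?r C x) \<le> real (card G) * (\<Sum>C\<in>G. a C)"
    if "G \<subseteq> {C \<in> classes. i \<in> subdoms X C}" "finite G" for G
  proof -
    have "(\<Sum>C\<in>G. energy i (?r C)) = (\<Sum>C\<in>G. a C)"
      using that by (intro sum.cong restrict) auto
    then show ?thesis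
      using qf_sum_le[OF psd that(2), of ?r] by simp
  qed
  have "energy i ?f = energy i (\<lambda>x. (\<Sum>F\<in>faces_of X i. ?r F x) + (\<Sum>E\<in>edges_of X i. ?r E x))"
  proof (rule qf_cong)
    fix x assume "x \<in> ?B"
    then have x: "x \<in> interface_nodes X" "i \<in> sharing X x"
      using boundary_nodes_iff[OF i] by auto
    have "(\<Sum>F\<in>faces_of X i. ?r F x) + (\<Sum>E\<in>edges_of X i. ?r E x)
        = (\<Sum>C\<in>faces_of X i \<union> edges_of X i. ?r C x)"
      by (rule sum.union_disjoint[symmetric]) (use fin disj in auto)
    also have "\<dots> = ?f x"
    proof (rule interface_node_cases[OF x(1)])
      assume v: "x \<in> verts X"
      have f0: "?f x = 0"
        unfolding jump_def by (rule jump_vertex[OF v x(2)])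
      then have "?r C x = 0" for C
        by simp
      then show ?thesis
        by (simp only: f0 sum.neutral_const)
    next
      fix C assume C: "C \<in> classes" "x \<in> C"
      have "(\<Sum>C\<in>faces_of X i \<union> edges_of X i. ?r C x) = ?r C x"
      proof (rule sum_single)
        show "C \<in> faces_of X i \<union> edges_of X i"
          unfolding classes using C x(2) subdoms_eq_sharing[OF C] by simp
        show "?r C' x = 0" if "C' \<in> faces_of X i \<union> edges_of X i" "C' \<noteq> C" for C'
          using that class_unique[OF C(1) _ C(2), of C'] unfolding classes by auto
      qed (use fin in simp)
      then show ?thesis using C(2) by simp
    qed
    finally show "?f x = (\<Sum>F\<in>faces_of X i. ?r F x) + (\<Sum>E\<in>edges_of X i. ?r E x)"
      by simp
  qed
  also have "\<dots> \<le> 2 * (energy i (\<lambda>x. \<Sum>F\<in>faces_of X i. ?r F x) + energy i (\<lambda>x. \<Sum>E\<in>edges_of X i. ?r E x))"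
    by (rule psd_add_le[OF psd])
  also have "\<dots> \<le> 2 * (real (card (faces_of X i)) * (\<Sum>F\<in>faces_of X i. a F)
      + real (card (edges_of X i)) * (\<Sum>E\<in>edges_of X i. a E))"
    using classes fin by (intro mult_left_mono add_mono part) auto
  finally show ?thesis .
qed

text \<open>Faces and edges contribute \<open>4 * tol X\<close> times their constants: a factor \<open>2\<close> comes from the separation of faces
and edges and another one from the separation of \<open>z\<^sub>i\<close> and \<open>z\<^sub>l\<close>. The sum of the two constants is at most twice
their maximum.\<close>

lemma jump_bound:
  "qf (pcoords X) (S_tilde X) (jump w) \<le> bddc_const X * tol X * qf (pcoords X) (S_tilde X) w"
proof -
  let ?N = "subs" and ?Q = "\<lambda>i. energy i (nodal i w)"
  let ?a = "\<lambda>i C. qf C (local_schur X i) (nodal i (jump w))"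
  define KF where "KF = Max ((\<lambda>i. (card (faces_of X i))\<^sup>2) ` ?N)"
  define KE where "KE = Max ((\<lambda>i. (card (edges_of X i))\<^sup>2 * Max ((\<lambda>E. card (subdoms X E)) ` edges_of X i)) ` ?N)"
  have fin: "finite (faces X)" "finite (edges X)"
    using finite_classes by auto
  have Q: "0 \<le> ?Q i" if "i \<in> ?N" for i
    by (rule psd_nonneg[OF psd_local_schur[OF that]])
  have a: "0 \<le> ?a i C" if "C \<in> classes" "i \<in> subdoms X C" for i C
    by (rule psd_nonneg[OF psd_subset[OF psd_local_schur[OF subdoms_index[OF that(2)]] finite_nodes(2)
        class_subset_boundary[OF that]]])
  have sumQ: "0 \<le> (\<Sum>i\<in>subdoms X C. ?Q i)" for C
    using Q subdoms_index by (intro sum_nonneg) blast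
  have "(\<Sum>i\<in>?N. card (faces_of X i) * (\<Sum>F\<in>faces_of X i. ?a i F)) \<le> 2 * tol X * real KF * (\<Sum>i\<in>?N. ?Q i)"
    unfolding faces_of_def
  proof (rule weighted_class_count[where w = "\<lambda>F. 1"])
    show "(\<Sum>i\<in>subdoms X F. ?a i F) \<le> 2 * tol X * 1 * (\<Sum>i\<in>subdoms X F. ?Q i)" if F: "F \<in> faces X" for F
      using class_jump_energy[of F w] F by (simp add: faces_def)
    show "(real (card {F \<in> faces X. i \<in> subdoms X F}))\<^sup>2 * 1 \<le> real KF" if "i \<in> subdoms X F" for F i
    proof -
      have "(card (faces_of X i))\<^sup>2 \<le> KF"
        unfolding KF_def using subdoms_index[OF that] by (intro Max_ge) auto
      then show ?thesis
        unfolding faces_of_def by (simp flip: of_nat_power)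
    qed
  qed (use fin finite_subdoms(2) a Q tol_pos in auto)
  moreover have "(\<Sum>i\<in>?N. card (edges_of X i) * (\<Sum>E\<in>edges_of X i. ?a i E)) \<le> 2 * tol X * real KE * (\<Sum>i\<in>?N. ?Q i)"
    unfolding edges_of_def
  proof (rule weighted_class_count[where w = "\<lambda>E. real (card (subdoms X E))"])
    show "(\<Sum>i\<in>subdoms X E. ?a i E) \<le> 2 * tol X * real (card (subdoms X E)) * (\<Sum>i\<in>subdoms X E. ?Q i)"
      if E: "E \<in> edges X" for E
    proof -
      have "2 * tol X * (real (card (subdoms X E)) - 1) \<le> 2 * tol X * real (card (subdoms X E))"
        using tol_pos by simp
      then have "2 * tol X * (real (card (subdoms X E)) - 1) * (\<Sum>i\<in>subdoms X E. ?Q i)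
          \<le> 2 * tol X * real (card (subdoms X E)) * (\<Sum>i\<in>subdoms X E. ?Q i)"
        using sumQ by (rule mult_right_mono)
      then show ?thesis
        using class_jump_energy[of E w] E by simp
    qed
    show "(real (card {E \<in> edges X. i \<in> subdoms X E}))\<^sup>2 * real (card (subdoms X E)) \<le> real KE"
      if E: "E \<in> edges X" "i \<in> subdoms X E" for E i
    proof -
      have "finite (edges_of X i)" "E \<in> edges_of X i"
        using fin E by (simp_all add: edges_of_def)
      then have "card (subdoms X E) \<le> Max ((\<lambda>E. card (subdoms X E)) ` edges_of X i)"
        by (intro Max_ge) auto
      then have "(card (edges_of X i))\<^sup>2 * card (subdoms X E)
          \<le> (card (edges_of X i))\<^sup>2 * Max ((\<lambda>E. card (subdoms X E)) ` edges_of X i)"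
        by simp
      also have "\<dots> \<le> KE"
        unfolding KE_def using subdoms_index[OF E(2)] by (intro Max_ge) auto
      finally have "real ((card (edges_of X i))\<^sup>2 * card (subdoms X E)) \<le> real KE"
        by (simp only: of_nat_le_iff)
      then show ?thesis
        unfolding edges_of_def by simp
    qed
    show "0 < real (card (subdoms X E))" if "E \<in> edges X" for E
      using that by (simp add: edges_def)
  qed (use fin finite_subdoms(2) a Q tol_pos in auto)
  ultimately have sum_le: "(\<Sum>i\<in>?N. card (faces_of X i) * (\<Sum>F\<in>faces_of X i. ?a i F))
      + (\<Sum>i\<in>?N. card (edges_of X i) * (\<Sum>E\<in>edges_of X i. ?a i E))
      \<le> 2 * tol X * (real KF + real KE) * (\<Sum>i\<in>?N. ?Q i)"
    by (simp add: algebra_simps)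
  have "qf (pcoords X) (S_tilde X) (jump w) = (\<Sum>i\<in>?N. energy i (nodal i (jump w)))"
    by (rule S_tilde_energy)
  also have "\<dots> \<le> (\<Sum>i\<in>?N. 2 * (card (faces_of X i) * (\<Sum>F\<in>faces_of X i. ?a i F)
      + card (edges_of X i) * (\<Sum>E\<in>edges_of X i. ?a i E)))"
    by (intro sum_mono jump_energy_classwise)
  also have "\<dots> = 2 * ((\<Sum>i\<in>?N. card (faces_of X i) * (\<Sum>F\<in>faces_of X i. ?a i F))
      + (\<Sum>i\<in>?N. card (edges_of X i) * (\<Sum>E\<in>edges_of X i. ?a i E)))"
    by (simp add: sum.distrib sum_distrib_left)
  also have "\<dots> \<le> 2 * (2 * tol X * (real KF + real KE) * (\<Sum>i\<in>?N. ?Q i))"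
    using sum_le by simp
  also have "\<dots> \<le> bddc_const X * tol X * (\<Sum>i\<in>?N. ?Q i)"
  proof -
    have "real KF + real KE \<le> 2 * real (max KF KE)"
      by simp
    then have "4 * (real KF + real KE) \<le> bddc_const X"
      unfolding bddc_const_def KF_def[symmetric] KE_def[symmetric] by simp
    then have "4 * (real KF + real KE) * (tol X * (\<Sum>i\<in>?N. ?Q i)) \<le> bddc_const X * (tol X * (\<Sum>i\<in>?N. ?Q i))"
      using tol_pos Q by (intro mult_right_mono mult_nonneg_nonneg sum_nonneg) auto
    then show ?thesis
      by (simp add: algebra_simps)
  qed
  also have "(\<Sum>i\<in>?N. ?Q i) = qf (pcoords X) (S_tilde X) w"
    by (rule S_tilde_energy[symmetric])
  finally show ?thesis .
qed

text \<open>A vector w of zero energy has dual coordinates zero, so its local parts are restrictions of one vector v on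
the interface coordinates, whose nodal values u have zero energy in every subdomain.\<close>

lemma pd_S_tilde: "pd_on (pcoords X) (S_tilde X)"
  unfolding pd_on_def
proof (intro conjI allI impI)
  show "symmetric_on (pcoords X) (S_tilde X)"
  proof (rule symmetricI_bilinear[OF finite_coords(3)])
    fix u v
    show "ip (pcoords X) u (mvec (pcoords X) (S_tilde X) v) = ip (pcoords X) v (mvec (pcoords X) (S_tilde X) u)"
      unfolding S_tilde_ip
    proof (rule sum.cong[OF refl])
      fix i assume "i \<in> subs"
      from ip_symmetric[OF psd_symmetric[OF psd_local_schur[OF this]], of "nodal i u" "nodal i v"]
      show "ip (boundary_nodes X i) (nodal i u) (mvec (boundary_nodes X i) (local_schur X i) (nodal i v))
          = ip (boundary_nodes X i) (nodal i v) (mvec (boundary_nodes X i) (local_schur X i) (nodal i u))"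
        by (simp only: ip_commute)
    qed
  qed
  fix w :: "pcoord \<Rightarrow> real" assume nz: "\<exists>p\<in>pcoords X. w p \<noteq> 0"
  have nonneg: "0 \<le> energy i (nodal i w)" if "i \<in> subs" for i
    by (rule psd_nonneg[OF psd_local_schur[OF that]])
  have "qf (pcoords X) (S_tilde X) w \<noteq> 0"
  proof
    assume "qf (pcoords X) (S_tilde X) w = 0"
    then have sum0: "(\<Sum>i\<in>subs. energy i (nodal i w)) = 0"
      by (simp only: S_tilde_energy)
    have zero: "energy i (nodal i w) = 0" if "i \<in> subs" for i
      by (rule sum_nonneg_0[OF _ _ sum0 that]) (use nonneg in auto)
    have dual: "local_part i w (Mode C k) = 0"
      if C: "C \<in> classes" and i: "i \<in> subdoms X C" and k: "k < card C" "\<not> selected X C k" for C i k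
    proof -
      let ?U = "{k. k < card C \<and> \<not> selected X C k}"
      have "(\<Sum>k\<in>?U. (local_part i w (Mode C k))\<^sup>2) \<le> 0"
        using unselected_coefficients[OF C i, of w] zero[OF subdoms_index[OF i]] by simp
      then have "(\<Sum>k\<in>?U. (local_part i w (Mode C k))\<^sup>2) = 0"
        by (intro antisym sum_nonneg) auto
      then have "(local_part i w (Mode C k))\<^sup>2 = 0"
        by (rule sum_nonneg_0[rotated 2]) (use k in auto)
      then show ?thesis by simp
    qed
    define v where "v = (\<lambda>c. if c \<in> primal_coords X then w (Primal c) else 0)"
    define u where "u = mvec (coords X) (basis_change X) v"
    have local: "local_part i w c = v c" if i: "i \<in> subs" and c: "c \<in> local_coords X i" for i c
    proof (cases "c \<in> primal_coords X")
      case True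
      then show ?thesis
        by (simp add: local_part_eq[OF i c] v_def)
    next
      case False
      then show ?thesis
        using c dual by (cases c) (auto simp: local_coords_iff primal_coords_iff v_def)
    qed
    have u_modes: "u x = modes C v x" if "C \<in> classes" "x \<in> C" for C x
      unfolding u_def by (rule basis_change_modes[OF order_refl that]) (use that in \<open>simp add: coords_iff\<close>)
    have u_vertex: "u x = v (Vertex x)" if "x \<in> verts X" for x
      unfolding u_def by (rule basis_change_vertex[OF order_refl that]) (use that in \<open>simp add: coords_iff\<close>)
    have u: "u x = 0" if x: "x \<in> interface_nodes X" for x
    proof (rule zero_energy_imp_zero[OF _ x])
      fix i assume i: "i \<in> subs"
      have "nodal i w x = u x" if x: "x \<in> boundary_nodes X i" for x
      proof -
        have xi: "x \<in> interface_nodes X" "i \<in> sharing X x"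
          using x boundary_nodes_iff[OF i] by auto
        show ?thesis
        proof (rule interface_node_cases[OF xi(1)])
          assume vert: "x \<in> verts X"
          then show ?thesis
            using xi(2) by (simp add: nodal_vertex u_vertex v_def primal_coords_iff)
        next
          fix C assume C: "C \<in> classes" "x \<in> C"
          then have iC: "i \<in> subdoms X C"
            using subdoms_eq_sharing xi(2) by simp
          have "nodal i w x = modes C (local_part i w) x"
            by (rule nodal_modes[OF C(1) iC C(2)])
          also have "\<dots> = modes C v x"
            using C(1) iC by (intro modes_cong local[OF i]) (simp add: local_coords_iff)
          finally show ?thesis
            by (simp only: u_modes[OF C])
        qed
      qed
      then have "energy i u = energy i (nodal i w)"
        by (intro qf_cong) simp
      then show "energy i u = 0"
        by (simp only: zero[OF i])
    qed
    have v: "v c = 0" if "c \<in> coords X" for c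
    proof (cases c)
      case (Vertex x)
      then have "x \<in> verts X"
        using that coords_iff by blast
      then show ?thesis
        using u_vertex u verts_subset Vertex by (metis subsetD)
    next
      case (Mode C k)
      then have C: "C \<in> classes" and k: "k < card C"
        using that coords_iff by blast+
      have "modes C v x = 0" if "x \<in> C" for x
        using u_modes[OF C that] u class_subset[OF C] that by auto
      then have "mvec C (eigbasis_inverse C) (modes C v) k = 0"
        unfolding mvec_def[of C] by simp
      then show ?thesis
        using eigbasis_inverse(1)[OF C k, of "\<lambda>k. v (Mode C k)"] Mode by (simp add: modes_def)
    qed
    have "w p = 0" if p: "p \<in> pcoords X" for p
    proof (cases p)
      case (Primal c)
      then have "c \<in> primal_coords X"
        using p by (simp add: pcoords_iff)
      then show ?thesis
        using v[of c] primal_coords_subset Primal by (auto simp: v_def)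
    next
      case (Dual i c)
      then have c: "i \<in> subs" "c \<in> local_coords X i" "c \<notin> primal_coords X"
        using p pcoords_iff(2)[of i c] by simp_all
      then show ?thesis
        using local[OF c(1,2)] local_part_eq[OF c(1,2), of w] Dual by (simp add: v_def)
    qed
    with nz show False by blast
  qed
  moreover have "0 \<le> qf (pcoords X) (S_tilde X) w"
    unfolding S_tilde_energy by (rule sum_nonneg) (rule nonneg)
  ultimately show "0 < qf (pcoords X) (S_tilde X) w"
    by linarith
qed

lemma interface_nonempty:
  assumes "bddc_const X \<noteq> 0"
  shows "coords X \<noteq> {}"
proof
  assume empty: "coords X = {}"
  have "classes = {}"
  proof (rule ccontr)
    assume "classes \<noteq> {}"
    then obtain C where C: "C \<in> classes" by blast
    then have "0 < card C"
      using class_nonempty finite_class by (simp add: card_gt_0_iff)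
    then have "Mode C 0 \<in> coords X"
      using C by (simp add: coords_iff)
    then show False
      using empty by blast
  qed
  then have no_class: "faces_of X i = {}" "edges_of X i = {}" for i
    by (auto simp: faces_of_def edges_of_def)
  have "dom X \<noteq> {}"
    using fe by (simp add: fe_discretization_def)
  then have "subs \<noteq> {}"
    using closure_dom by auto
  then have "bddc_const X = 0"
    by (simp add: bddc_const_def no_class)
  with assms show False ..
qed

lemma condition_bound:
  assumes "1 \<le> bddc_const X * tol X"
  shows "cond_number (coords X) (mmult (coords X) (M_inv X) (S_hat X)) \<le> bddc_const X * tol X"
  unfolding M_inv_def S_hat_def
proof (rule bddc_condition_number[OF finite_coords(1) _ finite_coords(3) pd_S_tilde _ _ assms])
  show "coords X \<noteq> {}"
    using assms by (intro interface_nonempty) auto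
  show "mvec (pcoords X) (mtrans R_tilde) (mvec (pcoords X) (D_tilde X) (mvec (coords X) R_tilde v)) c = v c"
    if "c \<in> coords X" for v c
    using average_distribute[OF that] by (simp only: average_def distribute_def)
  show "qf (pcoords X) (S_tilde X) (\<lambda>p. w p - mvec (coords X) R_tilde
        (mvec (pcoords X) (mtrans R_tilde) (mvec (pcoords X) (D_tilde X) w)) p)
      \<le> bddc_const X * tol X * qf (pcoords X) (S_tilde X) w" for w
    using jump_bound[of w] by (simp only: jump_def average_def distribute_def)
qed

end

theorem theorem1:
  fixes X :: bddc
  assumes "fe_discretization X"
    and "interface_partition X"
    and "partition_of_unity X"
    and "adaptive_eigenbases X"
    and "1 \<le> bddc_const X * tol X"
  shows "cond_number (coords X) (mmult (coords X) (M_inv X) (S_hat X)) \<le> bddc_const X * tol X"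
proof -
  have "0 \<le> bddc_const X"
    by (simp add: bddc_const_def)
  then have "0 < tol X"
    using assms(5) by (smt (verit) mult_nonneg_nonpos)
  then interpret adaptive_bddc X
    using assms(1-4) by unfold_locales
  show ?thesis
    by (rule condition_bound[OF assms(5)])
qed

end
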